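(* Let $\psi:\mathbb{R}\to\mathbb{R}$ be an even continuous strictly positive function that is monotone increasing for $x\ge0$, with $\int_{-\infty}^\infty e^{-\psi^2(t)}dt<\infty$ and $\int_{-\infty}^{\infty}(1+\psi^2(s))^m e^{-\psi^2(s)}ds<\infty$ for all $m\in\mathbb{N}$. Let $\alpha\in\{0,1\}$ and let $X^{(\alpha,3)}=X^{(\alpha,3)}_{N,c,R}$ be the random variable defined in the context. Then in each of the three asymptotic regimes ($i=1$: $c^2R\gg N^2$; $i=2$: $c^2R=sN^2$ with $s>0$ fixed; $i=3$: $c^2R\ll N^2$ and $N^2\ll c^3R^2$) of the limiting transition $N,c,R\to\infty$, $R=o(N)$, $c=o(N)$, the following convergence in distribution holds: $$\frac1{\sqrt{d^{(i)}_{N,c,R}}}\left(X^{(\alpha,3)}-\mathbb{E}X^{(\alpha,3)}\right)\to\xi^{(\alpha,i)},\qquad i=1,2,3,$$ where $$d^{(1)}_{N,c,R}=\frac{c^5R^3}{N^4},\qquad d^{(2)}_{N,c,R}=cR,\qquad d^{(3)}_{N,c,R}=\frac{c^3R^2}{N^2},$$ and $\xi^{(\alpha,i)}$ is a centered normal random variable with variance $\varphi_2^{(\alpha,i)}$, $\varphi_2^{(\alpha,1)}=\Theta_2^{(\alpha,\mathrm{i})}$, $\varphi_2^{(\alpha,2)}=\Theta_2^{(\alpha,\mathrm{ii})}(s)$, $\varphi_2^{(\alpha,3)}=\Theta_2^{(\alpha,\mathrm{iii})}$.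
   Context: Let $N=2n+1$, $L_N=\{-n,\dots,n\}$, and let $c,R>0$ be parameters with $c\le N$. Let $a_{ij}=a_{ij}^{(N,c,R)}$, $-n\le i<j\le n$, be jointly independent random variables with values in $\{0,1\}$ and $P(a_{ij}=1)=\frac{c}{N}e^{-\psi^2((i-j)/R)}$; $\mathbb{E}$ is the corresponding expectation. For $\alpha\in\{0,1\}$ let $A^{(\alpha)}_{N,c,R}$ be the real symmetric $N\times N$ matrix (indexed by $L_N$) with zero diagonal and entries $\big(1+\alpha\psi^2(\tfrac{i-j}{R})\big)a_{ij}$ for $i<j$. Define $X^{(\alpha,3)}_{N,c,R}=\mathrm{Tr}\,\big(A^{(\alpha)}_{N,c,R}\big)^3$. $\mathrm{Cum}_2$ is the second cumulant (variance). The numbers $\Theta_2$ are the following limits (which exist), taken as $N,c,R\to\infty$, $R=o(N)$, $c=o(N)$: $\Theta_2^{(\alpha,\mathrm{i})}=\lim\frac1{cR}\mathrm{Cum}_2\big(\frac{N^2}{c^2R}X^{(\alpha,3)}\big)$ when $c^2R/N^2\to\infty$; $\Theta_2^{(\alpha,\mathrm{ii})}(s)=\lim\frac1{cR}\mathrm{Cum}_2(X^{(\alpha,3)})$ when $c^2R/N^2=s$; and $\Theta_2^{(\alpha,\mathrm{iii})}=\lim\frac{N^2}{c^3R^2}\mathrm{Cum}_2(X^{(\alpha,3)})$ when $c^2R/N^2\to0$, which equals $6\cdot\frac1{2\pi}\int_{-\infty}^\infty(\tilde h_2^{(\alpha)}(p))^3dp$ with $\tilde h_2^{(\alpha)}(p)=\int_{-\infty}^\infty(1+\alpha\psi^2(x))^2e^{-\psi^2(x)}e^{-ipx}dx$.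 The notation $x\gg y$ ($x\ll y$) means $x/y\to\infty$ ($x/y\to0$) along the limiting transition. *)

theory Defs
  imports "HOL-Probability.Probability" "Jordan_Normal_Form.Matrix"
begin

section \<open>The random matrices\<close>

definition labels :: "nat \<Rightarrow> int set" where
  "labels n = {- int n..int n}"

abbreviation dimN :: "nat \<Rightarrow> real" where
  "dimN n \<equiv> 2 * real n + 1"

text \<open>
  For every admissible triple \<open>(n, c, R)\<close> there is a probability space \<open>M n c R\<close> carrying the
  variables \<open>a n c R i j\<close>; nothing is assumed about the relation between different triples.
\<close>

definition edge_variables ::
  "(real \<Rightarrow> real) \<Rightarrow> (nat \<Rightarrow> real \<Rightarrow> real \<Rightarrow> 'w measure) \<Rightarrow>
   (nat \<Rightarrow> real \<Rightarrow> real \<Rightarrow> int \<Rightarrow> int \<Rightarrow> 'w \<Rightarrow> real) \<Rightarrow> bool" where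
  "edge_variables \<psi> M a \<longleftrightarrow>
     (\<forall>n c R. 0 < c \<and> c \<le> dimN n \<and> 0 < R \<longrightarrow>
        prob_space (M n c R) \<and>
        prob_space.indep_vars (M n c R) (\<lambda>_. borel) (\<lambda>(i, j). a n c R i j)
          {(i, j). i \<in> labels n \<and> j \<in> labels n \<and> i < j} \<and>
        (\<forall>i\<in>labels n. \<forall>j\<in>labels n. i < j \<longrightarrow>
           (\<forall>\<omega>\<in>space (M n c R). a n c R i j \<omega> \<in> {0, 1}) \<and>
           measure (M n c R) {\<omega> \<in> space (M n c R). a n c R i j \<omega> = 1}
             = c / dimN n * exp (- (\<psi> (real_of_int (i - j) / R))\<^sup>2)))"

text \<open>
  In the next two definitions \<open>e\<close> is a realization of the edge variables. Rows and columns
  \<open>0, \<dots>, 2n\<close> of the matrix stand for the labels \<open>-n, \<dots>, n\<close>.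
\<close>

definition adj_entry :: "nat \<Rightarrow> (real \<Rightarrow> real) \<Rightarrow> real \<Rightarrow> (int \<Rightarrow> int \<Rightarrow> real) \<Rightarrow> int \<Rightarrow> int \<Rightarrow> real" where
  "adj_entry \<alpha> \<psi> R e i j =
     (if i = j then 0
      else (1 + real \<alpha> * (\<psi> (real_of_int (min i j - max i j) / R))\<^sup>2) * e (min i j) (max i j))"

definition adj_matrix :: "nat \<Rightarrow> (real \<Rightarrow> real) \<Rightarrow> nat \<Rightarrow> real \<Rightarrow> (int \<Rightarrow> int \<Rightarrow> real) \<Rightarrow> real mat" where
  "adj_matrix \<alpha> \<psi> n R e =
     mat (2 * n + 1) (2 * n + 1) (\<lambda>(r, s). adj_entry \<alpha> \<psi> R e (int r - int n) (int s - int n))"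

definition mat_trace :: "real mat \<Rightarrow> real" where
  "mat_trace B = (\<Sum>r<dim_row B. B $$ (r, r))"

definition X3 ::
  "nat \<Rightarrow> (real \<Rightarrow> real) \<Rightarrow> (nat \<Rightarrow> real \<Rightarrow> real \<Rightarrow> int \<Rightarrow> int \<Rightarrow> 'w \<Rightarrow> real) \<Rightarrow>
   nat \<Rightarrow> real \<Rightarrow> real \<Rightarrow> 'w \<Rightarrow> real" where
  "X3 \<alpha> \<psi> a n c R \<omega> = mat_trace (adj_matrix \<alpha> \<psi> n R (\<lambda>i j. a n c R i j \<omega>) ^\<^sub>m 3)"

abbreviation Cum2 :: "'w measure \<Rightarrow> ('w \<Rightarrow> real) \<Rightarrow> real" where
  "Cum2 \<equiv> prob_space.variance"

section \<open>The limiting transitions\<close>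

text \<open>
  The transition \<open>N, c, R \<rightarrow> \<infinity>\<close>, \<open>R = o(N)\<close>, \<open>c = o(N)\<close> as a filter on triples \<open>(n, c, R)\<close>.
  Eventually along it \<open>0 < c \<le> N\<close> and \<open>0 < R\<close>.
\<close>

definition transition :: "(nat \<times> real \<times> real) filter" where
  "transition =
     inf (filtercomap (\<lambda>(n, c, R). n) at_top)
    (inf (filtercomap (\<lambda>(n, c, R). c) at_top)
    (inf (filtercomap (\<lambda>(n, c, R). R) at_top)
    (inf (filtercomap (\<lambda>(n, c, R). R / dimN n) (nhds 0))
         (filtercomap (\<lambda>(n, c, R). c / dimN n) (nhds 0)))))"

definition regime_i :: "(nat \<times> real \<times> real) filter" where
  "regime_i = inf transition (filtercomap (\<lambda>(n, c, R). c\<^sup>2 * R / (dimN n)\<^sup>2) at_top)"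

definition regime_ii :: "real \<Rightarrow> (nat \<times> real \<times> real) filter" where
  "regime_ii s = inf transition (principal {(n, c, R). c\<^sup>2 * R = s * (dimN n)\<^sup>2})"

definition regime_iii :: "(nat \<times> real \<times> real) filter" where
  "regime_iii = inf transition (filtercomap (\<lambda>(n, c, R). c\<^sup>2 * R / (dimN n)\<^sup>2) (nhds 0))"

text \<open>The third regime of the limit theorem additionally requires \<open>N\<^sup>2 \<ll> c\<^sup>3 R\<^sup>2\<close>.\<close>

definition regime_iii_clt :: "(nat \<times> real \<times> real) filter" where
  "regime_iii_clt =
     inf regime_iii (filtercomap (\<lambda>(n, c, R). (dimN n)\<^sup>2 / (c ^ 3 * R\<^sup>2)) (nhds 0))"

section \<open>The limiting variances\<close>

text \<open>
  \<open>Lim\<close> is a definite description, so that statements about these numbers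
  carry content only once the limits are shown to exist.
\<close>

definition Theta2_i ::
  "nat \<Rightarrow> (real \<Rightarrow> real) \<Rightarrow> (nat \<Rightarrow> real \<Rightarrow> real \<Rightarrow> 'w measure) \<Rightarrow>
   (nat \<Rightarrow> real \<Rightarrow> real \<Rightarrow> int \<Rightarrow> int \<Rightarrow> 'w \<Rightarrow> real) \<Rightarrow> real" where
  "Theta2_i \<alpha> \<psi> M a =
     Lim regime_i (\<lambda>(n, c, R). 1 / (c * R) *
       Cum2 (M n c R) (\<lambda>\<omega>. (dimN n)\<^sup>2 / (c\<^sup>2 * R) * X3 \<alpha> \<psi> a n c R \<omega>))"

definition Theta2_ii ::
  "nat \<Rightarrow> (real \<Rightarrow> real) \<Rightarrow> (nat \<Rightarrow> real \<Rightarrow> real \<Rightarrow> 'w measure) \<Rightarrow>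
   (nat \<Rightarrow> real \<Rightarrow> real \<Rightarrow> int \<Rightarrow> int \<Rightarrow> 'w \<Rightarrow> real) \<Rightarrow> real \<Rightarrow> real" where
  "Theta2_ii \<alpha> \<psi> M a s =
     Lim (regime_ii s) (\<lambda>(n, c, R). 1 / (c * R) * Cum2 (M n c R) (X3 \<alpha> \<psi> a n c R))"

definition Theta2_iii ::
  "nat \<Rightarrow> (real \<Rightarrow> real) \<Rightarrow> (nat \<Rightarrow> real \<Rightarrow> real \<Rightarrow> 'w measure) \<Rightarrow>
   (nat \<Rightarrow> real \<Rightarrow> real \<Rightarrow> int \<Rightarrow> int \<Rightarrow> 'w \<Rightarrow> real) \<Rightarrow> real" where
  "Theta2_iii \<alpha> \<psi> M a =
     Lim regime_iii (\<lambda>(n, c, R). (dimN n)\<^sup>2 / (c ^ 3 * R\<^sup>2) * Cum2 (M n c R) (X3 \<alpha> \<psi> a n c R))"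

section \<open>Normalized fluctuations\<close>

definition fluctuation_law ::
  "(nat \<Rightarrow> real \<Rightarrow> real \<Rightarrow> real) \<Rightarrow> nat \<Rightarrow> (real \<Rightarrow> real) \<Rightarrow> (nat \<Rightarrow> real \<Rightarrow> real \<Rightarrow> 'w measure) \<Rightarrow>
   (nat \<Rightarrow> real \<Rightarrow> real \<Rightarrow> int \<Rightarrow> int \<Rightarrow> 'w \<Rightarrow> real) \<Rightarrow> nat \<times> real \<times> real \<Rightarrow> real measure" where
  "fluctuation_law d \<alpha> \<psi> M a = (\<lambda>(n, c, R).
     distr (M n c R) borel (\<lambda>\<omega>. 1 / sqrt (d n c R) *
       (X3 \<alpha> \<psi> a n c R \<omega> - prob_space.expectation (M n c R) (X3 \<alpha> \<psi> a n c R))))"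

text \<open>A probability measure only for \<open>v > 0\<close>; for \<open>v = 0\<close> this is the null measure.\<close>

definition centered_normal :: "real \<Rightarrow> real measure" where
  "centered_normal v = density lborel (\<lambda>x. ennreal (normal_density 0 (sqrt v) x))"

end

(*
  Each product of edge indicators along a triangle overlaps few others, so the characteristic
  function f of the centred count nearly satisfies the Gaussian equation f'(t) = - var * t * f(t)
  (Tikhomirov's method): in E[Y_T exp(i t W)] the triangles sharing an edge with T are split off,
  which leaves var * f(t) and an error that is cubic in the summands.  This gives
  |f(t) - exp(- var * t^2 / 2)| <= 36 * kappa * |t|^3, where kappa sums E[Z_T Z_A Z_C] over
  triangles A, C overlapping T.  With rho = c^2 R / N^2, the variance is c R rho (A + rho B), where A
  comes from pairs of equal triangles and B from the linear part of the Hoeffding decomposition;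
  Riemann sums give the limits of A and B, and kappa = O(c R rho (1 + rho^2)) is negligible.
*)

theory Submission
  imports Defs
begin

section \<open>Expectation over a random subset of a finite set\<close>

text \<open>The number of triangles that can overlap a given one is of order N, so an error bound
  through the maximal degree of the dependency graph is too weak. Joint expectations are the right
  weights: \<open>rho = c^2 R / N^2\<close> is the order of the expected number of triangles through
  an edge that is present, and two further overlapping triangles then cost only a factor of order 1
  + rho^2. The same quantity separates the regimes. For large rho the fluctuations of single edges
  dominate (the coefficient B), for small rho the triangles are almost independent (the coefficient
  A), and for fixed rho both effects count. The condition N^2 << c^3 R^2 says that the expected
  number of triangles tends to infinity. Expectations are finite sums over edge sets, so
  measurability and integrability arise only at the passage to the given probability spaces.
  Dominated convergence works along sequences while the limiting variances are limits along filters;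
  countable bases of these filters bridge the gap.\<close>

definition bex :: "'e set \<Rightarrow> ('e \<Rightarrow> real) \<Rightarrow> ('e set \<Rightarrow> 'b::real_vector) \<Rightarrow> 'b" where
  "bex E q f = (\<Sum>U\<in>Pow E. ((\<Prod>e\<in>U. q e) * (\<Prod>e\<in>E - U. 1 - q e)) *\<^sub>R f U)"

lemma bex_cong: "(\<And>U. U \<subseteq> E \<Longrightarrow> f U = g U) \<Longrightarrow> bex E q f = bex E q g"
  unfolding bex_def by (intro sum.cong) auto

lemma bex_zero [simp]: "bex E q (\<lambda>U. 0) = 0"
  by (simp add: bex_def)

lemma bex_add: "bex E q (\<lambda>U. f U + g U) = bex E q f + bex E q g"
  by (simp add: bex_def scaleR_add_right sum.distrib)

lemma bex_diff: "bex E q (\<lambda>U. f U - g U) = bex E q f - bex E q g"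
  by (simp add: bex_def scaleR_diff_right sum_subtractf)

lemma bex_sum: "bex E q (\<lambda>U. \<Sum>i\<in>I. f i U) = (\<Sum>i\<in>I. bex E q (f i))"
  unfolding bex_def by (subst sum.swap) (simp add: scaleR_sum_right)

lemma bex_linear:
  assumes "linear h"
  shows "bex E q (\<lambda>U. h (f U)) = h (bex E q f)"
  unfolding bex_def by (simp add: linear_sum[OF assms] linear_scale[OF assms])

lemma bex_mult_left:
  fixes c :: "'b::real_algebra"
  shows "bex E q (\<lambda>U. c * f U) = c * bex E q f"
  by (rule bex_linear) (rule linear_times)

lemma bex_mult_right:
  fixes c :: "'b::real_algebra"
  shows "bex E q (\<lambda>U. f U * c) = bex E q f * c"
  unfolding bex_def by (simp add: sum_distrib_right)

lemma bex_of_real: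
  "bex E q (\<lambda>U. of_real (f U)) = (of_real (bex E q f) :: 'b::real_algebra_1)"
  unfolding bex_def by (simp add: scaleR_conv_of_real)

lemma bex_const [simp]:
  assumes "finite E"
  shows "bex E q (\<lambda>U. c) = c"
proof -
  have "(\<Sum>U\<in>Pow E. (\<Prod>e\<in>U. q e) * (\<Prod>e\<in>E - U. 1 - q e)) = (\<Prod>e\<in>E. q e + (1 - q e))"
    by (rule prod_add[OF assms, symmetric])
  then show ?thesis
    unfolding bex_def by (simp flip: scaleR_sum_left)
qed

lemma bex_mono:
  fixes f g :: "'e set \<Rightarrow> real"
  assumes "\<And>e. e \<in> E \<Longrightarrow> 0 \<le> q e \<and> q e \<le> 1" and "\<And>U. U \<subseteq> E \<Longrightarrow> f U \<le> g U"
  shows "bex E q f \<le> bex E q g"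
  unfolding bex_def using assms
  by (auto intro!: sum_mono mult_left_mono mult_nonneg_nonneg prod_nonneg)

lemma bex_nonneg:
  fixes f :: "'e set \<Rightarrow> real"
  assumes "\<And>e. e \<in> E \<Longrightarrow> 0 \<le> q e \<and> q e \<le> 1" and "\<And>U. U \<subseteq> E \<Longrightarrow> 0 \<le> f U"
  shows "0 \<le> bex E q f"
  using bex_mono[OF assms(1), where f = "\<lambda>_. 0" and g = f] assms(2) by simp

lemma norm_bex_le:
  fixes f :: "'e set \<Rightarrow> 'b::real_normed_vector"
  assumes "\<And>e. e \<in> E \<Longrightarrow> 0 \<le> q e \<and> q e \<le> 1"
  shows "norm (bex E q f) \<le> bex E q (\<lambda>U. norm (f U))"
  unfolding bex_def
proof (rule sum_norm_le)
  fix U assume U: "U \<in> Pow E"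
  have "0 \<le> (\<Prod>e\<in>U. q e) * (\<Prod>e\<in>E - U. 1 - q e)"
    using assms U by (intro mult_nonneg_nonneg prod_nonneg) auto
  then show "norm (((\<Prod>e\<in>U. q e) * (\<Prod>e\<in>E - U. 1 - q e)) *\<^sub>R f U)
      \<le> ((\<Prod>e\<in>U. q e) * (\<Prod>e\<in>E - U. 1 - q e)) *\<^sub>R norm (f U)"
    by simp
qed

text \<open>A finite Fubini theorem: a subset of \<open>E\<close> is a subset of \<open>S\<close>
  together with a subset of \<open>E - S\<close>, and the weight of such a union is the product of
  the two weights.\<close>

lemma bex_split:
  assumes "finite E" "S \<subseteq> E"
  shows "bex E q f = bex S q (\<lambda>U. bex (E - S) q (\<lambda>V. f (U \<union> V)))"
proof -
  let ?w = "\<lambda>E U. (\<Prod>e\<in>U. q e) * (\<Prod>e\<in>E - U. 1 - q e)"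
  have weight: "?w E (U \<union> V) = ?w S U * ?w (E - S) V" if "U \<subseteq> S" "V \<subseteq> E - S" for U V
  proof -
    have fin: "finite U" "finite V" "finite (S - U)" "finite (E - S - V)"
      using assms that by (auto intro: finite_subset)
    have "(\<Prod>e\<in>U \<union> V. q e) = (\<Prod>e\<in>U. q e) * (\<Prod>e\<in>V. q e)"
      using fin that by (intro prod.union_disjoint) auto
    moreover have "E - (U \<union> V) = (S - U) \<union> (E - S - V)" using that assms by auto
    then have "(\<Prod>e\<in>E - (U \<union> V). 1 - q e) = (\<Prod>e\<in>S - U. 1 - q e) * (\<Prod>e\<in>E - S - V. 1 - q e)"
      using fin by (simp only:) (intro prod.union_disjoint, auto)
    ultimately show ?thesis by simp
  qed
  have "bex S q (\<lambda>U. bex (E - S) q (\<lambda>V. f (U \<union> V)))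
      = (\<Sum>(U, V)\<in>Pow S \<times> Pow (E - S). ?w E (U \<union> V) *\<^sub>R f (U \<union> V))"
    unfolding bex_def scaleR_sum_right sum.cartesian_product
    by (intro sum.cong refl) (auto simp: weight simp del: prod.union_disjoint split: prod.splits)
  also have "\<dots> = (\<Sum>U\<in>Pow E. ?w E U *\<^sub>R f U)"
    by (rule sum.reindex_bij_witness[where i = "\<lambda>U. (U \<inter> S, U - S)" and j = "\<lambda>(U, V). U \<union> V"])
       (use assms in \<open>auto simp: Un_Diff Int_Un_distrib2 intro!: arg_cong2[where f = Pair]\<close>)
  finally show ?thesis by (simp add: bex_def)
qed

text \<open>Dependence on the bits in \<open>S\<close> only, or on the other bits only, is encoded
  as invariance under \<open>U \<inter> S\<close> or \<open>U - S\<close>; splitting the sum along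
  \<open>S\<close> then separates the factors.\<close>

lemma bex_indep:
  fixes F G :: "'e set \<Rightarrow> 'b::real_algebra_1"
  assumes E: "finite E" "S \<subseteq> E"
    and F: "\<And>U. U \<subseteq> E \<Longrightarrow> F U = F (U \<inter> S)" and G: "\<And>U. U \<subseteq> E \<Longrightarrow> G U = G (U - S)"
  shows "bex E q (\<lambda>U. F U * G U) = bex E q F * bex E q G"
proof -
  have fin: "finite S" "finite (E - S)" using E finite_subset by auto
  have sep: "F (U \<union> V) = F U" "G (U \<union> V) = G V" if "U \<subseteq> S" "V \<subseteq> E - S" for U V
  proof -
    have *: "U \<union> V \<subseteq> E" "(U \<union> V) \<inter> S = U" "U \<union> V - S = V" using that E by auto
    show "F (U \<union> V) = F U" using F[OF *(1)] unfolding *(2) .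
    show "G (U \<union> V) = G V" using G[OF *(1)] unfolding *(3) .
  qed
  have "bex E q (\<lambda>U. F U * G U) = bex S q (\<lambda>U. bex (E - S) q (\<lambda>V. F U * G V))"
    unfolding bex_split[OF E, of q "\<lambda>U. F U * G U"]
    by (intro bex_cong arg_cong2[where f = "(*)"]) (auto simp: sep)
  also have "\<dots> = bex S q F * bex (E - S) q G"
    by (simp add: bex_mult_left bex_mult_right)
  also have "bex S q F = bex E q F"
    unfolding bex_split[OF E, of q F] using fin by (intro bex_cong) (simp add: sep cong: bex_cong)
  also have "bex (E - S) q G = bex E q G"
  proof -
    have "bex E q G = bex S q (\<lambda>U. bex (E - S) q G)"
      unfolding bex_split[OF E, of q G] by (intro bex_cong) (simp add: sep cong: bex_cong)
    then show ?thesis using fin by simp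
  qed
  finally show ?thesis .
qed

lemma bex_subset_indicator:
  assumes "finite E" "S \<subseteq> E"
  shows "bex E q (\<lambda>U. of_bool (S \<subseteq> U) :: real) = (\<Prod>e\<in>S. q e)"
proof -
  have fin: "finite S" "finite (E - S)" using assms finite_subset by auto
  have "bex E q (\<lambda>U. of_bool (S \<subseteq> U) :: real)
      = bex S q (\<lambda>U. bex (E - S) q (\<lambda>V. of_bool (S \<subseteq> U)))"
    unfolding bex_split[OF assms] by (intro bex_cong) auto
  \<comment> \<open>Among the subsets of \<open>S\<close> only \<open>S\<close> itself contains
    \<open>S\<close>, and its factor over the complement is an empty product.\<close>
  also have "\<dots> = (\<Sum>U\<in>Pow S. if U = S then (\<Prod>e\<in>S. q e) else 0)"
    unfolding bex_def[of S] using fin by (intro sum.cong) auto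
  also have "\<dots> = (\<Prod>e\<in>S. q e)" using fin by (simp add: sum.delta)
  finally show ?thesis .
qed

section \<open>A normal approximation bound for sums of monomials in independent bits\<close>

lemma cmod_iexp_minus_one: "cmod (iexp x - 1) \<le> \<bar>x\<bar>"
  using iexp_approx1[of x 0] by simp

lemma cmod_iexp_minus_linear: "cmod (iexp x - 1 - \<i> * x) \<le> x\<^sup>2 / 2"
  using iexp_approx1[of x 1] by (simp add: power2_eq_square algebra_simps)

text \<open>The integrating factor \<open>exp (v * t\<^sup>2 / 2)\<close> turns the hypothesis into
  a bound on the derivative of \<open>G\<close>. The mean value inequality on the segment from 0 to
  t multiplies the bound K t^2 by |t|. On that segment the factor is largest at t, since v is
  nonnegative, so it cancels on the way back.\<close>

lemma gaussian_ode_bound: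
  fixes f f' :: "real \<Rightarrow> complex"
  assumes deriv: "\<And>t. (f has_vector_derivative f' t) (at t)"
    and bound: "\<And>t. cmod (f' t + of_real (v * t) * f t) \<le> K * t\<^sup>2"
    and "f 0 = 1" "0 \<le> v" "0 \<le> K"
  shows "cmod (f t - of_real (exp (- (v * t\<^sup>2) / 2))) \<le> K * \<bar>t\<bar> ^ 3"
proof -
  define G where "G = (\<lambda>s. of_real (exp (v * s\<^sup>2 / 2)) * f s)"
  define G' where "G' = (\<lambda>s. of_real (exp (v * s\<^sup>2 / 2)) * (f' s + of_real (v * s) * f s))"
  have G: "(G has_vector_derivative G' s) (at s within closed_segment 0 t)" for s
  proof -
    have "((\<lambda>s. exp (v * s\<^sup>2 / 2)) has_field_derivative exp (v * s\<^sup>2 / 2) * (v * s)) (at s)"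
      by (auto intro!: derivative_eq_intros)
    then have "((\<lambda>s. of_real (exp (v * s\<^sup>2 / 2))) has_vector_derivative
        (of_real (exp (v * s\<^sup>2 / 2) * (v * s)) :: complex)) (at s)"
      by (rule has_vector_derivative_of_real)
    from has_vector_derivative_mult[OF this deriv[of s]]
    have "(G has_vector_derivative G' s) (at s)"
      unfolding G_def G'_def by (simp add: algebra_simps)
    then show ?thesis by (rule has_vector_derivative_at_within)
  qed
  have "cmod (G t - G 0) \<le> exp (v * t\<^sup>2 / 2) * (K * t\<^sup>2) * cmod (of_real (t - 0))"
  proof -
    have "norm (G t - G 0) \<le> exp (v * t\<^sup>2 / 2) * (K * t\<^sup>2) * norm (t - 0)"
    proof (rule differentiable_bound[where S = "closed_segment 0 t" and f' = "\<lambda>s h. h *\<^sub>R G' s"])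
      fix s assume s: "s \<in> closed_segment 0 t"
      show "(G has_derivative (\<lambda>h. h *\<^sub>R G' s)) (at s within closed_segment 0 t)"
        using G[of s] by (simp add: has_vector_derivative_def)
      have "\<bar>s\<bar> \<le> \<bar>t\<bar>" using s by (auto simp: closed_segment_eq_real_ivl split: if_splits)
      then have le: "s\<^sup>2 \<le> t\<^sup>2" by (simp add: abs_le_square_iff)
      have "cmod (G' s) \<le> exp (v * t\<^sup>2 / 2) * (K * t\<^sup>2)"
        unfolding G'_def norm_mult using le assms
        by (intro mult_mono order_trans[OF bound]) (auto intro!: mult_left_mono)
      moreover have "onorm (\<lambda>h. h *\<^sub>R G' s) = cmod (G' s)"
        using onorm_scaleR_left[of "\<lambda>h::real. h" "G' s"] onorm_id[where 'a = real]
        by (simp add: bounded_linear_ident id_def)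
      ultimately show "onorm (\<lambda>h. h *\<^sub>R G' s) \<le> exp (v * t\<^sup>2 / 2) * (K * t\<^sup>2)" by simp
    qed auto
    then show ?thesis by simp
  qed
  then have main: "cmod (G t - 1) \<le> exp (v * t\<^sup>2 / 2) * (K * \<bar>t\<bar> ^ 3)"
    using \<open>f 0 = 1\<close> by (simp add: G_def power3_eq_cube power2_eq_square abs_mult mult.assoc)
  have "f t - of_real (exp (- (v * t\<^sup>2) / 2)) = of_real (exp (- (v * t\<^sup>2) / 2)) * (G t - 1)"
  proof -
    have "(of_real (exp (- (v * t\<^sup>2) / 2)) * of_real (exp (v * t\<^sup>2 / 2)) :: complex) = 1"
      unfolding of_real_mult[symmetric] exp_add[symmetric] by (simp add: add_divide_distrib[symmetric])
    then have "of_real (exp (- (v * t\<^sup>2) / 2)) * G t = f t"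
      unfolding G_def mult.assoc[symmetric] by simp
    then show ?thesis by (simp add: right_diff_distrib)
  qed
  then have "cmod (f t - of_real (exp (- (v * t\<^sup>2) / 2))) = exp (- (v * t\<^sup>2) / 2) * cmod (G t - 1)"
    by (simp only: norm_mult norm_of_real) simp
  also have "\<dots> \<le> exp (- (v * t\<^sup>2) / 2) * (exp (v * t\<^sup>2 / 2) * (K * \<bar>t\<bar> ^ 3))"
    by (intro mult_left_mono main) simp
  also have "\<dots> = K * \<bar>t\<bar> ^ 3"
    by (simp add: mult.assoc[symmetric] exp_add[symmetric] add_divide_distrib[symmetric])
  finally show ?thesis .
qed

text \<open>Each index \<open>T\<close> carries the monomial \<open>wt T\<close> times the product
  of the bits in \<open>B T\<close>. Only the overlap pattern of the supports matters here;
  triangles enter later.\<close>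

locale monomial_sum =
  fixes E :: "'e set" and q :: "'e \<Rightarrow> real" and I :: "'i set"
    and B :: "'i \<Rightarrow> 'e set" and wt :: "'i \<Rightarrow> real"
  assumes fin_E: "finite E" and q01: "\<And>e. e \<in> E \<Longrightarrow> 0 \<le> q e \<and> q e \<le> 1"
    and fin_I: "finite I" and B_sub: "\<And>T. T \<in> I \<Longrightarrow> B T \<subseteq> E"
    and wt_nonneg: "\<And>T. T \<in> I \<Longrightarrow> 0 \<le> wt T"
begin

abbreviation ex :: "('e set \<Rightarrow> 'b::real_vector) \<Rightarrow> 'b" where
  "ex f \<equiv> bex E q f"

definition pr :: "'e set \<Rightarrow> real" where "pr S = (\<Prod>e\<in>S. q e)"
definition Z :: "'i \<Rightarrow> 'e set \<Rightarrow> real" where "Z T U = wt T * of_bool (B T \<subseteq> U)"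
definition mu :: "'i \<Rightarrow> real" where "mu T = wt T * pr (B T)"
definition Y :: "'i \<Rightarrow> 'e set \<Rightarrow> real" where "Y T U = Z T U - mu T"
definition near :: "'e set \<Rightarrow> 'i set" where "near S = {A \<in> I. B A \<inter> S \<noteq> {}}"
definition W :: "'e set \<Rightarrow> real" where "W U = (\<Sum>T\<in>I. Y T U)"
text \<open>\<open>W - V S\<close> depends only on the bits outside \<open>S\<close>, so
  \<open>V S\<close> is what has to be removed from \<open>W\<close> to make it independent of
  \<open>S\<close>.\<close>

definition V :: "'e set \<Rightarrow> 'e set \<Rightarrow> real" where "V S U = (\<Sum>T\<in>near S. Y T U)"

abbreviation nb :: "'i \<Rightarrow> 'i set" where "nb T \<equiv> near (B T)"

text \<open>The moments are those of the uncentred \<open>Z\<close>. They are nonnegative products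
  over unions of supports, and up to constants they bound all mixed third moments of the centred
  \<open>Y\<close> that occur.\<close>

definition k3 :: "'i \<Rightarrow> 'i \<Rightarrow> 'i \<Rightarrow> real" where
  "k3 T A C = ex (\<lambda>U. Z T U * Z A U * Z C U)"

definition kappa :: real where
  "kappa = (\<Sum>T\<in>I. \<Sum>A\<in>nb T. \<Sum>C\<in>nb T. k3 T A C)"

section \<open>Joint moments of the monomials\<close>

lemma near_sub: "near S \<subseteq> I" by (auto simp: near_def)

lemma fin_near [simp]: "finite (near S)"
  using fin_I near_sub finite_subset by blast

lemma pr_bounds: "S \<subseteq> E \<Longrightarrow> 0 \<le> pr S \<and> pr S \<le> 1"
  unfolding pr_def using q01 by (auto intro!: prod_nonneg prod_le_1)

text \<open>Positive correlation: the product counts the common elements of \<open>S\<close> and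
  \<open>S'\<close> twice, and each surplus factor is at most 1.\<close>

lemma pr_mult_le:
  assumes "S \<subseteq> E" "S' \<subseteq> E"
  shows "pr S * pr S' \<le> pr (S \<union> S')"
proof -
  have "finite S" "finite S'" using assms fin_E finite_subset by auto
  then have "pr S * pr S' = pr (S \<union> S') * pr (S \<inter> S')"
    unfolding pr_def by (rule prod.union_inter[symmetric])
  also have "\<dots> \<le> pr (S \<union> S') * 1"
    using pr_bounds[of "S \<union> S'"] pr_bounds[of "S \<inter> S'"] assms by (intro mult_left_mono) auto
  finally show ?thesis by simp
qed

lemma ex_subset: "S \<subseteq> E \<Longrightarrow> ex (\<lambda>U. of_bool (S \<subseteq> U)) = pr S"
  unfolding pr_def by (rule bex_subset_indicator[OF fin_E])

lemma ex_Z: "T \<in> I \<Longrightarrow> ex (Z T) = mu T"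
  using bex_mult_left[of E q "wt T" "\<lambda>U. of_bool (B T \<subseteq> U)"] ex_subset[OF B_sub, of T]
  by (simp add: Z_def[abs_def] mu_def)

lemma ex_ZZ:
  assumes "T \<in> I" "A \<in> I"
  shows "ex (\<lambda>U. Z T U * Z A U) = wt T * wt A * pr (B T \<union> B A)"
proof -
  have "ex (\<lambda>U. Z T U * Z A U) = ex (\<lambda>U. wt T * wt A * of_bool (B T \<union> B A \<subseteq> U))"
    by (intro bex_cong) (auto simp: Z_def)
  then show ?thesis
    using ex_subset[of "B T \<union> B A"] B_sub assms by (simp add: bex_mult_left)
qed

lemma k3_eq:
  assumes "T \<in> I" "A \<in> I" "C \<in> I"
  shows "k3 T A C = wt T * wt A * wt C * pr (B T \<union> B A \<union> B C)"
proof -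
  have "k3 T A C = ex (\<lambda>U. wt T * wt A * wt C * of_bool (B T \<union> B A \<union> B C \<subseteq> U))"
    unfolding k3_def by (intro bex_cong) (auto simp: Z_def)
  then show ?thesis
    using ex_subset[of "B T \<union> B A \<union> B C"] B_sub assms by (simp add: bex_mult_left)
qed

lemma Z_nonneg: "T \<in> I \<Longrightarrow> 0 \<le> Z T U" using wt_nonneg by (simp add: Z_def)

lemma mu_nonneg: "T \<in> I \<Longrightarrow> 0 \<le> mu T"
  using wt_nonneg pr_bounds B_sub by (simp add: mu_def)

lemma k3_nonneg: "T \<in> I \<Longrightarrow> A \<in> I \<Longrightarrow> C \<in> I \<Longrightarrow> 0 \<le> k3 T A C"
  using wt_nonneg pr_bounds[of "B T \<union> B A \<union> B C"] B_sub by (simp add: k3_eq)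

lemma abs_Y_le: "T \<in> I \<Longrightarrow> \<bar>Y T U\<bar> \<le> Z T U + mu T"
  using Z_nonneg[of T U] mu_nonneg[of T] by (auto simp: Y_def)

text \<open>Splitting a joint moment into a product of lower ones only decreases it, by positive
  correlation used once or twice.\<close>

lemma k3_dominates:
  assumes I: "T \<in> I" "A \<in> I" "C \<in> I"
  shows "mu C * ex (\<lambda>U. Z T U * Z A U) \<le> k3 T A C"
    and "mu A * mu C * mu T \<le> k3 T A C"
proof -
  note sub = B_sub[OF I(1)] B_sub[OF I(2)] B_sub[OF I(3)]
  note w = wt_nonneg[OF I(1)] wt_nonneg[OF I(2)] wt_nonneg[OF I(3)]
  have 1: "pr (B T \<union> B A) * pr (B C) \<le> pr (B T \<union> B A \<union> B C)"
    using sub by (intro pr_mult_le) auto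
  have "wt T * wt A * wt C * (pr (B T \<union> B A) * pr (B C)) \<le> k3 T A C"
    unfolding k3_eq[OF I] using w by (intro mult_left_mono 1) auto
  then show "mu C * ex (\<lambda>U. Z T U * Z A U) \<le> k3 T A C"
    using I by (simp add: ex_ZZ mu_def mult_ac Un_commute)
  have "pr (B T) * pr (B A) * pr (B C) \<le> pr (B T \<union> B A) * pr (B C)"
    using sub pr_bounds by (intro mult_right_mono pr_mult_le) auto
  then have "wt T * wt A * wt C * (pr (B T) * pr (B A) * pr (B C)) \<le> k3 T A C"
    unfolding k3_eq[OF I] using w by (intro mult_left_mono order_trans[OF _ 1]) auto
  then show "mu A * mu C * mu T \<le> k3 T A C"
    by (simp add: mu_def mult_ac)
qed

lemma k3_perm: "k3 T A C = k3 A T C" "k3 T A C = k3 T C A"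
  by (simp_all add: k3_def mult_ac)

text \<open>The 8 is 2^3: each \<open>\<bar>Y\<bar>\<close> is at most \<open>Z + mu\<close>, and
  each of the eight terms of the expanded product has expectation at most \<open>k3\<close>. Taking
  the factor of \<open>C\<close> out of the expectation gives 2 + 6 such terms instead.\<close>

lemma ex_abs_YYY:
  assumes I: "T \<in> I" "A \<in> I" "C \<in> I"
  shows "ex (\<lambda>U. \<bar>Y T U\<bar> * \<bar>Y A U\<bar> * \<bar>Y C U\<bar>) \<le> 8 * k3 T A C"
    and "ex (\<lambda>U. \<bar>Y T U\<bar> * \<bar>Y A U\<bar>) * ex (\<lambda>U. \<bar>Y C U\<bar>) \<le> 8 * k3 T A C"
proof -
  note d = k3_dominates
  have b: "mu C * ex (\<lambda>U. Z T U * Z A U) \<le> k3 T A C" "mu A * ex (\<lambda>U. Z T U * Z C U) \<le> k3 T A C"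
    "mu T * ex (\<lambda>U. Z A U * Z C U) \<le> k3 T A C" "mu A * mu C * mu T \<le> k3 T A C"
    using d[OF I] d(1)[of T C A] d(1)[of A C T] I k3_perm by simp_all
  have "ex (\<lambda>U. \<bar>Y T U\<bar> * \<bar>Y A U\<bar> * \<bar>Y C U\<bar>)
      \<le> ex (\<lambda>U. (Z T U + mu T) * (Z A U + mu A) * (Z C U + mu C))"
    using I Z_nonneg mu_nonneg
    by (intro bex_mono q01 mult_mono abs_Y_le mult_nonneg_nonneg add_nonneg_nonneg) auto
  also have "\<dots> = ex (\<lambda>U. Z T U * Z A U * Z C U + mu C * (Z T U * Z A U) + mu A * (Z T U * Z C U)
      + mu T * (Z A U * Z C U) + (mu A * mu C) * Z T U + (mu T * mu C) * Z A U + (mu T * mu A) * Z C U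
      + mu T * mu A * mu C)"
    by (intro bex_cong) (simp add: algebra_simps)
  \<comment> \<open>The three terms with a single factor \<open>Z\<close> and the one with none all
    have the expectation \<open>mu A * mu C * mu T\<close>, whence the 4.\<close>
  also have "\<dots> = k3 T A C + mu C * ex (\<lambda>U. Z T U * Z A U) + mu A * ex (\<lambda>U. Z T U * Z C U)
      + mu T * ex (\<lambda>U. Z A U * Z C U) + 4 * (mu A * mu C * mu T)"
    using I by (simp add: bex_add bex_mult_left ex_Z fin_E k3_def)
  finally show "ex (\<lambda>U. \<bar>Y T U\<bar> * \<bar>Y A U\<bar> * \<bar>Y C U\<bar>) \<le> 8 * k3 T A C"
    using b by linarith
  have "ex (\<lambda>U. \<bar>Y T U\<bar> * \<bar>Y A U\<bar>) \<le> ex (\<lambda>U. (Z T U + mu T) * (Z A U + mu A))"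
    using I Z_nonneg mu_nonneg
    by (intro bex_mono q01 mult_mono abs_Y_le mult_nonneg_nonneg add_nonneg_nonneg) auto
  also have "\<dots> = ex (\<lambda>U. Z T U * Z A U + mu T * Z A U + mu A * Z T U + mu T * mu A)"
    by (intro bex_cong) (simp add: algebra_simps)
  also have "\<dots> = ex (\<lambda>U. Z T U * Z A U) + 3 * (mu T * mu A)"
    using I by (simp add: bex_add bex_mult_left ex_Z fin_E)
  finally have 2: "ex (\<lambda>U. \<bar>Y T U\<bar> * \<bar>Y A U\<bar>) \<le> ex (\<lambda>U. Z T U * Z A U) + 3 * (mu T * mu A)" .
  have "ex (\<lambda>U. \<bar>Y C U\<bar>) \<le> ex (\<lambda>U. Z C U + mu C)"
    using I by (intro bex_mono q01 abs_Y_le)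
  also have "\<dots> = 2 * mu C" using I fin_E by (simp add: bex_add ex_Z)
  finally have 1: "ex (\<lambda>U. \<bar>Y C U\<bar>) \<le> 2 * mu C" .
  have "ex (\<lambda>U. \<bar>Y T U\<bar> * \<bar>Y A U\<bar>) * ex (\<lambda>U. \<bar>Y C U\<bar>)
      \<le> (ex (\<lambda>U. Z T U * Z A U) + 3 * (mu T * mu A)) * (2 * mu C)"
    using 1 2 I by (intro mult_mono) (auto intro!: bex_nonneg q01 add_nonneg_nonneg mult_nonneg_nonneg Z_nonneg mu_nonneg)
  also have "\<dots> = 2 * (mu C * ex (\<lambda>U. Z T U * Z A U)) + 6 * (mu A * mu C * mu T)"
    by (simp add: algebra_simps)
  finally show "ex (\<lambda>U. \<bar>Y T U\<bar> * \<bar>Y A U\<bar>) * ex (\<lambda>U. \<bar>Y C U\<bar>) \<le> 8 * k3 T A C"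
    using b by linarith
qed

section \<open>Decoupling and the differential equation for the characteristic function\<close>

lemma Y_local:
  assumes "T \<in> I"
  shows "B T \<subseteq> S \<Longrightarrow> Y T (U \<inter> S) = Y T U" and "B T \<inter> S = {} \<Longrightarrow> Y T (U - S) = Y T U"
  unfolding Y_def Z_def
  by (auto intro!: arg_cong[where f = "\<lambda>b. wt T * of_bool b - mu T"])

lemma W_split: "W U = (\<Sum>T | T \<in> I \<and> B T \<inter> S = {}. Y T U) + V S U"
proof -
  have "I = {T \<in> I. B T \<inter> S = {}} \<union> near S" by (auto simp: near_def)
  then have "W U = (\<Sum>T\<in>{T \<in> I. B T \<inter> S = {}} \<union> near S. Y T U)" by (simp add: W_def)
  also have "\<dots> = (\<Sum>T | T \<in> I \<and> B T \<inter> S = {}. Y T U) + V S U"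
    unfolding V_def using fin_I by (intro sum.union_disjoint) (auto simp: near_def)
  finally show ?thesis .
qed

lemma ex_far:
  fixes F :: "'e set \<Rightarrow> real"
  assumes S: "S \<subseteq> E" and F: "\<And>U. U \<subseteq> E \<Longrightarrow> F U = F (U \<inter> S)"
  shows "ex (\<lambda>U. of_real (F U) * iexp (t * (W U - V S U)))
    = of_real (ex F) * ex (\<lambda>U. iexp (t * (W U - V S U)))"
proof -
  have "W U - V S U = W (U - S) - V S (U - S)" for U
    unfolding W_split[of _ S] by (auto intro!: sum.cong simp: Y_local)
  then have "ex (\<lambda>U. of_real (F U) * iexp (t * (W U - V S U)))
    = ex (\<lambda>U. of_real (F U)) * ex (\<lambda>U. iexp (t * (W U - V S U)))"
    using F by (intro bex_indep[OF fin_E S]) auto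
  then show ?thesis by (simp add: bex_of_real)
qed

text \<open>Replacing \<open>W\<close> by \<open>W - V S\<close> costs at most |t| |V S| and makes
  the exponential independent of \<open>F\<close>. The replacement is made in the joint expectation
  and undone in the separate factor, hence the two error terms.\<close>

lemma decorrelate:
  fixes F :: "'e set \<Rightarrow> real"
  assumes S: "S \<subseteq> E" and F: "\<And>U. U \<subseteq> E \<Longrightarrow> F U = F (U \<inter> S)"
  shows "cmod (ex (\<lambda>U. of_real (F U) * iexp (t * W U)) - of_real (ex F) * ex (\<lambda>U. iexp (t * W U)))
    \<le> \<bar>t\<bar> * (ex (\<lambda>U. \<bar>F U\<bar> * \<bar>V S U\<bar>) + ex (\<lambda>U. \<bar>F U\<bar>) * ex (\<lambda>U. \<bar>V S U\<bar>))"
proof -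
  define g where "g = (\<lambda>U. iexp (t * (W U - V S U)))"
  define D where "D = (\<lambda>U. iexp (t * W U) - g U)"
  have D: "cmod (D U) \<le> \<bar>t\<bar> * \<bar>V S U\<bar>" for U
  proof -
    have "D U = g U * (iexp (t * V S U) - 1)"
      unfolding D_def g_def by (simp add: exp_add[symmetric] algebra_simps)
    then show ?thesis
      using cmod_iexp_minus_one[of "t * V S U"] by (simp add: norm_mult g_def abs_mult)
  qed
  have split: "iexp (t * W U) = g U + D U" for U by (simp add: D_def)
  have "ex (\<lambda>U. of_real (F U) * iexp (t * W U)) - of_real (ex F) * ex (\<lambda>U. iexp (t * W U))
      = ex (\<lambda>U. of_real (F U) * D U) - of_real (ex F) * ex D"
    unfolding split using ex_far[where S = S and F = F and t = t, OF S F]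
    by (simp add: bex_add distrib_left g_def)
  then have "cmod (ex (\<lambda>U. of_real (F U) * iexp (t * W U)) - of_real (ex F) * ex (\<lambda>U. iexp (t * W U)))
      \<le> cmod (ex (\<lambda>U. of_real (F U) * D U)) + \<bar>ex F\<bar> * cmod (ex D)"
    using norm_triangle_ineq4[of "ex (\<lambda>U. of_real (F U) * D U)" "of_real (ex F) * ex D"]
    by (simp add: norm_mult)
  also have "cmod (ex (\<lambda>U. of_real (F U) * D U)) \<le> ex (\<lambda>U. \<bar>t\<bar> * (\<bar>F U\<bar> * \<bar>V S U\<bar>))"
    using D by (intro order_trans[OF norm_bex_le] bex_mono q01)
      (auto simp: norm_mult mult.left_commute[of "\<bar>t\<bar>"] intro!: mult_left_mono)
  also have "cmod (ex D) \<le> ex (\<lambda>U. \<bar>t\<bar> * \<bar>V S U\<bar>)"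
    using D by (intro order_trans[OF norm_bex_le] bex_mono q01) auto
  also have "\<bar>ex F\<bar> \<le> ex (\<lambda>U. \<bar>F U\<bar>)"
    using norm_bex_le[of E q F] q01 by simp
  finally show ?thesis
    by (simp add: bex_mult_left distrib_left mult.left_commute mult_left_mono mult_right_mono
        bex_nonneg q01)
qed

lemma ex_Y: "T \<in> I \<Longrightarrow> ex (Y T) = 0"
  using fin_E by (simp add: Y_def[abs_def] bex_diff ex_Z)

text \<open>\<open>Y T\<close> is centred and independent of \<open>W - V (B T)\<close>, so its
  expectation against the exponential of that difference vanishes. Factoring the exponential as that
  of \<open>W\<close> times that of \<open>- V (B T)\<close> and expanding the latter to first order
  leaves a quadratic remainder.\<close>

lemma first_order:
  assumes T: "T \<in> I"
  shows "cmod (ex (\<lambda>U. of_real (Y T U) * iexp (t * W U))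
      - \<i> * t * ex (\<lambda>U. of_real (Y T U * V (B T) U) * iexp (t * W U)))
    \<le> t\<^sup>2 / 2 * ex (\<lambda>U. \<bar>Y T U\<bar> * (V (B T) U)\<^sup>2)"
proof -
  let ?V = "V (B T)"
  define r where "r = (\<lambda>U. iexp (- (t * ?V U)) - 1 - \<i> * of_real (- (t * ?V U)))"
  have "of_real (Y T U) * iexp (t * W U) - \<i> * t * (of_real (Y T U * ?V U) * iexp (t * W U))
      = of_real (Y T U) * iexp (t * (W U - ?V U)) - of_real (Y T U) * (iexp (t * W U) * r U)" for U
  proof -
    have "iexp (t * (W U - ?V U)) = iexp (t * W U) * iexp (- (t * ?V U))"
      by (simp add: exp_add[symmetric] algebra_simps)
    then show ?thesis unfolding r_def by (simp add: algebra_simps)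
  qed
  then have "ex (\<lambda>U. of_real (Y T U) * iexp (t * W U))
      - \<i> * t * ex (\<lambda>U. of_real (Y T U * ?V U) * iexp (t * W U))
     = ex (\<lambda>U. of_real (Y T U) * iexp (t * (W U - ?V U))) - ex (\<lambda>U. of_real (Y T U) * (iexp (t * W U) * r U))"
    unfolding bex_mult_left[symmetric] bex_diff[symmetric] by simp
  also have "ex (\<lambda>U. of_real (Y T U) * iexp (t * (W U - ?V U))) = 0"
    using ex_far[OF B_sub[OF T], of "Y T" t] T by (simp add: Y_local ex_Y)
  finally have "cmod (ex (\<lambda>U. of_real (Y T U) * iexp (t * W U))
      - \<i> * t * ex (\<lambda>U. of_real (Y T U * ?V U) * iexp (t * W U)))
     = cmod (ex (\<lambda>U. of_real (Y T U) * (iexp (t * W U) * r U)))" by simp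
  also have "\<dots> \<le> ex (\<lambda>U. t\<^sup>2 / 2 * (\<bar>Y T U\<bar> * (?V U)\<^sup>2))"
  proof (intro order_trans[OF norm_bex_le] bex_mono q01)
    fix U
    have "cmod (r U) \<le> t\<^sup>2 / 2 * (?V U)\<^sup>2"
      using cmod_iexp_minus_linear[of "- (t * ?V U)"] by (simp add: r_def power_mult_distrib)
    then show "cmod (of_real (Y T U) * (iexp (t * W U) * r U)) \<le> t\<^sup>2 / 2 * (\<bar>Y T U\<bar> * (?V U)\<^sup>2)"
      using mult_left_mono[of "cmod (r U)" "t\<^sup>2 / 2 * (?V U)\<^sup>2" "\<bar>Y T U\<bar>"]
      by (simp add: norm_mult mult.left_commute)
  qed
  also have "\<dots> = t\<^sup>2 / 2 * ex (\<lambda>U. \<bar>Y T U\<bar> * (?V U)\<^sup>2)" by (rule bex_mult_left)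
  finally show ?thesis .
qed

definition var :: real where "var = (\<Sum>T\<in>I. \<Sum>A\<in>nb T. ex (\<lambda>U. Y T U * Y A U))"

text \<open>Only overlapping monomials correlate: the part of \<open>W\<close> away from
  \<open>B T\<close> is independent of the centred \<open>Y T\<close>.\<close>

lemma var_eq: "ex (\<lambda>U. (W U)\<^sup>2) = var"
proof -
  have "ex (\<lambda>U. Y T U * W U) = (\<Sum>A\<in>nb T. ex (\<lambda>U. Y T U * Y A U))" if T: "T \<in> I" for T
  proof -
    have zero: "ex (\<lambda>U. Y T U * (\<Sum>A | A \<in> I \<and> B A \<inter> B T = {}. Y A U)) = 0"
    proof -
      have "ex (\<lambda>U. Y T U * (\<Sum>A | A \<in> I \<and> B A \<inter> B T = {}. Y A U))
          = ex (Y T) * ex (\<lambda>U. \<Sum>A | A \<in> I \<and> B A \<inter> B T = {}. Y A U)"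
        using T by (intro bex_indep[OF fin_E B_sub]) (auto simp: Y_local)
      then show ?thesis using T by (simp add: ex_Y)
    qed
    show ?thesis
      unfolding W_split[of _ "B T"] distrib_left bex_add zero
      by (simp add: V_def sum_distrib_left bex_sum)
  qed
  then show ?thesis
    unfolding var_def power2_eq_square
    by (subst (1) W_def) (simp add: sum_distrib_right bex_sum)
qed

lemma var_nonneg: "0 \<le> var"
  unfolding var_eq[symmetric] by (intro bex_nonneg q01) auto

lemma kappa_nonneg: "0 \<le> kappa"
  unfolding kappa_def using near_sub by (intro sum_nonneg k3_nonneg) auto

text \<open>Overlap is symmetric and so is \<open>k3\<close>, hence a path T - A - C is a star
  centred at A. Such paths arise when \<open>Y T * Y A\<close> is decoupled and C overlaps
  A.\<close>

lemma kappa_swap: "(\<Sum>T\<in>I. \<Sum>A\<in>nb T. \<Sum>C\<in>nb A. k3 T A C) = kappa"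
proof -
  have "(\<Sum>T\<in>I. \<Sum>A\<in>nb T. \<Sum>C\<in>nb A. k3 T A C)
      = (\<Sum>A\<in>I. \<Sum>T\<in>{T \<in> I. B A \<inter> B T \<noteq> {}}. \<Sum>C\<in>nb A. k3 T A C)"
    unfolding near_def[of "B _"] using fin_I by (rule sum.swap_restrict) fact
  also have "\<dots> = kappa"
    unfolding kappa_def by (intro sum.cong) (auto simp: near_def k3_perm)
  finally show ?thesis .
qed

lemma ex_Y_V2:
  assumes T: "T \<in> I"
  shows "ex (\<lambda>U. \<bar>Y T U\<bar> * (V (B T) U)\<^sup>2) \<le> 8 * (\<Sum>A\<in>nb T. \<Sum>C\<in>nb T. k3 T A C)"
proof -
  have "\<bar>Y T U\<bar> * (V (B T) U)\<^sup>2 \<le> (\<Sum>A\<in>nb T. \<Sum>C\<in>nb T. \<bar>Y T U\<bar> * \<bar>Y A U\<bar> * \<bar>Y C U\<bar>)" for U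
  proof -
    have "\<bar>V (B T) U\<bar> \<le> (\<Sum>A\<in>nb T. \<bar>Y A U\<bar>)" unfolding V_def by (rule sum_abs)
    then have "\<bar>V (B T) U\<bar> * \<bar>V (B T) U\<bar> \<le> (\<Sum>A\<in>nb T. \<bar>Y A U\<bar>) * (\<Sum>A\<in>nb T. \<bar>Y A U\<bar>)"
      by (intro mult_mono) (auto intro: sum_nonneg)
    then have "\<bar>Y T U\<bar> * (V (B T) U)\<^sup>2 \<le> \<bar>Y T U\<bar> * ((\<Sum>A\<in>nb T. \<bar>Y A U\<bar>) * (\<Sum>A\<in>nb T. \<bar>Y A U\<bar>))"
      by (intro mult_left_mono) (auto simp: power2_eq_square)
    then show ?thesis by (simp add: sum_product sum_distrib_left mult_ac)
  qed
  then have "ex (\<lambda>U. \<bar>Y T U\<bar> * (V (B T) U)\<^sup>2)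
      \<le> ex (\<lambda>U. \<Sum>A\<in>nb T. \<Sum>C\<in>nb T. \<bar>Y T U\<bar> * \<bar>Y A U\<bar> * \<bar>Y C U\<bar>)"
    by (intro bex_mono q01)
  also have "\<dots> \<le> (\<Sum>A\<in>nb T. \<Sum>C\<in>nb T. 8 * k3 T A C)"
    unfolding bex_sum using T near_sub by (intro sum_mono ex_abs_YYY) auto
  finally show ?thesis by (simp add: sum_distrib_left)
qed

text \<open>A support meets \<open>B T \<union> B A\<close> exactly if it meets one of the two. Both
  error terms of \<open>decorrelate\<close> cost 8 times \<open>k3\<close>, whence 16.\<close>

lemma ex_YY_V:
  assumes I: "T \<in> I" "A \<in> I"
  shows "ex (\<lambda>U. \<bar>Y T U * Y A U\<bar> * \<bar>V (B T \<union> B A) U\<bar>)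
      + ex (\<lambda>U. \<bar>Y T U * Y A U\<bar>) * ex (\<lambda>U. \<bar>V (B T \<union> B A) U\<bar>)
    \<le> 16 * ((\<Sum>C\<in>nb T. k3 T A C) + (\<Sum>C\<in>nb A. k3 T A C))"
proof -
  let ?S = "B T \<union> B A"
  have V: "\<bar>V ?S U\<bar> \<le> (\<Sum>C\<in>near ?S. \<bar>Y C U\<bar>)" for U unfolding V_def by (rule sum_abs)
  have "ex (\<lambda>U. \<bar>Y T U * Y A U\<bar> * \<bar>V ?S U\<bar>)
      \<le> ex (\<lambda>U. \<Sum>C\<in>near ?S. \<bar>Y T U\<bar> * \<bar>Y A U\<bar> * \<bar>Y C U\<bar>)"
    unfolding sum_distrib_left[symmetric] abs_mult
    by (intro bex_mono q01 mult_left_mono V) auto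
  also have "\<dots> \<le> (\<Sum>C\<in>near ?S. 8 * k3 T A C)"
    unfolding bex_sum using I near_sub by (intro sum_mono ex_abs_YYY) auto
  finally have 1: "ex (\<lambda>U. \<bar>Y T U * Y A U\<bar> * \<bar>V ?S U\<bar>) \<le> (\<Sum>C\<in>near ?S. 8 * k3 T A C)" .
  have "ex (\<lambda>U. \<bar>Y T U * Y A U\<bar>) * ex (\<lambda>U. \<bar>V ?S U\<bar>)
      \<le> ex (\<lambda>U. \<bar>Y T U\<bar> * \<bar>Y A U\<bar>) * ex (\<lambda>U. \<Sum>C\<in>near ?S. \<bar>Y C U\<bar>)"
    unfolding abs_mult by (intro mult_left_mono bex_mono q01 V bex_nonneg) auto
  also have "\<dots> \<le> (\<Sum>C\<in>near ?S. 8 * k3 T A C)"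
    unfolding bex_sum sum_distrib_left using I near_sub by (intro sum_mono ex_abs_YYY) auto
  finally have 2: "ex (\<lambda>U. \<bar>Y T U * Y A U\<bar>) * ex (\<lambda>U. \<bar>V ?S U\<bar>) \<le> (\<Sum>C\<in>near ?S. 8 * k3 T A C)" .
  have nonneg: "0 \<le> sum (k3 T A) (nb T \<inter> nb A)"
    using near_sub by (intro sum_nonneg k3_nonneg I) auto
  have "near ?S = nb T \<union> nb A" by (auto simp: near_def)
  then have "(\<Sum>C\<in>near ?S. k3 T A C) \<le> (\<Sum>C\<in>nb T. k3 T A C) + (\<Sum>C\<in>nb A. k3 T A C)"
    using sum.union_inter[of "nb T" "nb A" "k3 T A"] nonneg by simp
  then show ?thesis using 1 2 by (simp add: sum_distrib_left[symmetric])
qed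

theorem char_fun_bound:
  "cmod (ex (\<lambda>U. iexp (t * W U)) - of_real (exp (- (var * t\<^sup>2) / 2))) \<le> 36 * kappa * \<bar>t\<bar> ^ 3"
proof (rule gaussian_ode_bound[where f' = "\<lambda>t. \<i> * ex (\<lambda>U. of_real (W U) * iexp (t * W U))"])
  show "((\<lambda>t. ex (\<lambda>U. iexp (t * W U))) has_vector_derivative
      \<i> * ex (\<lambda>U. of_real (W U) * iexp (t * W U))) (at t)" for t
  proof -
    have "((\<lambda>t. iexp (t * W U)) has_vector_derivative \<i> * (of_real (W U) * iexp (t * W U))) (at t)" for U
    proof -
      have "((\<lambda>t. t * W U) has_vector_derivative W U) (at t)"
        using has_vector_derivative_mult_left[OF has_vector_derivative_id[of "at t"], of "W U"] by simp
      from vector_diff_chain_at[OF this has_vector_derivative_iexp]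
      show ?thesis by (simp add: o_def scaleR_conv_of_real mult_ac)
    qed
    then show ?thesis
      unfolding bex_mult_left[symmetric] unfolding bex_def
      by (intro has_vector_derivative_sum
          bounded_linear.has_vector_derivative[OF bounded_linear_scaleR_right])
  qed
  show "cmod (\<i> * ex (\<lambda>U. of_real (W U) * iexp (t * W U)) + of_real (var * t) * ex (\<lambda>U. iexp (t * W U)))
      \<le> 36 * kappa * t\<^sup>2" for t
  proof -
    define f where "f = ex (\<lambda>U. iexp (t * W U))"
    \<comment> \<open>\<open>e1\<close> is the Taylor error of removing the neighbours of
      \<open>T\<close>; \<open>e2\<close> is the error of decoupling \<open>Y T * Y A\<close> from
      the exponential.\<close>
    define e1 where "e1 T = ex (\<lambda>U. of_real (Y T U) * iexp (t * W U))
      - \<i> * t * ex (\<lambda>U. of_real (Y T U * V (B T) U) * iexp (t * W U))" for T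
    define e2 where "e2 T A = ex (\<lambda>U. of_real (Y T U * Y A U) * iexp (t * W U))
      - of_real (ex (\<lambda>U. Y T U * Y A U)) * f" for T A
    have e1: "cmod (e1 T) \<le> t\<^sup>2 * (4 * (\<Sum>A\<in>nb T. \<Sum>C\<in>nb T. k3 T A C))" if "T \<in> I" for T
      unfolding e1_def using mult_left_mono[OF ex_Y_V2[OF that], of "t\<^sup>2 / 2"]
      by (intro order_trans[OF first_order[OF that]]) simp
    have e2: "cmod (e2 T A) \<le> \<bar>t\<bar> * (16 * ((\<Sum>C\<in>nb T. k3 T A C) + (\<Sum>C\<in>nb A. k3 T A C)))"
      if "T \<in> I" "A \<in> nb T" for T A
    proof -
      have A: "A \<in> I" using that near_sub by auto
      have "cmod (e2 T A) \<le> \<bar>t\<bar> * (ex (\<lambda>U. \<bar>Y T U * Y A U\<bar> * \<bar>V (B T \<union> B A) U\<bar>)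
          + ex (\<lambda>U. \<bar>Y T U * Y A U\<bar>) * ex (\<lambda>U. \<bar>V (B T \<union> B A) U\<bar>))"
        unfolding e2_def f_def using that A B_sub by (intro decorrelate) (auto simp: Y_local)
      also have "\<dots> \<le> \<bar>t\<bar> * (16 * ((\<Sum>C\<in>nb T. k3 T A C) + (\<Sum>C\<in>nb A. k3 T A C)))"
        by (intro mult_left_mono ex_YY_V that A) auto
      finally show ?thesis .
    qed
    have T: "ex (\<lambda>U. of_real (Y T U) * iexp (t * W U))
        = e1 T + \<i> * t * (\<Sum>A\<in>nb T. e2 T A + of_real (ex (\<lambda>U. Y T U * Y A U)) * f)" for T
    proof -
      have "ex (\<lambda>U. of_real (Y T U * V (B T) U) * iexp (t * W U))
          = (\<Sum>A\<in>nb T. ex (\<lambda>U. of_real (Y T U * Y A U) * iexp (t * W U)))"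
        unfolding V_def by (simp add: sum_distrib_left sum_distrib_right bex_sum)
      then show ?thesis by (simp add: e1_def e2_def)
    qed
    have "\<i> * ex (\<lambda>U. of_real (W U) * iexp (t * W U))
        = \<i> * (\<Sum>T\<in>I. ex (\<lambda>U. of_real (Y T U) * iexp (t * W U)))"
    proof -
      have "(\<lambda>U. of_real (W U) * iexp (t * W U)) = (\<lambda>U. \<Sum>T\<in>I. of_real (Y T U) * iexp (t * W U))"
        unfolding sum_distrib_right[symmetric] of_real_sum[symmetric] W_def ..
      then show ?thesis by (simp only: bex_sum)
    qed
    \<comment> \<open>The covariances carry the factor i * (i t) = -t and add up to the Gaussian
      term.\<close>
    also have "\<dots> = \<i> * (\<Sum>T\<in>I. e1 T) - t * (\<Sum>T\<in>I. \<Sum>A\<in>nb T. e2 T A) - of_real (var * t) * f"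
      unfolding T var_def
      by (simp add: sum.distrib sum_distrib_left[symmetric] sum_distrib_right[symmetric]
          algebra_simps flip: of_real_sum)
    finally have "\<i> * ex (\<lambda>U. of_real (W U) * iexp (t * W U)) + of_real (var * t) * f
        = \<i> * (\<Sum>T\<in>I. e1 T) - t * (\<Sum>T\<in>I. \<Sum>A\<in>nb T. e2 T A)" by simp
    then have "cmod (\<i> * ex (\<lambda>U. of_real (W U) * iexp (t * W U)) + of_real (var * t) * f)
        \<le> cmod (\<Sum>T\<in>I. e1 T) + \<bar>t\<bar> * cmod (\<Sum>T\<in>I. \<Sum>A\<in>nb T. e2 T A)"
      using norm_triangle_ineq4[of "\<i> * (\<Sum>T\<in>I. e1 T)" "t * (\<Sum>T\<in>I. \<Sum>A\<in>nb T. e2 T A)"]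
      by (simp add: norm_mult)
    also have "\<dots> \<le> (\<Sum>T\<in>I. t\<^sup>2 * (4 * (\<Sum>A\<in>nb T. \<Sum>C\<in>nb T. k3 T A C)))
        + \<bar>t\<bar> * (\<Sum>T\<in>I. \<Sum>A\<in>nb T. \<bar>t\<bar> * (16 * ((\<Sum>C\<in>nb T. k3 T A C) + (\<Sum>C\<in>nb A. k3 T A C))))"
      by (intro add_mono mult_left_mono sum_norm_le e1 e2) auto
    \<comment> \<open>36 = 4 + 16 + 16: the Taylor error, and the decoupling error for C near T and
      for C near A.\<close>
    also have "\<dots> = 36 * kappa * t\<^sup>2"
    proof -
      have "(\<Sum>T\<in>I. t\<^sup>2 * (4 * (\<Sum>A\<in>nb T. \<Sum>C\<in>nb T. k3 T A C))) = 4 * kappa * t\<^sup>2"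
        by (simp add: kappa_def sum_distrib_left mult_ac)
      moreover have "\<bar>t\<bar> * (\<Sum>T\<in>I. \<Sum>A\<in>nb T. \<bar>t\<bar> * (16 * ((\<Sum>C\<in>nb T. k3 T A C) + (\<Sum>C\<in>nb A. k3 T A C))))
          = \<bar>t\<bar> * \<bar>t\<bar> * 16 * (kappa + (\<Sum>T\<in>I. \<Sum>A\<in>nb T. \<Sum>C\<in>nb A. k3 T A C))"
        unfolding kappa_def sum.distrib[symmetric] sum_distrib_left[symmetric]
        by (simp add: mult_ac)
      ultimately show ?thesis by (simp add: kappa_swap power2_eq_square)
    qed
    finally show ?thesis unfolding f_def .
  qed
qed (use fin_E var_nonneg kappa_nonneg in auto)

section \<open>Closed form of the variance and reduction of the third-order term to edges\<close>

lemma ex_YY: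
  assumes "T \<in> I" "A \<in> I"
  shows "ex (\<lambda>U. Y T U * Y A U) = wt T * wt A * (pr (B T \<union> B A) - pr (B T) * pr (B A))"
proof -
  have "ex (\<lambda>U. Y T U * Y A U) = ex (\<lambda>U. Z T U * Z A U - mu T * Z A U - mu A * Z T U + mu T * mu A)"
    by (intro bex_cong) (simp add: Y_def algebra_simps)
  also have "\<dots> = ex (\<lambda>U. Z T U * Z A U) - mu T * mu A"
    using assms by (simp add: bex_add bex_diff bex_mult_left ex_Z fin_E)
  finally show ?thesis using assms by (simp add: ex_ZZ[of T A] mu_def right_diff_distrib)
qed

text \<open>
  The sum over edges is the contribution of the linear part of the Hoeffding decomposition.
\<close>

lemma var_closed_form:
  assumes inter: "\<And>T A. T \<in> I \<Longrightarrow> A \<in> I \<Longrightarrow> T \<noteq> A \<Longrightarrow> card (B T \<inter> B A) \<le> 1"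
    and q_pos: "\<And>e. e \<in> E \<Longrightarrow> 0 < q e"
  shows "var = (\<Sum>T\<in>I. (wt T)\<^sup>2 * pr (B T) * (1 - pr (B T)) - (\<Sum>e\<in>B T. (mu T)\<^sup>2 * ((1 - q e) / q e)))
    + (\<Sum>e\<in>E. (1 - q e) / q e * (\<Sum>T | T \<in> I \<and> e \<in> B T. mu T)\<^sup>2)"
proof -
  let ?r = "\<lambda>e. (1 - q e) / q e"
  \<comment> \<open>Distinct monomials with one common edge e have covariance
    \<open>mu T * mu A * (1 / q e - 1)\<close>. On the diagonal the sum of these expressions over
    all edges of \<open>T\<close> is not the variance; \<open>d T\<close> is the difference.\<close>
  define d where "d T = (wt T)\<^sup>2 * pr (B T) * (1 - pr (B T)) - (\<Sum>e\<in>B T. (mu T)\<^sup>2 * ?r e)" for T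
  have cov: "ex (\<lambda>U. Y T U * Y A U)
      = (\<Sum>e\<in>B T \<inter> B A. mu T * mu A * ?r e) + (if A = T then d T else 0)"
    if I: "T \<in> I" "A \<in> I" for T A
  proof (cases "A = T")
    case True
    then show ?thesis using I by (simp add: ex_YY d_def power2_eq_square algebra_simps)
  next
    case False
    have fin: "finite (B T)" "finite (B A)" using I B_sub fin_E finite_subset by metis+
    then have *: "pr (B T \<union> B A) * pr (B T \<inter> B A) = pr (B T) * pr (B A)"
      unfolding pr_def by (intro prod.union_inter)
    have "card (B T \<inter> B A) = 0 \<or> card (B T \<inter> B A) = 1" using inter[OF I] False by force
    then consider "B T \<inter> B A = {}" | e where "B T \<inter> B A = {e}"
      using fin by (auto simp: card_1_singleton_iff)
    then show ?thesis
    proof cases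
      case 1
      then show ?thesis using * False I by (simp add: ex_YY pr_def)
    next
      case (2 e)
      then have "e \<in> E" using I B_sub by blast
      then have "0 < q e" by (rule q_pos)
      have "pr (B T \<union> B A) = pr (B T) * pr (B A) / q e"
        using * \<open>0 < q e\<close> by (simp add: 2 pr_def[of "{e}"] field_simps)
      then show ?thesis using False I \<open>0 < q e\<close>
        by (simp add: 2 ex_YY mu_def field_simps Un_commute)
    qed
  qed
  have disj: "ex (\<lambda>U. Y T U * Y A U) = 0" if "T \<in> I" "A \<in> I" "B A \<inter> B T = {}" for T A
    using that cov[OF that(1,2)] by (auto simp: d_def pr_def Int_commute)
  have "var = (\<Sum>T\<in>I. \<Sum>A\<in>I. ex (\<lambda>U. Y T U * Y A U))"
    unfolding var_def
    by (rule sum.cong[OF refl], rule sum.mono_neutral_left)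
       (use fin_I near_sub disj in \<open>auto simp: near_def\<close>)
  also have "\<dots> = (\<Sum>T\<in>I. \<Sum>A\<in>I. \<Sum>e\<in>B T \<inter> B A. mu T * mu A * ?r e) + (\<Sum>T\<in>I. d T)"
    using fin_I by (simp add: cov sum.distrib)
  \<comment> \<open>With indicators in place of the range of e, the sum over edges can be moved
    outside, where the double sum over \<open>T\<close> and \<open>A\<close> becomes a
    square.\<close>
  also have "(\<Sum>T\<in>I. \<Sum>A\<in>I. \<Sum>e\<in>B T \<inter> B A. mu T * mu A * ?r e)
      = (\<Sum>T\<in>I. \<Sum>A\<in>I. \<Sum>e\<in>E. of_bool (e \<in> B T) * mu T * (of_bool (e \<in> B A) * mu A) * ?r e)"
  proof (rule sum.cong[OF refl], rule sum.cong[OF refl])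
    fix T A assume "T \<in> I" "A \<in> I"
    then show "(\<Sum>e\<in>B T \<inter> B A. mu T * mu A * ?r e)
        = (\<Sum>e\<in>E. of_bool (e \<in> B T) * mu T * (of_bool (e \<in> B A) * mu A) * ?r e)"
      using fin_E B_sub[of T] by (intro sum.mono_neutral_cong_left) auto
  qed
  also have "\<dots> = (\<Sum>T\<in>I. \<Sum>e\<in>E. \<Sum>A\<in>I. of_bool (e \<in> B T) * mu T * (of_bool (e \<in> B A) * mu A) * ?r e)"
    by (rule sum.cong[OF refl], rule sum.swap)
  also have "\<dots> = (\<Sum>e\<in>E. \<Sum>T\<in>I. \<Sum>A\<in>I. of_bool (e \<in> B T) * mu T * (of_bool (e \<in> B A) * mu A) * ?r e)"
    by (rule sum.swap)
  also have "\<dots> = (\<Sum>e\<in>E. ?r e * ((\<Sum>T\<in>I. of_bool (e \<in> B T) * mu T) * (\<Sum>A\<in>I. of_bool (e \<in> B A) * mu A)))"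
    by (simp add: sum_product sum_distrib_left mult_ac)
  also have "\<dots> = (\<Sum>e\<in>E. ?r e * (\<Sum>T | T \<in> I \<and> e \<in> B T. mu T)\<^sup>2)"
    using fin_I by (simp add: power2_eq_square sum.inter_filter of_bool_def if_distrib[of "\<lambda>x. x * _"] cong: if_cong)
  finally show ?thesis by (simp add: d_def)
qed

text \<open>The inner double sum is the expectation of \<open>Z T\<close> times a square. Every
  neighbour of \<open>T\<close> contains an edge of \<open>T\<close>, so the sum being squared is at
  most a sum of at most k stars, and Cauchy-Schwarz yields the factor k.\<close>

lemma kappa_le:
  assumes card: "\<And>T. T \<in> I \<Longrightarrow> card (B T) \<le> k"
  shows "kappa \<le> real k * (\<Sum>T\<in>I. \<Sum>e\<in>B T. ex (\<lambda>U. Z T U * (\<Sum>A | A \<in> I \<and> e \<in> B A. Z A U)\<^sup>2))"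
proof -
  let ?s = "\<lambda>e U. \<Sum>A | A \<in> I \<and> e \<in> B A. Z A U"
  have "(\<Sum>A\<in>nb T. \<Sum>C\<in>nb T. k3 T A C) \<le> real k * (\<Sum>e\<in>B T. ex (\<lambda>U. Z T U * (?s e U)\<^sup>2))"
    if T: "T \<in> I" for T
  proof -
    have finB: "finite (B T)" using T B_sub fin_E finite_subset by metis
    have "(\<Sum>A\<in>nb T. \<Sum>C\<in>nb T. k3 T A C) = ex (\<lambda>U. Z T U * (\<Sum>A\<in>nb T. Z A U)\<^sup>2)"
      unfolding k3_def bex_sum[symmetric]
      by (simp add: power2_eq_square sum_product sum_distrib_left mult_ac)
    also have "\<dots> \<le> ex (\<lambda>U. Z T U * (real k * (\<Sum>e\<in>B T. (?s e U)\<^sup>2)))"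
    proof (intro bex_mono q01 mult_left_mono Z_nonneg T)
      fix U
      have "(\<Sum>A\<in>nb T. Z A U) \<le> (\<Sum>A\<in>nb T. \<Sum>e\<in>B T. of_bool (e \<in> B A) * Z A U)"
      proof (rule sum_mono)
        fix A assume A: "A \<in> nb T"
        then obtain e where e: "e \<in> B T" "e \<in> B A" by (auto simp: near_def)
        have "Z A U = (\<Sum>e\<in>{e}. of_bool (e \<in> B A) * Z A U)" using e by simp
        also have "\<dots> \<le> (\<Sum>e\<in>B T. of_bool (e \<in> B A) * Z A U)"
          using e finB A near_sub Z_nonneg by (intro sum_mono2) auto
        finally show "Z A U \<le> (\<Sum>e\<in>B T. of_bool (e \<in> B A) * Z A U)" .
      qed
      also have "\<dots> \<le> (\<Sum>A\<in>I. \<Sum>e\<in>B T. of_bool (e \<in> B A) * Z A U)"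
        using fin_I near_sub Z_nonneg by (intro sum_mono2 sum_nonneg) auto
      also have "\<dots> = (\<Sum>e\<in>B T. ?s e U)"
        using fin_I by (subst sum.swap) (simp add: sum.inter_filter of_bool_def if_distrib[of "\<lambda>x. x * _"] cong: if_cong)
      finally have "(\<Sum>A\<in>nb T. Z A U) \<le> (\<Sum>e\<in>B T. ?s e U)" .
      then have "(\<Sum>A\<in>nb T. Z A U)\<^sup>2 \<le> (\<Sum>e\<in>B T. ?s e U)\<^sup>2"
        using near_sub by (intro power_mono sum_nonneg Z_nonneg) auto
      also have "\<dots> \<le> real (card (B T)) * (\<Sum>e\<in>B T. (?s e U)\<^sup>2)"
        using sum_squared_le_sum_of_squares[of "\<lambda>e. ?s e U" "B T"] finB by (simp add: mult.commute)
      also have "\<dots> \<le> real k * (\<Sum>e\<in>B T. (?s e U)\<^sup>2)"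
        using card[OF T] by (intro mult_right_mono sum_nonneg) auto
      finally show "(\<Sum>A\<in>nb T. Z A U)\<^sup>2 \<le> real k * (\<Sum>e\<in>B T. (?s e U)\<^sup>2)" .
    qed
    also have "\<dots> = real k * (\<Sum>e\<in>B T. ex (\<lambda>U. Z T U * (?s e U)\<^sup>2))"
      unfolding bex_sum[symmetric] bex_mult_left[symmetric]
      by (simp add: sum_distrib_left mult_ac)
    finally show ?thesis .
  qed
  then show ?thesis
    unfolding kappa_def sum_distrib_left[of "real k"] by (intro sum_mono)
qed

end

section \<open>Triangles\<close>

text \<open>Weights and probabilities are symmetric functions on all pairs, although only the pairs
  with i < j carry random bits. The zero diagonal of \<open>w\<close> removes degenerate triples
  from unrestricted sums.\<close>

locale triangles =
  fixes L :: "int set" and w q :: "int \<Rightarrow> int \<Rightarrow> real"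
  assumes fin_L: "finite L"
    and w_sym: "w i j = w j i" and w_diag: "w i i = 0" and w_nonneg: "0 \<le> w i j"
    and q_sym: "q i j = q j i" and q_pos: "0 < q i j" and q_le_1: "q i j \<le> 1"
begin

definition edges :: "(int \<times> int) set" where
  "edges = {(i, j). i \<in> L \<and> j \<in> L \<and> i < j}"

definition tris :: "(int \<times> int \<times> int) set" where
  "tris = {(i, j, k). i \<in> L \<and> j \<in> L \<and> k \<in> L \<and> i < j \<and> j < k}"

definition sides :: "int \<times> int \<times> int \<Rightarrow> (int \<times> int) set" where
  "sides = (\<lambda>(i, j, k). {(i, j), (j, k), (i, k)})"

text \<open>The 6 counts the closed walks of length three around one triangle, all of which occur in
  the trace of the cube.\<close>

definition w3 :: "int \<times> int \<times> int \<Rightarrow> real" where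
  "w3 = (\<lambda>(i, j, k). 6 * (w i j * w j k * w i k))"

section \<open>Triangles, their sides, and sums over ordered triples\<close>

lemma fin_edges: "finite edges"
  by (rule finite_subset[of _ "L \<times> L"]) (auto simp: edges_def fin_L)

lemma fin_tris: "finite tris"
  by (rule finite_subset[of _ "L \<times> L \<times> L"]) (auto simp: tris_def fin_L)

sublocale monomial_sum edges "\<lambda>(i, j). q i j" tris sides w3
proof
  show "finite edges" "finite tris" by (fact fin_edges fin_tris)+
qed (auto simp: edges_def tris_def sides_def w3_def w_nonneg q_pos q_le_1 less_imp_le)

text \<open>Two different sides of a triangle already determine its three vertices.\<close>

lemma sides_inter:
  assumes "T \<in> tris" "A \<in> tris" "T \<noteq> A"
  shows "card (sides T \<inter> sides A) \<le> 1"
proof -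
  have "e = e'" if "e \<in> sides T \<inter> sides A" "e' \<in> sides T \<inter> sides A" for e e'
    using assms that unfolding tris_def sides_def by auto
  then show ?thesis by (metis card_le_Suc0_iff_eq One_nat_def finite.emptyI finite_Int card.infinite le0)
qed

lemma card_sides: "card (sides T) \<le> 3"
  by (cases T) (auto simp: sides_def card_insert_if)

text \<open>A triple of distinct labels has exactly one increasing rearrangement; the six orders are
  separated by indicators and each is reindexed to the increasing one. Degenerate triples contribute
  nothing.\<close>

lemma sum_tris:
  fixes f :: "int \<Rightarrow> int \<Rightarrow> int \<Rightarrow> real"
  assumes sym: "\<And>i j k. f i j k = f j i k" "\<And>i j k. f i j k = f i k j"
    and diag: "\<And>i k. f i i k = 0"
  shows "(\<Sum>i\<in>L. \<Sum>j\<in>L. \<Sum>k\<in>L. f i j k) = 6 * (\<Sum>(i, j, k)\<in>tris. f i j k)"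
proof -
  let ?o = "\<lambda>i j k :: int. if i < j \<and> j < k then f i j k else 0"
  let ?C = "L \<times> L \<times> L"
  have deg: "f i i k = 0" "f i k i = 0" "f k i i = 0" for i k using diag sym by metis+
  have s: "f i k j = f i j k" "f j i k = f i j k" "f j k i = f i j k" "f k i j = f i j k" "f k j i = f i j k" for i j k
    using sym by metis+
  have six: "f i j k = ?o i j k + ?o i k j + ?o j i k + ?o j k i + ?o k i j + ?o k j i" for i j k
    using deg[of i k] deg[of i j] deg[of j i] by (auto simp: s)
  have "(\<Sum>i\<in>L. \<Sum>j\<in>L. \<Sum>k\<in>L. f i j k) = (\<Sum>(i, j, k)\<in>?C. f i j k)"
    by (simp add: sum.cartesian_product split_def)
  also have "\<dots> = (\<Sum>(i, j, k)\<in>?C. ?o i j k) + (\<Sum>(i, j, k)\<in>?C. ?o i k j) + (\<Sum>(i, j, k)\<in>?C. ?o j i k)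
      + (\<Sum>(i, j, k)\<in>?C. ?o j k i) + (\<Sum>(i, j, k)\<in>?C. ?o k i j) + (\<Sum>(i, j, k)\<in>?C. ?o k j i)"
    unfolding sum.distrib[symmetric] by (rule sum.cong[OF refl]) (use six in \<open>auto simp only: split\<close>)
  also have "(\<Sum>(i, j, k)\<in>?C. ?o i k j) = (\<Sum>(i, j, k)\<in>?C. ?o i j k)"
    by (rule sum.reindex_bij_witness[where i = "\<lambda>(i, j, k). (i, k, j)" and j = "\<lambda>(i, j, k). (i, k, j)"]) auto
  also have "(\<Sum>(i, j, k)\<in>?C. ?o j i k) = (\<Sum>(i, j, k)\<in>?C. ?o i j k)"
    by (rule sum.reindex_bij_witness[where i = "\<lambda>(i, j, k). (j, i, k)" and j = "\<lambda>(i, j, k). (j, i, k)"]) auto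
  also have "(\<Sum>(i, j, k)\<in>?C. ?o j k i) = (\<Sum>(i, j, k)\<in>?C. ?o i j k)"
    by (rule sum.reindex_bij_witness[where i = "\<lambda>(j, k, i). (i, j, k)" and j = "\<lambda>(i, j, k). (j, k, i)"]) auto
  also have "(\<Sum>(i, j, k)\<in>?C. ?o k i j) = (\<Sum>(i, j, k)\<in>?C. ?o i j k)"
    by (rule sum.reindex_bij_witness[where i = "\<lambda>(k, i, j). (i, j, k)" and j = "\<lambda>(i, j, k). (k, i, j)"]) auto
  also have "(\<Sum>(i, j, k)\<in>?C. ?o k j i) = (\<Sum>(i, j, k)\<in>?C. ?o i j k)"
    by (rule sum.reindex_bij_witness[where i = "\<lambda>(k, j, i). (i, j, k)" and j = "\<lambda>(i, j, k). (k, j, i)"]) auto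
  also have "(\<Sum>(i, j, k)\<in>?C. ?o i j k) = (\<Sum>(i, j, k)\<in>tris. f i j k)"
    using fin_L by (intro sum.mono_neutral_cong_right) (auto simp: tris_def split: if_splits)
  finally show ?thesis by simp
qed

lemma sum_star:
  fixes f :: "int \<Rightarrow> int \<Rightarrow> int \<Rightarrow> real"
  assumes sym: "\<And>i j k. f i j k = f j i k" "\<And>i j k. f i j k = f i k j"
    and diag: "\<And>i k. f i i k = 0"
    and e: "(p, r) \<in> edges"
  shows "(\<Sum>(i, j, k) | (i, j, k) \<in> tris \<and> (p, r) \<in> sides (i, j, k). f i j k) = (\<Sum>k\<in>L. f p r k)"
proof -
  have deg: "f i i k = 0" "f i k i = 0" "f k i i = 0" for i k using diag sym by metis+
  have s: "f i k j = f i j k" "f j i k = f i j k" "f j k i = f i j k" "f k i j = f i j k" "f k j i = f i j k" for i j k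
    using sym by metis+
  let ?sort = "\<lambda>k. if k < p then (k, p, r) else if k < r then (p, k, r) else (p, r, k)"
  have "(\<Sum>(i, j, k) | (i, j, k) \<in> tris \<and> (p, r) \<in> sides (i, j, k). f i j k)
      = (\<Sum>k\<in>L - {p, r}. f p r k)"
    \<comment> \<open>The third vertex of a triangle through the edge (p, r) is the sum of all its
      vertices minus p and r, whichever side that edge is.\<close>
    by (rule sum.reindex_bij_witness[where i = ?sort and j = "\<lambda>(i, j, k). i + j + k - p - r"])
       (use e in \<open>auto simp: tris_def sides_def edges_def s split: if_splits\<close>)
  also have "\<dots> = (\<Sum>k\<in>L. f p r k)"
    using fin_L deg by (intro sum.mono_neutral_left) auto
  finally show ?thesis .
qed

lemma sum_edges:
  fixes g :: "int \<Rightarrow> int \<Rightarrow> real"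
  assumes sym: "\<And>i j. g i j = g j i" and diag: "\<And>i. g i i = 0"
  shows "(\<Sum>i\<in>L. \<Sum>j\<in>L. g i j) = 2 * (\<Sum>(i, j)\<in>edges. g i j)"
proof -
  let ?o = "\<lambda>i j :: int. if i < j then g i j else 0"
  have two: "g i j = ?o i j + ?o j i" for i j using sym[of i j] diag[of i] by auto
  have "(\<Sum>i\<in>L. \<Sum>j\<in>L. g i j) = (\<Sum>(i, j)\<in>L \<times> L. g i j)"
    by (simp add: sum.cartesian_product)
  also have "\<dots> = (\<Sum>(i, j)\<in>L \<times> L. ?o i j) + (\<Sum>(i, j)\<in>L \<times> L. ?o j i)"
    unfolding sum.distrib[symmetric] by (rule sum.cong[OF refl]) (use two in \<open>auto simp only: split\<close>)
  also have "(\<Sum>(i, j)\<in>L \<times> L. ?o j i) = (\<Sum>(i, j)\<in>L \<times> L. ?o i j)"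
    by (rule sum.reindex_bij_witness[where i = "\<lambda>(i, j). (j, i)" and j = "\<lambda>(i, j). (j, i)"]) auto
  also have "(\<Sum>(i, j)\<in>L \<times> L. ?o i j) = (\<Sum>(i, j)\<in>edges. g i j)"
    using fin_L by (intro sum.mono_neutral_cong_right) (auto simp: edges_def split: if_splits)
  finally show ?thesis by simp
qed

lemma pr_sides: "(i, j, k) \<in> tris \<Longrightarrow> pr (sides (i, j, k)) = q i j * q j k * q i k"
  by (auto simp: pr_def sides_def tris_def)

lemma sum_sides:
  "(i, j, k) \<in> tris \<Longrightarrow> (\<Sum>e\<in>sides (i, j, k). g e) = g (i, j) + g (j, k) + (g (i, k) :: real)"
  by (auto simp: sides_def tris_def)

lemma w3_apply: "w3 (i, j, k) = 6 * (w i j * w j k * w i k)"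
  by (simp add: w3_def)

lemma mu_tri: "(i, j, k) \<in> tris \<Longrightarrow> mu (i, j, k) = 6 * (w i j * w j k * w i k) * (q i j * q j k * q i k)"
  by (simp add: mu_def w3_apply pr_sides)

text \<open>In the closed form of the variance, \<open>1 - defect\<close> is what remains of the
  diagonal term relative to its leading part \<open>(w3 T)\<^sup>2 * pr (sides T)\<close>: the
  summand 1 stems from the squared mean, the other three from the linear parts of the sides, which
  the edge sum already contains.\<close>

definition defect :: "int \<Rightarrow> int \<Rightarrow> int \<Rightarrow> real" where
  "defect i j k = q i j * q j k * q i k
     * (1 + (1 - q i j) / q i j + (1 - q j k) / q j k + (1 - q i k) / q i k)"

lemma sum_mu_star:
  assumes "(p, r) \<in> edges"
  shows "(\<Sum>T | T \<in> tris \<and> (p, r) \<in> sides T. mu T)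
    = 6 * w p r * q p r * (\<Sum>k\<in>L. w p k * q p k * (w r k * q r k))"
proof -
  let ?f = "\<lambda>i j k. 6 * (w i j * w j k * w i k) * (q i j * q j k * q i k)"
  have "(\<Sum>T | T \<in> tris \<and> (p, r) \<in> sides T. mu T)
      = (\<Sum>(i, j, k) | (i, j, k) \<in> tris \<and> (p, r) \<in> sides (i, j, k). ?f i j k)"
    by (intro sum.cong) (auto simp: mu_tri)
  also have "\<dots> = (\<Sum>k\<in>L. ?f p r k)"
    using assms by (intro sum_star) (auto simp: w_diag w_sym q_sym mult_ac)
  also have "\<dots> = 6 * w p r * q p r * (\<Sum>k\<in>L. w p k * q p k * (w r k * q r k))"
    by (simp add: sum_distrib_left mult_ac)
  finally show ?thesis .
qed

text \<open>Squaring the weight 6 gives 36. Passing to ordered triples divides by 6, and passing to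
  ordered pairs by 2, which leaves 6 and 18.\<close>

lemma var_triangles:
  "var = 6 * (\<Sum>i\<in>L. \<Sum>j\<in>L. \<Sum>k\<in>L. (w i j * w j k * w i k)\<^sup>2 * (q i j * q j k * q i k) * (1 - defect i j k))
    + 18 * (\<Sum>i\<in>L. \<Sum>j\<in>L. (w i j)\<^sup>2 * q i j * (1 - q i j) * (\<Sum>k\<in>L. w i k * q i k * (w j k * q j k))\<^sup>2)"
proof -
  let ?q = "\<lambda>(i, j). q i j"
  let ?f = "\<lambda>i j k. (w i j * w j k * w i k)\<^sup>2 * (q i j * q j k * q i k) * (1 - defect i j k)"
  let ?g = "\<lambda>i j. (w i j)\<^sup>2 * q i j * (1 - q i j) * (\<Sum>k\<in>L. w i k * q i k * (w j k * q j k))\<^sup>2"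
  have "var = (\<Sum>T\<in>tris. (w3 T)\<^sup>2 * pr (sides T) * (1 - pr (sides T)) - (\<Sum>e\<in>sides T. (mu T)\<^sup>2 * ((1 - ?q e) / ?q e)))
    + (\<Sum>e\<in>edges. (1 - ?q e) / ?q e * (\<Sum>T | T \<in> tris \<and> e \<in> sides T. mu T)\<^sup>2)"
    using q_pos by (intro var_closed_form sides_inter) auto
  also have "(\<Sum>T\<in>tris. (w3 T)\<^sup>2 * pr (sides T) * (1 - pr (sides T)) - (\<Sum>e\<in>sides T. (mu T)\<^sup>2 * ((1 - ?q e) / ?q e)))
      = 36 * (\<Sum>(i, j, k)\<in>tris. ?f i j k)"
    unfolding sum_distrib_left
  proof (intro sum.cong refl)
    fix T assume T: "T \<in> tris"
    then obtain i j k where ijk: "T = (i, j, k)" "(i, j, k) \<in> tris" by (cases T) auto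
    have "(6 * a)\<^sup>2 * Q * (1 - Q) - ((6 * a * Q)\<^sup>2 * r1 + (6 * a * Q)\<^sup>2 * r2 + (6 * a * Q)\<^sup>2 * r3)
        = 36 * (a\<^sup>2 * Q * (1 - Q * (1 + r1 + r2 + r3)))" for a Q r1 r2 r3 :: real
      by (simp add: power2_eq_square algebra_simps)
    then show "(w3 T)\<^sup>2 * pr (sides T) * (1 - pr (sides T)) - (\<Sum>e\<in>sides T. (mu T)\<^sup>2 * ((1 - ?q e) / ?q e))
        = 36 * (case T of (i, j, k) \<Rightarrow> ?f i j k)"
      using ijk(2) by (simp only: ijk(1) pr_sides sum_sides mu_tri w3_apply defect_def split)
  qed
  also have "\<dots> = 6 * (\<Sum>i\<in>L. \<Sum>j\<in>L. \<Sum>k\<in>L. ?f i j k)"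
    by (subst sum_tris[of ?f]) (auto simp: w_diag w_sym q_sym defect_def mult_ac add_ac)
  also have "(\<Sum>e\<in>edges. (1 - ?q e) / ?q e * (\<Sum>T | T \<in> tris \<and> e \<in> sides T. mu T)\<^sup>2)
      = 36 * (\<Sum>(i, j)\<in>edges. ?g i j)"
    unfolding sum_distrib_left
  proof (intro sum.cong refl)
    fix e assume "e \<in> edges"
    then obtain i j where e: "e = (i, j)" "(i, j) \<in> edges" by (cases e) auto
    have "(1 - q i j) / q i j * (6 * w i j * q i j * s)\<^sup>2 = 36 * ((w i j)\<^sup>2 * q i j * (1 - q i j) * s\<^sup>2)" for s
      using q_pos[of i j] by (simp add: power2_eq_square field_simps)
    then show "(1 - ?q e) / ?q e * (\<Sum>T | T \<in> tris \<and> e \<in> sides T. mu T)\<^sup>2 = 36 * (case e of (i, j) \<Rightarrow> ?g i j)"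
      using e by (simp only: sum_mu_star split)
  qed
  also have "\<dots> = 18 * (\<Sum>i\<in>L. \<Sum>j\<in>L. ?g i j)"
    by (subst sum_edges[of ?g]) (auto simp: w_diag w_sym q_sym mult_ac)
  finally show ?thesis .
qed

section \<open>Common neighbours and the third-order term\<close>

definition x :: "int \<Rightarrow> int \<Rightarrow> (int \<times> int) set \<Rightarrow> real" where
  "x i j U = w i j * of_bool ((min i j, max i j) \<in> U)"

text \<open>The entry (p, r) of the square of the random matrix, a weighted count of the common
  neighbours of p and r.\<close>

definition P :: "int \<Rightarrow> int \<Rightarrow> (int \<times> int) set \<Rightarrow> real" where
  "P p r U = (\<Sum>k\<in>L. x p k U * x r k U)"

lemma x_sym: "x i j U = x j i U"
  by (simp add: x_def w_sym min.commute max.commute)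

lemma x_diag [simp]: "x i i U = 0" by (simp add: x_def w_diag)

lemma x_bounds: "0 \<le> x i j U" "x i j U \<le> w i j"
  using w_nonneg by (auto simp: x_def)

lemma P_sym: "P p r U = P r p U" by (simp add: P_def mult.commute)

lemma sides_apply: "sides (i, j, k) = {(i, j), (j, k), (i, k)}"
  by (simp add: sides_def)

lemma Z_tri: "(i, j, k) \<in> tris \<Longrightarrow> Z (i, j, k) U = 6 * (x i j U * x j k U * x i k U)"
  by (auto simp: Z_def w3_apply tris_def sides_apply x_def min_def max_def)

lemma sum_Z_star:
  assumes "(p, r) \<in> edges"
  shows "(\<Sum>T | T \<in> tris \<and> (p, r) \<in> sides T. Z T U) = 6 * x p r U * P p r U"
proof -
  let ?f = "\<lambda>i j k. 6 * (x i j U * x j k U * x i k U)"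
  have "(\<Sum>T | T \<in> tris \<and> (p, r) \<in> sides T. Z T U)
      = (\<Sum>(i, j, k) | (i, j, k) \<in> tris \<and> (p, r) \<in> sides (i, j, k). ?f i j k)"
    by (intro sum.cong) (auto simp: Z_tri)
  also have "\<dots> = (\<Sum>k\<in>L. ?f p r k)"
    using assms by (intro sum_star) (auto simp: x_sym mult_ac)
  also have "\<dots> = 6 * x p r U * P p r U"
    by (simp add: P_def sum_distrib_left mult_ac)
  finally show ?thesis .
qed

text \<open>The contribution of a triangle with marked side (p, r). The squared star at that side
  contains the square of \<open>x p r\<close>, which is bounded by the constant
  \<open>(w p r)\<^sup>2\<close>; a first power of \<open>x p r\<close> is still present from the
  triangle itself.\<close>

definition G0 :: "int \<Rightarrow> int \<Rightarrow> int \<Rightarrow> real" where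
  "G0 p r m = ex (\<lambda>U. (w p r)\<^sup>2 * (x p r U * x r m U * x p m U * (P p r U)\<^sup>2))"

lemma G0_sym: "G0 p r m = G0 r p m"
  by (simp add: G0_def w_sym P_sym x_sym mult_ac)

text \<open>324 = 3 * 216 * 3 / 6: the number of sides in \<open>kappa_le\<close>, the factor 6 *
  6^2 of a triangle times a squared star, and three choices of the marked side against six orders of
  a triple.\<close>

lemma kappa_le_G0: "kappa \<le> 324 * (\<Sum>i\<in>L. \<Sum>j\<in>L. \<Sum>k\<in>L. G0 i j k)"
proof -
  let ?f = "\<lambda>i j k. G0 i j k + G0 j k i + G0 i k j"
  have "kappa \<le> real 3 * (\<Sum>T\<in>tris. \<Sum>e\<in>sides T. ex (\<lambda>U. Z T U * (\<Sum>A | A \<in> tris \<and> e \<in> sides A. Z A U)\<^sup>2))"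
    by (rule kappa_le) (rule card_sides)
  moreover have "(\<Sum>T\<in>tris. \<Sum>e\<in>sides T. ex (\<lambda>U. Z T U * (\<Sum>A | A \<in> tris \<and> e \<in> sides A. Z A U)\<^sup>2))
      \<le> (\<Sum>(i, j, k)\<in>tris. 216 * ?f i j k)"
  proof (rule sum_mono)
    fix T assume T: "T \<in> tris"
    obtain i j k where ijk: "T = (i, j, k)" by (cases T)
    have *: "ex (\<lambda>U. Z T U * (\<Sum>A | A \<in> tris \<and> (p, r) \<in> sides A. Z A U)\<^sup>2) \<le> 216 * G0 p r m"
      if e: "(p, r) \<in> edges" and Z: "\<And>U. Z T U = 6 * (x p r U * x r m U * x p m U)" for p r m
    proof -
      have "Z T U * (\<Sum>A | A \<in> tris \<and> (p, r) \<in> sides A. Z A U)\<^sup>2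
          \<le> 216 * ((w p r)\<^sup>2 * (x p r U * x r m U * x p m U * (P p r U)\<^sup>2))" for U
      proof -
        have "(x p r U)\<^sup>2 \<le> (w p r)\<^sup>2" using x_bounds by (intro power_mono)
        then have "(x p r U)\<^sup>2 * (x p r U * x r m U * x p m U * (P p r U)\<^sup>2)
            \<le> (w p r)\<^sup>2 * (x p r U * x r m U * x p m U * (P p r U)\<^sup>2)"
          by (intro mult_right_mono mult_nonneg_nonneg x_bounds) auto
        then show ?thesis by (simp add: sum_Z_star[OF e] Z power_mult_distrib mult_ac)
      qed
      then have "ex (\<lambda>U. Z T U * (\<Sum>A | A \<in> tris \<and> (p, r) \<in> sides A. Z A U)\<^sup>2)
          \<le> ex (\<lambda>U. 216 * ((w p r)\<^sup>2 * (x p r U * x r m U * x p m U * (P p r U)\<^sup>2)))"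
        by (intro bex_mono q01)
      then show ?thesis by (simp only: bex_mult_left G0_def)
    qed
    have e: "(i, j) \<in> edges" "(j, k) \<in> edges" "(i, k) \<in> edges"
      using T by (auto simp: ijk tris_def edges_def)
    have zz: "Z T U = 6 * (x i j U * x j k U * x i k U)" for U using T by (simp add: ijk Z_tri)
    have "ex (\<lambda>U. Z T U * (\<Sum>A | A \<in> tris \<and> (i, j) \<in> sides A. Z A U)\<^sup>2) \<le> 216 * G0 i j k"
      "ex (\<lambda>U. Z T U * (\<Sum>A | A \<in> tris \<and> (j, k) \<in> sides A. Z A U)\<^sup>2) \<le> 216 * G0 j k i"
      "ex (\<lambda>U. Z T U * (\<Sum>A | A \<in> tris \<and> (i, k) \<in> sides A. Z A U)\<^sup>2) \<le> 216 * G0 i k j"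
      by (rule *[OF e(1)] *[OF e(2)] *[OF e(3)]; simp add: zz x_sym mult_ac)+
    then show "(\<Sum>e\<in>sides T. ex (\<lambda>U. Z T U * (\<Sum>A | A \<in> tris \<and> e \<in> sides A. Z A U)\<^sup>2))
        \<le> (case T of (i, j, k) \<Rightarrow> 216 * ?f i j k)"
      using T unfolding ijk by (subst sum_sides) auto
  qed
  moreover have "(\<Sum>(i, j, k)\<in>tris. 216 * ?f i j k) = 36 * (6 * (\<Sum>(i, j, k)\<in>tris. ?f i j k))"
    by (simp add: sum_distrib_left split_def)
  moreover have "6 * (\<Sum>(i, j, k)\<in>tris. ?f i j k) = 3 * (\<Sum>i\<in>L. \<Sum>j\<in>L. \<Sum>k\<in>L. G0 i j k)"
  proof -
    have "6 * (\<Sum>(i, j, k)\<in>tris. ?f i j k) = (\<Sum>i\<in>L. \<Sum>j\<in>L. \<Sum>k\<in>L. ?f i j k)"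
      by (rule sum_tris[symmetric]) (auto simp: G0_sym add_ac, simp_all add: G0_def w_diag)
    moreover have "(\<Sum>i\<in>L. \<Sum>j\<in>L. \<Sum>k\<in>L. G0 j k i) = (\<Sum>i\<in>L. \<Sum>j\<in>L. \<Sum>k\<in>L. G0 i j k)"
      by (subst sum.swap, rule sum.cong[OF refl], rule sum.swap)
    moreover have "(\<Sum>i\<in>L. \<Sum>j\<in>L. \<Sum>k\<in>L. G0 i k j) = (\<Sum>i\<in>L. \<Sum>j\<in>L. \<Sum>k\<in>L. G0 i j k)"
      by (rule sum.cong[OF refl], rule sum.swap)
    ultimately show ?thesis by (simp add: sum.distrib)
  qed
  ultimately show ?thesis by simp
qed

lemma ex_x3:
  assumes "p \<in> L" "r \<in> L" "m \<in> L" "p \<noteq> r" "p \<noteq> m" "r \<noteq> m"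
  shows "ex (\<lambda>U. x p r U * x r m U * x p m U) = w p r * w r m * w p m * (q p r * q r m * q p m)"
proof -
  let ?S = "{(min p r, max p r), (min r m, max r m), (min p m, max p m)}"
  have S: "?S \<subseteq> edges" using assms by (auto simp: edges_def min_def max_def)
  have "ex (\<lambda>U. x p r U * x r m U * x p m U) = ex (\<lambda>U. w p r * w r m * w p m * of_bool (?S \<subseteq> U))"
    by (intro bex_cong) (auto simp: x_def)
  also have "\<dots> = w p r * w r m * w p m * pr ?S"
    using ex_subset[OF S] by (simp add: bex_mult_left)
  also have "pr ?S = q p r * q r m * q p m"
    unfolding pr_def using assms q_sym by (subst prod.insert; (auto simp: min_def max_def)?)+
  finally show ?thesis .
qed

lemma ex_xx_sq:
  assumes "p \<in> L" "r \<in> L" "k \<in> L" "p \<noteq> r"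
  shows "ex (\<lambda>U. (x p k U * x r k U)\<^sup>2) = (w p k)\<^sup>2 * q p k * ((w r k)\<^sup>2 * q r k)"
proof (cases "k = p \<or> k = r")
  case True
  then show ?thesis by (auto simp: w_diag)
next
  case False
  let ?S = "{(min p k, max p k), (min r k, max r k)}"
  have S: "?S \<subseteq> edges" using assms False by (auto simp: edges_def min_def max_def)
  have "ex (\<lambda>U. (x p k U * x r k U)\<^sup>2) = ex (\<lambda>U. (w p k)\<^sup>2 * (w r k)\<^sup>2 * of_bool (?S \<subseteq> U))"
    by (intro bex_cong) (auto simp: x_def power_mult_distrib)
  also have "\<dots> = (w p k)\<^sup>2 * (w r k)\<^sup>2 * pr ?S"
    using ex_subset[OF S] by (simp add: bex_mult_left)
  also have "pr ?S = q p k * q r k"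
    unfolding pr_def using assms False q_sym by (subst prod.insert; (auto simp: min_def max_def)?)+
  finally show ?thesis by simp
qed

text \<open>The four edges are distinct unless k or l lies in {p, r}; in that case both sides vanish
  with the diagonal of \<open>w\<close>.\<close>

lemma ex_xxxx:
  assumes "p \<in> L" "r \<in> L" "k \<in> L" "l \<in> L" "p \<noteq> r" "k \<noteq> l"
  shows "ex (\<lambda>U. x p k U * x r k U * (x p l U * x r l U))
    = w p k * q p k * (w r k * q r k) * (w p l * q p l * (w r l * q r l))"
proof (cases "k = p \<or> k = r \<or> l = p \<or> l = r")
  case True
  then show ?thesis by (auto simp: w_diag)
next
  case False
  let ?S = "{(min p k, max p k), (min r k, max r k), (min p l, max p l), (min r l, max r l)}"
  have S: "?S \<subseteq> edges" using assms False by (auto simp: edges_def min_def max_def)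
  have "ex (\<lambda>U. x p k U * x r k U * (x p l U * x r l U))
      = ex (\<lambda>U. w p k * w r k * w p l * w r l * of_bool (?S \<subseteq> U))"
    by (intro bex_cong) (auto simp: x_def)
  also have "\<dots> = w p k * w r k * w p l * w r l * pr ?S"
    using ex_subset[OF S] by (simp add: bex_mult_left)
  also have "pr ?S = q p k * q r k * q p l * q r l"
    unfolding pr_def using assms False q_sym by (subst prod.insert; (auto simp: min_def max_def)?)+
  finally show ?thesis by simp
qed

text \<open>For different middle vertices the two paths of length two are independent and give the
  squared mean. Equal middle vertices give the second sum.\<close>

lemma ex_P_sq:
  assumes "p \<in> L" "r \<in> L" "p \<noteq> r"
  shows "ex (\<lambda>U. (P p r U)\<^sup>2) \<le> (\<Sum>k\<in>L. w p k * q p k * (w r k * q r k))\<^sup>2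
    + (\<Sum>k\<in>L. (w p k)\<^sup>2 * q p k * ((w r k)\<^sup>2 * q r k))"
proof -
  let ?c = "\<lambda>k. w p k * q p k * (w r k * q r k)"
  let ?d = "\<lambda>k. (w p k)\<^sup>2 * q p k * ((w r k)\<^sup>2 * q r k)"
  have c: "0 \<le> ?c k" for k using w_nonneg q_pos by (simp add: less_imp_le)
  have "ex (\<lambda>U. (P p r U)\<^sup>2) = (\<Sum>k\<in>L. \<Sum>l\<in>L. ex (\<lambda>U. x p k U * x r k U * (x p l U * x r l U)))"
    unfolding P_def power2_eq_square sum_product bex_sum ..
  also have "\<dots> \<le> (\<Sum>k\<in>L. \<Sum>l\<in>L. ?c k * ?c l + (if l = k then ?d k else 0))"
  proof (intro sum_mono)
    fix k l assume "k \<in> L" "l \<in> L"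
    then show "ex (\<lambda>U. x p k U * x r k U * (x p l U * x r l U)) \<le> ?c k * ?c l + (if l = k then ?d k else 0)"
      using assms c[of k] ex_xxxx[of p r k l] ex_xx_sq[of p r k]
      by (auto simp: power2_eq_square)
  qed
  also have "\<dots> = (\<Sum>k\<in>L. ?c k)\<^sup>2 + (\<Sum>k\<in>L. ?d k)"
    using fin_L by (simp add: sum.distrib power2_eq_square sum_product)
  finally show ?thesis .
qed

text \<open>The only path in \<open>P p r\<close> that uses an edge of the triangle is the one
  through m. Once it is split off with (a + b)^2 <= 2 a^2 + 2 b^2 and bounded by its weights, the
  remaining paths are independent of the triangle.\<close>

lemma G0_le:
  assumes L: "p \<in> L" "r \<in> L" "m \<in> L"
  shows "G0 p r m \<le> 2 * ((w p r) ^ 3 * q p r) * ((w r m) ^ 3 * q r m) * ((w p m) ^ 3 * q p m)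
    + 2 * ((w p r) ^ 3 * q p r) * (w r m * q r m) * (w p m * q p m) * ex (\<lambda>U. (P p r U)\<^sup>2)"
proof (cases "p = r \<or> p = m \<or> r = m")
  case True
  then have "G0 p r m = 0" by (auto simp: G0_def w_diag)
  moreover have "0 \<le> ex (\<lambda>U. (P p r U)\<^sup>2)" by (intro bex_nonneg q01) auto
  ultimately show ?thesis using w_nonneg q_pos[THEN less_imp_le]
    by (simp add: mult_nonneg_nonneg)
next
  case False
  define P' where "P' U = (\<Sum>k\<in>L - {m}. x p k U * x r k U)" for U
  have P': "0 \<le> P' U" "P' U \<le> P p r U" for U
    unfolding P'_def P_def using fin_L x_bounds
    by (auto intro!: sum_nonneg sum_mono2 mult_nonneg_nonneg)
  have split: "P p r U = x p m U * x r m U + P' U" for U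
    unfolding P_def P'_def using fin_L L(3) by (rule sum.remove)
  let ?xxx = "\<lambda>U. x p r U * x r m U * x p m U"
  have xxx: "0 \<le> ?xxx U" for U by (intro mult_nonneg_nonneg x_bounds)
  have "?xxx U * (P p r U)\<^sup>2 \<le> ?xxx U * (2 * (w p m * w r m)\<^sup>2) + ?xxx U * (2 * (P' U)\<^sup>2)" for U
  proof -
    have "(P p r U)\<^sup>2 \<le> 2 * (x p m U * x r m U)\<^sup>2 + 2 * (P' U)\<^sup>2"
      unfolding split using sum_squares_bound[of "x p m U * x r m U" "P' U"]
      by (simp add: power2_sum)
    also have "(x p m U * x r m U)\<^sup>2 \<le> (w p m * w r m)\<^sup>2"
      by (intro power_mono mult_mono x_bounds mult_nonneg_nonneg w_nonneg)
    finally have "(P p r U)\<^sup>2 \<le> 2 * (w p m * w r m)\<^sup>2 + 2 * (P' U)\<^sup>2" by simp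
    from mult_left_mono[OF this xxx[of U]] show ?thesis by (simp add: distrib_left)
  qed
  then have "ex (\<lambda>U. ?xxx U * (P p r U)\<^sup>2)
      \<le> ex (\<lambda>U. ?xxx U * (2 * (w p m * w r m)\<^sup>2) + ?xxx U * (2 * (P' U)\<^sup>2))"
    by (intro bex_mono q01)
  also have "\<dots> = ex ?xxx * (2 * (w p m * w r m)\<^sup>2) + ex (\<lambda>U. ?xxx U * (2 * (P' U)\<^sup>2))"
    by (simp only: bex_add bex_mult_right)
  also have "ex (\<lambda>U. ?xxx U * (2 * (P' U)\<^sup>2)) = ex ?xxx * ex (\<lambda>U. 2 * (P' U)\<^sup>2)"
  proof (rule bex_indep[where S = "{(min p r, max p r), (min r m, max r m), (min p m, max p m)}"])
    show "finite edges" by (rule fin_edges)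
    show "{(min p r, max p r), (min r m, max r m), (min p m, max p m)} \<subseteq> edges"
      using False L by (auto simp: edges_def min_def max_def)
    have edge_eq: "(min i j, max i j) = (min i' j', max i' j') \<longleftrightarrow> i = i' \<and> j = j' \<or> i = j' \<and> j = i'"
      for i j i' j' :: int by (auto simp: min_def max_def)
    \<comment> \<open>For k outside {p, r, m} neither (p, k) nor (r, k) is a side of the triangle;
      for k in {p, r} both products are zero.\<close>
    have far: "x p k U * x r k U = x p k (U - {(min p r, max p r), (min r m, max r m), (min p m, max p m)})
        * x r k (U - {(min p r, max p r), (min r m, max r m), (min p m, max p m)})"
      if "k \<noteq> m" for k U
    proof (cases "k = p \<or> k = r")
      case k: False
      have *: "x i k U = x i k (U - {(min p r, max p r), (min r m, max r m), (min p m, max p m)})"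
        if "i = p \<or> i = r" for i
        unfolding x_def Diff_iff insert_iff empty_iff edge_eq
        using that k \<open>k \<noteq> m\<close> by simp
      show ?thesis by (intro arg_cong2[where f = "(*)"] *) simp_all
    qed auto
    show "2 * (P' U)\<^sup>2 = 2 * (P' (U - {(min p r, max p r), (min r m, max r m), (min p m, max p m)}))\<^sup>2" for U
      unfolding P'_def by (intro arg_cong[where f = "\<lambda>z. 2 * z\<^sup>2"] sum.cong[OF refl] far) blast
    show "?xxx U = ?xxx (U \<inter> {(min p r, max p r), (min r m, max r m), (min p m, max p m)})" for U
      unfolding x_def Int_iff insert_iff by simp
  qed
  also have "ex (\<lambda>U. 2 * (P' U)\<^sup>2) = 2 * ex (\<lambda>U. (P' U)\<^sup>2)" by (rule bex_mult_left)
  finally have 1: "ex (\<lambda>U. ?xxx U * (P p r U)\<^sup>2) \<le> ex ?xxx * (2 * (w p m * w r m)\<^sup>2) + ex ?xxx * (2 * ex (\<lambda>U. (P' U)\<^sup>2))" .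
  have "ex (\<lambda>U. (P' U)\<^sup>2) \<le> ex (\<lambda>U. (P p r U)\<^sup>2)"
    using P' by (intro bex_mono q01 power_mono)
  then have "ex ?xxx * (2 * ex (\<lambda>U. (P' U)\<^sup>2)) \<le> ex ?xxx * (2 * ex (\<lambda>U. (P p r U)\<^sup>2))"
    by (intro mult_left_mono bex_nonneg q01 xxx) auto
  then have "ex (\<lambda>U. ?xxx U * (P p r U)\<^sup>2)
      \<le> ex ?xxx * (2 * (w p m * w r m)\<^sup>2) + ex ?xxx * (2 * ex (\<lambda>U. (P p r U)\<^sup>2))"
    using 1 by linarith
  then have "(w p r)\<^sup>2 * ex (\<lambda>U. ?xxx U * (P p r U)\<^sup>2)
      \<le> (w p r)\<^sup>2 * (ex ?xxx * (2 * (w p m * w r m)\<^sup>2) + ex ?xxx * (2 * ex (\<lambda>U. (P p r U)\<^sup>2)))"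
    by (rule mult_left_mono) simp
  moreover have "ex ?xxx = w p r * w r m * w p m * (q p r * q r m * q p m)"
    using L False by (intro ex_x3) auto
  moreover have "v\<^sup>2 * (v * a * b * (q1 * q2 * q3) * (2 * (b * a)\<^sup>2) + v * a * b * (q1 * q2 * q3) * (2 * e))
      = 2 * (v ^ 3 * q1) * (a ^ 3 * q2) * (b ^ 3 * q3) + 2 * (v ^ 3 * q1) * (a * q2) * (b * q3) * e"
    for v a b q1 q2 q3 e :: real
    by (simp add: algebra_simps power2_eq_square power3_eq_cube)
  ultimately show ?thesis
    unfolding G0_def bex_mult_left by (simp only:)
qed

text \<open>In a triangle one side is bounded by its maximum and the other two are summed over their
  free vertices, which gives the order \<beta>^3 N R^2; paths between two fixed vertices give
  \<beta>^2 R in the same way. The powers 1, 2, 3 of \<open>w\<close> come from means of paths,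
  second moments of paths, and sides counted three times. 648 is 324 times the 2 of
  \<open>G0_le\<close>.\<close>

lemma kappa_triangles_le:
  fixes h :: "int \<Rightarrow> int \<Rightarrow> real"
  assumes h_nonneg: "\<And>i j. 0 \<le> h i j" and h_le: "\<And>i j. h i j \<le> K"
    and h_sum: "\<And>i. i \<in> L \<Longrightarrow> (\<Sum>j\<in>L. h i j) \<le> K * R"
    and wq: "\<And>i j m. m \<in> {1, 2, 3} \<Longrightarrow> w i j ^ m * q i j \<le> \<beta> * h i j"
    and pos: "0 \<le> \<beta>" "0 \<le> K" "0 \<le> R"
  shows "kappa \<le> 648 * K ^ 3 * (\<beta> ^ 3 * card L * R\<^sup>2) * (1 + K\<^sup>2 * (\<beta>\<^sup>2 * R) + K ^ 4 * (\<beta>\<^sup>2 * R)\<^sup>2)"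
proof -
  let ?F = "1 + K\<^sup>2 * (\<beta>\<^sup>2 * R) + K ^ 4 * (\<beta>\<^sup>2 * R)\<^sup>2"
  have wq_nonneg: "0 \<le> w i j ^ m * q i j" for i j m
    using w_nonneg q_pos[THEN less_imp_le] by simp
  have wqK: "w i j ^ m * q i j \<le> \<beta> * K" if "m \<in> {1, 2, 3}" for i j m
    using wq[OF that] mult_left_mono[OF h_le pos(1)] by (rule order_trans)
  have two: "(\<Sum>k\<in>L. w p k ^ m * q p k * (w r k ^ m * q r k)) \<le> K\<^sup>2 * (\<beta>\<^sup>2 * R)"
    if "p \<in> L" "m \<in> {1, 2, 3}" for p r m
  proof -
    have "(\<Sum>k\<in>L. w p k ^ m * q p k * (w r k ^ m * q r k)) \<le> (\<Sum>k\<in>L. (\<beta> * h p k) * (\<beta> * K))"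
      using that(2) pos h_nonneg by (intro sum_mono mult_mono[OF wq wqK]) (auto intro: wq_nonneg)
    also have "\<dots> = \<beta>\<^sup>2 * K * (\<Sum>k\<in>L. h p k)"
      by (simp add: sum_distrib_left power2_eq_square mult_ac)
    also have "\<dots> \<le> \<beta>\<^sup>2 * K * (K * R)" using pos that by (intro mult_left_mono h_sum) auto
    finally show ?thesis by (simp add: power2_eq_square mult_ac)
  qed
  have P2: "ex (\<lambda>U. (P p r U)\<^sup>2) \<le> K ^ 4 * (\<beta>\<^sup>2 * R)\<^sup>2 + K\<^sup>2 * (\<beta>\<^sup>2 * R)"
    if "p \<in> L" "r \<in> L" "p \<noteq> r" for p r
  proof -
    have "0 \<le> (\<Sum>k\<in>L. w p k * q p k * (w r k * q r k))"
      using w_nonneg q_pos[THEN less_imp_le] by (intro sum_nonneg) simp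
    then have "(\<Sum>k\<in>L. w p k * q p k * (w r k * q r k))\<^sup>2 \<le> (K\<^sup>2 * (\<beta>\<^sup>2 * R))\<^sup>2"
      using two[of p 1 r] that by (intro power_mono) auto
    then show ?thesis
      using ex_P_sq[OF that] two[of p 2 r] that by (simp add: power_mult_distrib)
  qed
  have G: "G0 p r m \<le> 2 * \<beta> ^ 3 * (h p r * h r m * K) * ?F" if "p \<in> L" "r \<in> L" "m \<in> L" for p r m
  proof (cases "p = r")
    case True
    then show ?thesis using pos h_nonneg by (simp add: G0_def w_diag)
  next
    case False
    let ?b = "\<beta> * h p r * (\<beta> * h r m) * (\<beta> * K)"
    have m: "w i j ^ m * q i j * (w i' j' ^ m' * q i' j') * (w p' m'' ^ m' * q p' m'') \<le> \<beta> * h i j * (\<beta> * h i' j') * (\<beta> * K)"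
      if "m \<in> {1, 2, 3}" "m' \<in> {1, 2, 3}" for i j i' j' p' m'' and m m' :: nat
      using mult_mono[OF mult_mono[OF wq wq] wqK] that pos h_nonneg
      by (simp add: wq_nonneg)
    have "G0 p r m \<le> 2 * ?b + 2 * ?b * (K ^ 4 * (\<beta>\<^sup>2 * R)\<^sup>2 + K\<^sup>2 * (\<beta>\<^sup>2 * R))"
    proof (rule order_trans[OF G0_le[OF that]], rule add_mono)
      show "2 * (w p r ^ 3 * q p r) * (w r m ^ 3 * q r m) * (w p m ^ 3 * q p m) \<le> 2 * ?b"
        using m[of 3 3 p r r m p m] by simp
      show "2 * (w p r ^ 3 * q p r) * (w r m * q r m) * (w p m * q p m) * ex (\<lambda>U. (P p r U)\<^sup>2)
          \<le> 2 * ?b * (K ^ 4 * (\<beta>\<^sup>2 * R)\<^sup>2 + K\<^sup>2 * (\<beta>\<^sup>2 * R))"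
      proof (rule mult_mono)
        show "2 * (w p r ^ 3 * q p r) * (w r m * q r m) * (w p m * q p m) \<le> 2 * ?b"
          using m[of 3 1 p r r m p m] by simp
        show "ex (\<lambda>U. (P p r U)\<^sup>2) \<le> K ^ 4 * (\<beta>\<^sup>2 * R)\<^sup>2 + K\<^sup>2 * (\<beta>\<^sup>2 * R)"
          by (rule P2[OF that(1,2) False])
        show "0 \<le> ex (\<lambda>U. (P p r U)\<^sup>2)" by (intro bex_nonneg q01) auto
        show "0 \<le> 2 * ?b" using pos h_nonneg by simp
      qed
    qed
    also have "\<dots> = 2 * \<beta> ^ 3 * (h p r * h r m * K) * ?F"
      by (simp add: algebra_simps power3_eq_cube)
    finally show ?thesis .
  qed
  have hh: "(\<Sum>p\<in>L. \<Sum>r\<in>L. \<Sum>m\<in>L. h p r * h r m) \<le> card L * (K * R)\<^sup>2"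
  proof -
    have "(\<Sum>p\<in>L. \<Sum>r\<in>L. \<Sum>m\<in>L. h p r * h r m) = (\<Sum>p\<in>L. \<Sum>r\<in>L. h p r * (\<Sum>m\<in>L. h r m))"
      by (simp add: sum_distrib_left)
    also have "\<dots> \<le> (\<Sum>p\<in>L. \<Sum>r\<in>L. h p r * (K * R))"
      by (intro sum_mono mult_left_mono h_sum h_nonneg)
    also have "\<dots> = (\<Sum>p\<in>L. (\<Sum>r\<in>L. h p r) * (K * R))"
      by (simp add: sum_distrib_right)
    also have "\<dots> \<le> (\<Sum>p\<in>L. (K * R) * (K * R))"
      using pos by (intro sum_mono mult_right_mono h_sum) auto
    finally show ?thesis by (simp add: power2_eq_square)
  qed
  have F: "0 \<le> ?F" using pos by simp
  have "kappa \<le> 324 * (\<Sum>i\<in>L. \<Sum>j\<in>L. \<Sum>k\<in>L. G0 i j k)" by (rule kappa_le_G0)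
  also have "\<dots> \<le> 324 * (\<Sum>i\<in>L. \<Sum>j\<in>L. \<Sum>k\<in>L. 2 * \<beta> ^ 3 * (h i j * h j k * K) * ?F)"
    by (intro mult_left_mono sum_mono G) auto
  also have "\<dots> = 648 * K * \<beta> ^ 3 * ?F * (\<Sum>p\<in>L. \<Sum>r\<in>L. \<Sum>m\<in>L. h p r * h r m)"
    unfolding sum_distrib_left by (intro sum.cong refl) (simp add: mult_ac)
  also have "\<dots> \<le> 648 * K * \<beta> ^ 3 * ?F * (card L * (K * R)\<^sup>2)"
    using pos F hh by (intro mult_left_mono) auto
  also have "\<dots> = 648 * K ^ 3 * (\<beta> ^ 3 * card L * R\<^sup>2) * ?F"
    by (simp add: power2_eq_square power3_eq_cube mult_ac)
  finally show ?thesis .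
qed

end

section \<open>Riemann sums\<close>

lemma floor_scaled_tendsto:
  fixes R :: "nat \<Rightarrow> real"
  assumes "filterlim R at_top sequentially"
  shows "(\<lambda>k. real_of_int \<lfloor>R k * y\<rfloor> / R k) \<longlonglongrightarrow> y"
proof -
  have ev: "\<forall>\<^sub>F k in sequentially. 1 \<le> R k" using assms by (auto simp: filterlim_at_top)
  have inv: "(\<lambda>k. 1 / R k) \<longlonglongrightarrow> 0"
    using tendsto_inverse_0_at_top[OF assms] by (simp add: inverse_eq_divide)
  have "(\<lambda>k. real_of_int \<lfloor>R k * y\<rfloor> / R k - y) \<longlonglongrightarrow> 0"
  proof (rule Lim_null_comparison[OF _ inv])
    show "\<forall>\<^sub>F k in sequentially. norm (real_of_int \<lfloor>R k * y\<rfloor> / R k - y) \<le> 1 / R k"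
      using ev
    proof eventually_elim
      case (elim k)
      have "\<bar>real_of_int \<lfloor>R k * y\<rfloor> - R k * y\<bar> \<le> 1" by linarith
      moreover have "real_of_int \<lfloor>R k * y\<rfloor> / R k - y = (real_of_int \<lfloor>R k * y\<rfloor> - R k * y) / R k"
        using elim by (simp add: field_simps)
      ultimately show ?case using elim by (simp add: divide_right_mono)
    qed
  qed
  then show ?thesis by (simp add: LIM_zero_iff)
qed

text \<open>A lattice sum with mesh 1/R is the integral of a function that is constant on cells of
  length 1/R. In this form dominated convergence applies to it.\<close>

lemma step_function_integral:
  fixes \<phi> :: "int \<Rightarrow> real"
  assumes "finite A" "0 < R"
  shows "integrable lborel (\<lambda>y. of_bool (\<lfloor>R * y\<rfloor> \<in> A) * \<phi> \<lfloor>R * y\<rfloor>)"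
    and "(\<integral>y. of_bool (\<lfloor>R * y\<rfloor> \<in> A) * \<phi> \<lfloor>R * y\<rfloor> \<partial>lborel) = 1 / R * (\<Sum>m\<in>A. \<phi> m)"
proof -
  have eq: "(\<lambda>y. of_bool (\<lfloor>R * y\<rfloor> \<in> A) * \<phi> \<lfloor>R * y\<rfloor>)
      = (\<lambda>y. \<Sum>m\<in>A. \<phi> m * indicator {of_int m / R..<(of_int m + 1) / R} y)"
  proof
    fix y
    have ind: "indicator {of_int m / R..<(of_int m + 1) / R} y = (if m = \<lfloor>R * y\<rfloor> then 1 else 0 :: real)" for m
    proof -
      have "y \<in> {of_int m / R..<(of_int m + 1) / R} \<longleftrightarrow> of_int m \<le> R * y \<and> R * y < of_int m + 1"
        using assms by (auto simp: field_simps)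
      also have "\<dots> \<longleftrightarrow> m = \<lfloor>R * y\<rfloor>" by (metis floor_eq_iff)
      finally show ?thesis by (simp add: indicator_def)
    qed
    show "of_bool (\<lfloor>R * y\<rfloor> \<in> A) * \<phi> \<lfloor>R * y\<rfloor>
        = (\<Sum>m\<in>A. \<phi> m * indicator {of_int m / R..<(of_int m + 1) / R} y)"
      unfolding ind using assms by (simp add: if_distrib cong: if_cong)
  qed
  have le: "of_int m / R \<le> (of_int m + 1) / R" for m :: int
    using assms by (simp add: divide_right_mono)
  show "integrable lborel (\<lambda>y. of_bool (\<lfloor>R * y\<rfloor> \<in> A) * \<phi> \<lfloor>R * y\<rfloor>)"
    unfolding eq by (intro Bochner_Integration.integrable_sum integrable_mult_right integrable_real_indicator)
      (auto simp: le)
  have "(\<integral>y. of_bool (\<lfloor>R * y\<rfloor> \<in> A) * \<phi> \<lfloor>R * y\<rfloor> \<partial>lborel) = (\<Sum>m\<in>A. \<phi> m * (1 / R))"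
    unfolding eq using assms
    by (subst Bochner_Integration.integral_sum) (auto simp: le diff_divide_distrib[symmetric])
  then show "(\<integral>y. of_bool (\<lfloor>R * y\<rfloor> \<in> A) * \<phi> \<lfloor>R * y\<rfloor> \<partial>lborel) = 1 / R * (\<Sum>m\<in>A. \<phi> m)"
    by (simp add: sum_divide_distrib[symmetric])
qed

text \<open>Summand and index set may both change with k, since the range of labels and the weights
  do. Pointwise convergence almost everywhere tolerates the points where the zero diagonal or the
  end of the label range interferes.\<close>

lemma riemann_sum_tendsto:
  fixes R :: "nat \<Rightarrow> real" and \<phi> :: "nat \<Rightarrow> int \<Rightarrow> real"
  assumes R: "\<And>k. 0 < R k" and A: "\<And>k. finite (A k)"
    and G: "integrable lborel G"
    and bound: "\<And>k y. \<lfloor>R k * y\<rfloor> \<in> A k \<Longrightarrow> \<bar>\<phi> k \<lfloor>R k * y\<rfloor>\<bar> \<le> G y" and G_nonneg: "\<And>y. 0 \<le> G y"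
    and meas: "f \<in> borel_measurable borel"
    and lim: "AE y in lborel. (\<lambda>k. of_bool (\<lfloor>R k * y\<rfloor> \<in> A k) * \<phi> k \<lfloor>R k * y\<rfloor>) \<longlonglongrightarrow> f y"
  shows "(\<lambda>k. 1 / R k * (\<Sum>m\<in>A k. \<phi> k m)) \<longlonglongrightarrow> (\<integral>y. f y \<partial>lborel)"
proof -
  have "(\<lambda>k. \<integral>y. of_bool (\<lfloor>R k * y\<rfloor> \<in> A k) * \<phi> k \<lfloor>R k * y\<rfloor> \<partial>lborel) \<longlonglongrightarrow> (\<integral>y. f y \<partial>lborel)"
  proof (rule integral_dominated_convergence[OF _ _ G lim])
    show "f \<in> borel_measurable lborel" using meas by simp
    show "(\<lambda>y. of_bool (\<lfloor>R k * y\<rfloor> \<in> A k) * \<phi> k \<lfloor>R k * y\<rfloor>) \<in> borel_measurable lborel" for k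
      using step_function_integral(1)[OF A R] by (rule borel_measurable_integrable)
    show "AE y in lborel. norm (of_bool (\<lfloor>R k * y\<rfloor> \<in> A k) * \<phi> k \<lfloor>R k * y\<rfloor>) \<le> G y" for k
      using bound G_nonneg by (auto simp: of_bool_def)
  qed
  then show ?thesis by (simp add: step_function_integral(2)[OF A R])
qed

lemma integral_positive:
  fixes f :: "real \<Rightarrow> real"
  assumes "integrable lborel f" "\<And>x. 0 < f x"
  shows "0 < (\<integral>x. f x \<partial>lborel)"
proof -
  have "(\<integral>x. f x \<partial>lborel) \<noteq> 0"
  proof
    assume "(\<integral>x. f x \<partial>lborel) = 0"
    then have "AE x in lborel. f x = 0"
      using assms integral_nonneg_eq_0_iff_AE[of lborel f] by (simp add: less_imp_le)
    moreover have "f x \<noteq> 0" for x using assms(2)[of x] by simp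
    ultimately have "AE x in (lborel :: real measure). False" by simp
    then have "emeasure lborel (space lborel) = 0"
      by (subst (asm) AE_iff_measurable[of "UNIV"]) auto
    then show False by simp
  qed
  moreover have "0 \<le> (\<integral>x. f x \<partial>lborel)"
    using assms by (intro integral_nonneg_AE) (auto intro: less_imp_le)
  ultimately show ?thesis by simp
qed

section \<open>The profile of the matrix entries and its majorants\<close>

locale profile =
  fixes \<psi> :: "real \<Rightarrow> real" and \<alpha> :: nat
  assumes even: "\<psi> (- x) = \<psi> x" and cont: "continuous_on UNIV \<psi>" and pos: "0 < \<psi> x"
    and mono: "mono_on {0..} \<psi>"
    and moments: "integrable lborel (\<lambda>s. (1 + (\<psi> s)\<^sup>2) ^ m * exp (- (\<psi> s)\<^sup>2))"
    and \<alpha>: "\<alpha> \<in> {0, 1}"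
begin

text \<open>Up to the factor c / N, the s-th moment of a matrix entry at distance R x from the
  diagonal, for s at least 1; \<open>h 0\<close> is the profile of the edge probabilities.\<close>

definition h :: "nat \<Rightarrow> real \<Rightarrow> real" where
  "h s x = (1 + real \<alpha> * (\<psi> x)\<^sup>2) ^ s * exp (- (\<psi> x)\<^sup>2)"

text \<open>
  Unlike \<open>h s\<close> itself, \<open>H\<close> decreases in \<open>\<psi>\<^sup>2\<close> (the constant \<open>4\<close> exceeds the exponent \<open>3\<close>),
  so it dominates \<open>h s\<close> also at the lattice points next to a given point.
\<close>

definition H :: "real \<Rightarrow> real" where
  "H x = (4 + (\<psi> x)\<^sup>2) ^ 3 * exp (- (\<psi> x)\<^sup>2)"

text \<open>An integrable majorant of \<open>H\<close> on the whole interval of radius 1 about y. It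
  therefore dominates every step function built from \<open>H\<close> with mesh at most 1.\<close>

definition Hs :: "real \<Rightarrow> real" where
  "Hs y = 64 * indicator {-1..1} y + H (y - 1) + H (y + 1)"

lemma \<psi>_measurable [measurable]: "\<psi> \<in> borel_measurable borel"
  using cont by (rule borel_measurable_continuous_onI)

lemma h_measurable [measurable]: "h s \<in> borel_measurable borel"
  unfolding h_def by measurable

lemma H_measurable [measurable]: "H \<in> borel_measurable borel"
  unfolding H_def by measurable

lemma h_cont: "isCont (h s) x"
proof -
  have "isCont \<psi> x" using cont by (simp add: continuous_on_eq_continuous_at)
  then show ?thesis unfolding h_def by (intro continuous_intros)
qed

lemma h_pos: "0 < h s x"
  unfolding h_def by (simp add: add_pos_nonneg)

lemma H_even: "H (- x) = H x"
  by (simp add: H_def even)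

lemma H_pos: "0 < H x"
  unfolding H_def by (simp add: add_pos_nonneg)

lemma h_le_H: "s \<le> 3 \<Longrightarrow> h s x \<le> H x"
proof -
  assume s: "s \<le> 3"
  have "1 + real \<alpha> * (\<psi> x)\<^sup>2 \<le> 4 + (\<psi> x)\<^sup>2" using \<alpha> by auto
  then have "(1 + real \<alpha> * (\<psi> x)\<^sup>2) ^ s \<le> (4 + (\<psi> x)\<^sup>2) ^ s" by (intro power_mono) auto
  also have "\<dots> \<le> (4 + (\<psi> x)\<^sup>2) ^ 3" using s by (intro power_increasing) auto
  finally show ?thesis unfolding h_def H_def by (intro mult_right_mono) auto
qed

text \<open>For 0 <= s <= t one has 4 + t <= (4 + s) (1 + (t - s) / 4) <= (4 + s) exp ((t - s) / 4).
  The cube of the last factor is at most exp (t - s) because 3/4 < 1.\<close>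

lemma H_antimono:
  assumes "\<bar>x\<bar> \<le> \<bar>y\<bar>"
  shows "H y \<le> H x"
proof -
  have abs: "\<psi> \<bar>z\<bar> = \<psi> z" for z by (cases "0 \<le> z") (auto simp: even)
  have "\<psi> \<bar>x\<bar> \<le> \<psi> \<bar>y\<bar>" using mono assms by (auto simp: mono_on_def)
  then have le: "(\<psi> x)\<^sup>2 \<le> (\<psi> y)\<^sup>2" unfolding abs using pos[of x] by (intro power_mono) auto
  have *: "(4 + t) ^ 3 * exp (- t) \<le> (4 + s) ^ 3 * exp (- s)" if "0 \<le> s" "s \<le> t" for s t :: real
  proof -
    have "4 + t \<le> (4 + s) * (1 + (t - s) / 4)"
      using mult_nonneg_nonneg[of s "t - s"] that by (simp add: field_simps)
    also have "\<dots> \<le> (4 + s) * exp ((t - s) / 4)"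
      using that by (intro mult_left_mono exp_ge_add_one_self) auto
    finally have "(4 + t) ^ 3 \<le> ((4 + s) * exp ((t - s) / 4)) ^ 3"
      using that by (intro power_mono) auto
    also have "\<dots> = (4 + s) ^ 3 * exp (3 * ((t - s) / 4))"
      by (simp add: power_mult_distrib exp_of_nat_mult[symmetric])
    also have "\<dots> \<le> (4 + s) ^ 3 * exp (t - s)"
      using that by (intro mult_left_mono) auto
    finally have "(4 + t) ^ 3 * exp (- t) \<le> (4 + s) ^ 3 * exp (t - s) * exp (- t)"
      by (rule mult_right_mono) simp
    then show ?thesis by (simp add: mult.assoc exp_add[symmetric])
  qed
  show ?thesis unfolding H_def using le by (intro *) auto
qed

lemma H_le: "H x \<le> 64"
proof -
  have "(4 + t) ^ 3 * exp (- t) \<le> 64" if "0 \<le> t" for t :: real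
  proof -
    have "4 + t \<le> 4 * (1 + t / 4)" by simp
    also have "\<dots> \<le> 4 * exp (t / 4)" by (intro mult_left_mono exp_ge_add_one_self) auto
    finally have "(4 + t) ^ 3 \<le> (4 * exp (t / 4)) ^ 3" using that by (intro power_mono) auto
    also have "\<dots> = 64 * exp (3 * (t / 4))"
      by (simp add: power_mult_distrib exp_of_nat_mult[symmetric])
    also have "\<dots> \<le> 64 * exp t" using that by simp
    finally have "(4 + t) ^ 3 * exp (- t) \<le> 64 * exp t * exp (- t)" by (rule mult_right_mono) simp
    then show ?thesis by (simp add: mult.assoc exp_add[symmetric])
  qed
  then show ?thesis by (simp add: H_def)
qed

lemma H_integrable: "integrable lborel H"
proof (rule Bochner_Integration.integrable_bound)
  show "integrable lborel (\<lambda>s. 64 * ((1 + (\<psi> s)\<^sup>2) ^ 3 * exp (- (\<psi> s)\<^sup>2)))"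
    using moments[of 3] by simp
  have "(4 + t) ^ 3 \<le> 64 * (1 + t) ^ 3" if "0 \<le> t" for t :: real
    using power_mono[of "4 + t" "4 * (1 + t)" 3] that unfolding power_mult_distrib by simp
  then have "H x \<le> 64 * ((1 + (\<psi> x)\<^sup>2) ^ 3 * exp (- (\<psi> x)\<^sup>2))" for x
    unfolding H_def mult.assoc[symmetric]
    by (intro mult_right_mono) auto
  then show "AE x in lborel. norm (H x) \<le> norm (64 * ((1 + (\<psi> x)\<^sup>2) ^ 3 * exp (- (\<psi> x)\<^sup>2)))"
    using H_pos by (auto simp: abs_of_pos intro: order_trans)
qed simp

lemma Hs_integrable: "integrable lborel Hs"
proof -
  have "integrable lborel (\<lambda>y. H (- 1 + 1 * y))" "integrable lborel (\<lambda>y. H (1 + 1 * y))"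
    by (rule lborel_integrable_real_affine[OF H_integrable]; simp)+
  then show ?thesis unfolding Hs_def by (intro Bochner_Integration.integrable_add) (auto simp: add.commute)
qed

lemma Hs_nonneg: "0 \<le> Hs y"
  unfolding Hs_def using H_pos[of "y - 1"] H_pos[of "y + 1"] by auto

text \<open>Near the origin the bound 64 suffices. Elsewhere the point of the interval about y that
  is closest to the origin is \<open>y - 1\<close> or \<open>y + 1\<close>, and \<open>H\<close>
  decreases away from 0.\<close>

lemma H_le_Hs: "\<bar>x - y\<bar> \<le> 1 \<Longrightarrow> H x \<le> Hs y"
proof -
  assume xy: "\<bar>x - y\<bar> \<le> 1"
  consider "\<bar>y\<bar> \<le> 1" | "1 < y" | "y < - 1" by linarith
  then show ?thesis
  proof cases
    case 1
    then show ?thesis using H_le[of x] H_pos[of "y - 1"] H_pos[of "y + 1"] by (auto simp: Hs_def indicator_def)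
  next
    case 2
    then have "H x \<le> H (y - 1)" using xy by (intro H_antimono) auto
    then show ?thesis using H_pos[of "y + 1"] by (auto simp: Hs_def indicator_def)
  next
    case 3
    then have "H x \<le> H (y + 1)" using xy by (intro H_antimono) auto
    then show ?thesis using H_pos[of "y - 1"] by (auto simp: Hs_def indicator_def)
  qed
qed

lemma H_floor_le: "1 \<le> R \<Longrightarrow> H (\<lfloor>R * y\<rfloor> / R) \<le> Hs y"
proof (rule H_le_Hs)
  assume R: "1 \<le> R"
  have "\<bar>real_of_int \<lfloor>R * y\<rfloor> - R * y\<bar> \<le> 1" by linarith
  moreover have "real_of_int \<lfloor>R * y\<rfloor> / R - y = (real_of_int \<lfloor>R * y\<rfloor> - R * y) / R"
    using R by (simp add: field_simps)
  ultimately show "\<bar>real_of_int \<lfloor>R * y\<rfloor> / R - y\<bar> \<le> 1"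
    using R by (simp add: field_simps)
qed

definition HI :: real where "HI = (\<integral>y. Hs y \<partial>lborel)"

lemma HI_nonneg: "0 \<le> HI"
  unfolding HI_def using Hs_nonneg by (intro integral_nonneg_AE) auto

text \<open>The shift by i only changes the set of lattice points, and the integral of the majorant
  does not depend on that set; hence the bound is uniform in i and \<open>A\<close>.\<close>

lemma sum_H_le:
  fixes i :: int
  assumes "1 \<le> R" "finite A"
  shows "1 / R * (\<Sum>j\<in>A. H ((j - i) / R)) \<le> HI"
proof -
  let ?A = "(\<lambda>j. j - i) ` A"
  have "(\<Sum>j\<in>A. H ((j - i) / R)) = (\<Sum>m\<in>?A. H (m / R))"
    by (subst sum.reindex) (auto simp: inj_on_def)
  then have "1 / R * (\<Sum>j\<in>A. H ((j - i) / R)) = (\<integral>y. of_bool (\<lfloor>R * y\<rfloor> \<in> ?A) * H (\<lfloor>R * y\<rfloor> / R) \<partial>lborel)"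
    using assms by (subst step_function_integral(2)) auto
  also have "\<dots> \<le> HI"
    unfolding HI_def using assms Hs_integrable H_floor_le[OF assms(1)] Hs_nonneg
    by (intro integral_mono step_function_integral(1)) (auto simp: of_bool_def)
  finally show ?thesis .
qed

text \<open>The value at 0 reproduces the zero diagonal of the matrix. In scaled coordinates this
  changes the limit only at a single point.\<close>

definition g0 :: "nat \<Rightarrow> real \<Rightarrow> int \<Rightarrow> real" where
  "g0 s R m = (if m = 0 then 0 else h s (m / R))"

lemma g0_nonneg: "0 \<le> g0 s R m"
  using h_pos[of s "m / R"] by (simp add: g0_def)

lemma g0_le: "s \<le> 3 \<Longrightarrow> g0 s R m \<le> H (m / R)"
  using h_le_H[of s "m / R"] H_pos[of 0] by (auto simp: g0_def)

lemma g0_tendsto: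
  assumes "(\<lambda>k. m k / R k) \<longlonglongrightarrow> z" "z \<noteq> 0"
  shows "(\<lambda>k. g0 s (R k) (m k)) \<longlonglongrightarrow> h s z"
proof -
  have "\<forall>\<^sub>F k in sequentially. real_of_int (m k) / R k \<noteq> 0"
    using assms by (rule tendsto_imp_eventually_ne)
  then have "\<forall>\<^sub>F k in sequentially. h s (m k / R k) = g0 s (R k) (m k)"
    by eventually_elim (auto simp: g0_def)
  moreover have "(\<lambda>k. h s (m k / R k)) \<longlonglongrightarrow> h s z"
    using h_cont assms(1) by (rule isCont_tendsto_compose)
  ultimately show ?thesis by (rule Lim_transform_eventually[rotated])
qed

text \<open>Since \<open>h s\<close> is even, this is its convolution with itself.\<close>

definition conv :: "nat \<Rightarrow> real \<Rightarrow> real" where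
  "conv s x = (\<integral>y. h s y * h s (y - x) \<partial>lborel)"

lemma conv_measurable [measurable]: "conv s \<in> borel_measurable borel"
  unfolding conv_def[abs_def] by measurable

lemma h_h_le: "s \<le> 3 \<Longrightarrow> h s y * h s (y - x) \<le> 64 * H y"
  using mult_mono[OF h_le_H order_trans[OF h_le_H H_le], of s s y "y - x"] h_pos[of s] H_pos[of y]
  by (simp add: less_imp_le mult.commute)

lemma conv_integrable: "s \<le> 3 \<Longrightarrow> integrable lborel (\<lambda>y. h s y * h s (y - x))"
proof (rule Bochner_Integration.integrable_bound)
  assume s: "s \<le> 3"
  show "integrable lborel (\<lambda>y. 64 * H y)" using H_integrable by simp
  show "AE y in lborel. norm (h s y * h s (y - x)) \<le> norm (64 * H y)"
    using h_h_le[OF s] h_pos H_pos by (auto simp: abs_of_pos abs_mult)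
qed simp

lemma conv_pos: "s \<le> 3 \<Longrightarrow> 0 < conv s x"
  unfolding conv_def using h_pos by (intro integral_positive conv_integrable) auto

section \<open>Lattice sums over the labels and their limits\<close>

lemma sum_labels_shift:
  fixes u :: int
  shows "(\<Sum>v\<in>labels n. \<phi> (v - u)) = (\<Sum>m\<in>(\<lambda>v. v - u) ` labels n. \<phi> m)"
  by (subst sum.reindex) (auto simp: inj_on_def)

lemma mem_shifted_labels: "m \<in> (\<lambda>v. v - u) ` labels n \<longleftrightarrow> m + u \<in> labels n"
  by (auto simp: image_iff labels_def intro!: bexI[of _ "m + u"])

text \<open>\<open>room\<close> is the distance from u to the ends of the label range in units of R.
  A displacement m of order R changes it by a bounded amount only.\<close>

lemma eventually_mem_labels:
  fixes u :: "nat \<Rightarrow> int" and n :: "nat \<Rightarrow> nat"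
  assumes R: "filterlim R at_top sequentially"
    and room: "filterlim (\<lambda>k. (real (n k) - \<bar>u k\<bar>) / R k) at_top sequentially"
    and m: "(\<lambda>k. real_of_int (m k) / R k) \<longlonglongrightarrow> y"
  shows "\<forall>\<^sub>F k in sequentially. m k + u k \<in> labels (n k)"
    and "filterlim (\<lambda>k. (real (n k) - \<bar>m k + u k\<bar>) / R k) at_top sequentially"
proof -
  have Rpos: "\<forall>\<^sub>F k in sequentially. 0 < R k" using R by (auto simp: filterlim_at_top_dense)
  have bd: "\<forall>\<^sub>F k in sequentially. \<bar>real_of_int (m k) / R k\<bar> < \<bar>y\<bar> + 1"
    using tendsto_rabs[OF m] by (rule order_tendstoD) simp
  have le: "(real (n k) - \<bar>u k\<bar>) / R k - \<bar>real_of_int (m k) / R k\<bar> \<le> (real (n k) - \<bar>m k + u k\<bar>) / R k" if "0 < R k" for k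
  proof -
    have "\<bar>real_of_int (m k) / R k\<bar> = \<bar>real_of_int (m k)\<bar> / R k" using that by simp
    then show ?thesis using that by (simp add: diff_divide_distrib[symmetric] divide_right_mono)
  qed
  show *: "filterlim (\<lambda>k. (real (n k) - \<bar>m k + u k\<bar>) / R k) at_top sequentially"
    unfolding filterlim_at_top
  proof
    fix Z
    have "\<forall>\<^sub>F k in sequentially. Z + (\<bar>y\<bar> + 1) \<le> (real (n k) - \<bar>u k\<bar>) / R k"
      using room by (auto simp: filterlim_at_top)
    then show "\<forall>\<^sub>F k in sequentially. Z \<le> (real (n k) - \<bar>m k + u k\<bar>) / R k"
      using bd Rpos by eventually_elim (use le in force)
  qed
  have "\<forall>\<^sub>F k in sequentially. 0 \<le> (real (n k) - \<bar>m k + u k\<bar>) / R k"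
    using * by (auto simp: filterlim_at_top)
  then show "\<forall>\<^sub>F k in sequentially. m k + u k \<in> labels (n k)"
    using Rpos by eventually_elim (auto simp: zero_le_divide_iff labels_def)
qed

definition Q :: "nat \<Rightarrow> nat \<Rightarrow> real \<Rightarrow> int \<Rightarrow> int \<Rightarrow> real" where
  "Q s n R u v = 1 / R * (\<Sum>m\<in>labels n. g0 s R (m - u) * g0 s R (m - v))"

lemma Q_nonneg: "0 \<le> R \<Longrightarrow> 0 \<le> Q s n R u v"
  unfolding Q_def by (intro mult_nonneg_nonneg sum_nonneg g0_nonneg) auto

lemma Q_le: "s \<le> 3 \<Longrightarrow> 1 \<le> R \<Longrightarrow> Q s n R u v \<le> 64 * HI"
proof -
  assume s: "s \<le> 3" and R: "1 \<le> R"
  have "(\<Sum>m\<in>labels n. g0 s R (m - u) * g0 s R (m - v)) \<le> (\<Sum>m\<in>labels n. H ((m - u) / R) * 64)"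
    using H_le H_pos[THEN less_imp_le]
    by (intro sum_mono mult_mono order_trans[OF g0_le[OF s]] g0_nonneg) auto
  then have "Q s n R u v \<le> 1 / R * (\<Sum>m\<in>labels n. H ((m - u) / R) * 64)"
    unfolding Q_def using R by (intro mult_left_mono) auto
  also have "\<dots> = 64 * (1 / R * (\<Sum>m\<in>labels n. H ((m - u) / R)))"
    by (simp add: sum_distrib_right[symmetric])
  also have "\<dots> \<le> 64 * HI"
    using sum_H_le[OF R, of "labels n" u] by (simp add: labels_def)
  finally show ?thesis .
qed

lemma Q_tendsto:
  fixes u v :: "nat \<Rightarrow> int" and n :: "nat \<Rightarrow> nat"
  assumes s: "s \<le> 3" and R1: "\<And>k. 1 \<le> R k" and R: "filterlim R at_top sequentially"
    and room: "filterlim (\<lambda>k. (real (n k) - \<bar>u k\<bar>) / R k) at_top sequentially"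
    and uv: "(\<lambda>k. real_of_int (v k - u k) / R k) \<longlonglongrightarrow> x"
  shows "(\<lambda>k. Q s (n k) (R k) (u k) (v k)) \<longlonglongrightarrow> conv s x"
proof -
  let ?A = "\<lambda>k. (\<lambda>v. v - u k) ` labels (n k)"
  let ?\<phi> = "\<lambda>k m. g0 s (R k) m * g0 s (R k) (m - (v k - u k))"
  have Q: "Q s (n k) (R k) (u k) (v k) = 1 / R k * (\<Sum>m\<in>?A k. ?\<phi> k m)" for k
    unfolding Q_def sum_labels_shift[symmetric] by simp
  show ?thesis unfolding Q conv_def
  proof (rule riemann_sum_tendsto[where G = "\<lambda>y. 64 * Hs y"])
    show "0 < R k" for k using R1[of k] by simp
    show "finite (?A k)" for k by (simp add: labels_def)
    show "integrable lborel (\<lambda>y. 64 * Hs y)" using Hs_integrable by simp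
    show "0 \<le> 64 * Hs y" for y using Hs_nonneg by simp
    show "\<bar>?\<phi> k \<lfloor>R k * y\<rfloor>\<bar> \<le> 64 * Hs y" for k y
    proof -
      have "?\<phi> k \<lfloor>R k * y\<rfloor> \<le> Hs y * 64"
        using H_floor_le[OF R1] H_le Hs_nonneg
        by (intro mult_mono order_trans[OF g0_le[OF s]] g0_nonneg) auto
      then show ?thesis using g0_nonneg by (simp add: abs_mult)
    qed
    show "(\<lambda>y. h s y * h s (y - x)) \<in> borel_measurable borel" by measurable
    \<comment> \<open>At y = 0 and y = x the lattice point may hit the zero of \<open>g0\<close>, so
      these two points are left out.\<close>
    have "(\<lambda>k. of_bool (\<lfloor>R k * y\<rfloor> \<in> ?A k) * ?\<phi> k \<lfloor>R k * y\<rfloor>) \<longlonglongrightarrow> h s y * h s (y - x)"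
      if "y \<noteq> 0" "y \<noteq> x" for y
    proof -
      note fl = floor_scaled_tendsto[OF R, of y]
      have "\<forall>\<^sub>F k in sequentially. \<lfloor>R k * y\<rfloor> \<in> ?A k"
        unfolding mem_shifted_labels by (rule eventually_mem_labels(1)[OF R room fl])
      then have ev: "\<forall>\<^sub>F k in sequentially. ?\<phi> k \<lfloor>R k * y\<rfloor> = of_bool (\<lfloor>R k * y\<rfloor> \<in> ?A k) * ?\<phi> k \<lfloor>R k * y\<rfloor>"
        by eventually_elim simp
      have "(\<lambda>k. real_of_int (\<lfloor>R k * y\<rfloor> - (v k - u k)) / R k) \<longlonglongrightarrow> y - x"
        using tendsto_diff[OF fl uv] by (simp add: diff_divide_distrib)
      then have "(\<lambda>k. ?\<phi> k \<lfloor>R k * y\<rfloor>) \<longlonglongrightarrow> h s y * h s (y - x)"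
        using that by (intro tendsto_mult g0_tendsto[OF fl] g0_tendsto) auto
      then show ?thesis using ev by (rule Lim_transform_eventually)
    qed
    moreover have "AE y in lborel. y \<noteq> 0 \<and> y \<noteq> x"
      using AE_lborel_singleton[of 0] AE_lborel_singleton[of x] by eventually_elim auto
    ultimately show "AE y in lborel. (\<lambda>k. of_bool (\<lfloor>R k * y\<rfloor> \<in> ?A k) * ?\<phi> k \<lfloor>R k * y\<rfloor>) \<longlonglongrightarrow> h s y * h s (y - x)"
      by (auto elim: eventually_mono)
  qed
qed

text \<open>One row of either sum in the variance. For s = 2, p = 1 all three sides of one triangle
  carry squared weights. For s = 1, p = 2 only the common edge does, and the two factors
  \<open>Q\<close> are the remaining paths of two triangles through it; \<open>\<theta>\<close> then
  holds the factor 1 - q of that edge.\<close>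

definition S :: "nat \<Rightarrow> nat \<Rightarrow> (int \<Rightarrow> real) \<Rightarrow> nat \<Rightarrow> real \<Rightarrow> int \<Rightarrow> real" where
  "S s p \<theta> n R u = 1 / R * (\<Sum>v\<in>labels n. g0 2 R (v - u) * \<theta> (v - u) * Q s n R u v ^ p)"

text \<open>As \<open>h 2\<close> is even, \<open>J 2 1\<close> is its threefold convolution at 0,
  that is, the integral of the cubed Fourier transform divided by 2 pi; the variance of the third
  regime is 6 times this number.\<close>

definition J :: "nat \<Rightarrow> nat \<Rightarrow> real" where
  "J s p = (\<integral>x. h 2 x * conv s x ^ p \<partial>lborel)"

lemma S_summand_le:
  assumes "s \<le> 3" "1 \<le> R" "\<And>m. 0 \<le> \<theta> m \<and> \<theta> m \<le> 1"
  shows "\<bar>g0 2 R m * \<theta> m * Q s n R u v ^ p\<bar> \<le> H (m / R) * (64 * HI) ^ p"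
proof -
  have "g0 2 R m * \<theta> m * Q s n R u v ^ p \<le> H (m / R) * 1 * (64 * HI) ^ p"
    using assms g0_nonneg H_pos[THEN less_imp_le] Q_nonneg Q_le
    by (intro mult_mono g0_le power_mono) auto
  moreover have "0 \<le> g0 2 R m * \<theta> m * Q s n R u v ^ p"
    using assms g0_nonneg Q_nonneg[of R s n u v] by (intro mult_nonneg_nonneg) auto
  ultimately show ?thesis by simp
qed

lemma S_le:
  assumes "s \<le> 3" "1 \<le> R" "\<And>m. 0 \<le> \<theta> m \<and> \<theta> m \<le> 1"
  shows "\<bar>S s p \<theta> n R u\<bar> \<le> HI * (64 * HI) ^ p"
proof -
  have "\<bar>S s p \<theta> n R u\<bar> \<le> 1 / R * (\<Sum>v\<in>labels n. \<bar>g0 2 R (v - u) * \<theta> (v - u) * Q s n R u v ^ p\<bar>)"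
    unfolding S_def abs_mult[of "1 / R"] using assms(2) by (intro mult_mono sum_abs) auto
  also have "\<dots> \<le> 1 / R * (\<Sum>v\<in>labels n. H ((v - u) / R) * (64 * HI) ^ p)"
    using assms S_summand_le[OF assms, of "_ - u"] by (intro mult_left_mono sum_mono) auto
  also have "\<dots> = (1 / R * (\<Sum>v\<in>labels n. H ((v - u) / R))) * (64 * HI) ^ p"
    by (simp add: sum_distrib_right[symmetric])
  also have "\<dots> \<le> HI * (64 * HI) ^ p"
    using sum_H_le[OF assms(2), of "labels n" u] HI_nonneg
    by (intro mult_right_mono) (auto simp: labels_def)
  finally show ?thesis .
qed

text \<open>This concerns rows in the bulk: u is many multiples of R away from both ends, so the
  truncation of the label range disappears in the limit for v and for the third vertex
  alike.\<close>

lemma S_tendsto: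
  fixes u :: "nat \<Rightarrow> int" and n :: "nat \<Rightarrow> nat"
  assumes s: "s \<le> 3" and R1: "\<And>k. 1 \<le> R k" and R: "filterlim R at_top sequentially"
    and room: "filterlim (\<lambda>k. (real (n k) - \<bar>u k\<bar>) / R k) at_top sequentially"
    and \<theta>: "\<And>k m. 0 \<le> \<theta> k m \<and> \<theta> k m \<le> 1" and \<theta>_lim: "\<And>m. (\<lambda>k. \<theta> k (m k)) \<longlonglongrightarrow> 1"
  shows "(\<lambda>k. S s p (\<theta> k) (n k) (R k) (u k)) \<longlonglongrightarrow> J s p"
proof -
  let ?A = "\<lambda>k. (\<lambda>v. v - u k) ` labels (n k)"
  let ?\<phi> = "\<lambda>k m. g0 2 (R k) m * \<theta> k m * Q s (n k) (R k) (u k) (m + u k) ^ p"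
  have S: "S s p (\<theta> k) (n k) (R k) (u k) = 1 / R k * (\<Sum>m\<in>?A k. ?\<phi> k m)" for k
    unfolding S_def sum_labels_shift[symmetric] by simp
  show ?thesis unfolding S J_def
  proof (rule riemann_sum_tendsto[where G = "\<lambda>y. Hs y * (64 * HI) ^ p"])
    show "0 < R k" for k using R1[of k] by simp
    show "finite (?A k)" for k by (simp add: labels_def)
    show "integrable lborel (\<lambda>y. Hs y * (64 * HI) ^ p)" using Hs_integrable by simp
    show "0 \<le> Hs y * (64 * HI) ^ p" for y using Hs_nonneg HI_nonneg by simp
    show "\<bar>?\<phi> k \<lfloor>R k * y\<rfloor>\<bar> \<le> Hs y * (64 * HI) ^ p" for k y
      using H_floor_le[OF R1] HI_nonneg
      by (intro order_trans[OF S_summand_le[OF s R1 \<theta>]] mult_right_mono) auto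
    show "(\<lambda>x. h 2 x * conv s x ^ p) \<in> borel_measurable borel" by measurable
    have "(\<lambda>k. of_bool (\<lfloor>R k * y\<rfloor> \<in> ?A k) * ?\<phi> k \<lfloor>R k * y\<rfloor>) \<longlonglongrightarrow> h 2 y * conv s y ^ p"
      if "y \<noteq> 0" for y
    proof -
      note fl = floor_scaled_tendsto[OF R, of y]
      have "\<forall>\<^sub>F k in sequentially. \<lfloor>R k * y\<rfloor> \<in> ?A k"
        unfolding mem_shifted_labels by (rule eventually_mem_labels(1)[OF R room fl])
      then have ev: "\<forall>\<^sub>F k in sequentially. ?\<phi> k \<lfloor>R k * y\<rfloor> = of_bool (\<lfloor>R k * y\<rfloor> \<in> ?A k) * ?\<phi> k \<lfloor>R k * y\<rfloor>"
        by eventually_elim simp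
      have "(\<lambda>k. ?\<phi> k \<lfloor>R k * y\<rfloor>) \<longlonglongrightarrow> h 2 y * 1 * conv s y ^ p"
        using that fl
        by (intro tendsto_mult g0_tendsto[OF fl] \<theta>_lim tendsto_power Q_tendsto[OF s R1 R room]) auto
      then show ?thesis using ev by (auto intro: Lim_transform_eventually)
    qed
    then show "AE y in lborel. (\<lambda>k. of_bool (\<lfloor>R k * y\<rfloor> \<in> ?A k) * ?\<phi> k \<lfloor>R k * y\<rfloor>) \<longlonglongrightarrow> h 2 y * conv s y ^ p"
      using AE_lborel_singleton[of 0] by (auto elim: eventually_mono)
  qed
qed

text \<open>Positivity matters because \<open>centered_normal v\<close> is a probability measure
  only for positive v.\<close>

lemma J_pos: "s \<le> 3 \<Longrightarrow> 0 < J s p"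
  unfolding J_def
proof (rule integral_positive)
  assume s: "s \<le> 3"
  show "0 < h 2 x * conv s x ^ p" for x using h_pos conv_pos[OF s] by simp
  define K where "K = (\<integral>y. 64 * H y \<partial>lborel)"
  have conv_le: "conv s x \<le> K" for x
    unfolding conv_def K_def
  proof (rule integral_mono[OF conv_integrable[OF s]])
    show "integrable lborel (\<lambda>y. 64 * H y)" using H_integrable by simp
    show "h s y * h s (y - x) \<le> 64 * H y" for y by (rule h_h_le[OF s])
  qed
  show "integrable lborel (\<lambda>x. h 2 x * conv s x ^ p)"
  proof (rule Bochner_Integration.integrable_bound)
    show "integrable lborel (\<lambda>x. H x * K ^ p)" using H_integrable by simp
    have "h 2 x * conv s x ^ p \<le> H x * K ^ p" for x
      using h_le_H[of 2 x] h_pos[of 2 x] conv_le[of x] conv_pos[OF s, of x]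
      by (intro mult_mono power_mono) auto
    then show "AE x in lborel. norm (h 2 x * conv s x ^ p) \<le> norm (H x * K ^ p)"
      using h_pos conv_pos[OF s] H_pos order.strict_trans2[OF conv_pos[OF s] conv_le]
      by (auto simp: abs_mult abs_of_pos)
  qed measurable
qed

text \<open>The average over rows is again a Riemann sum, now with mesh 1/N and z = u/N. Rows with
  |z| < 1/2 lie in the bulk because N/R tends to infinity, those with |z| > 1/2 eventually leave the
  label range, and the two boundary points form a null set.\<close>

lemma mean_S_tendsto:
  fixes n :: "nat \<Rightarrow> nat"
  assumes s: "s \<le> 3" and R1: "\<And>k. 1 \<le> R k" and R: "filterlim R at_top sequentially"
    and n: "filterlim n at_top sequentially" and Rn: "(\<lambda>k. R k / dimN (n k)) \<longlonglongrightarrow> 0"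
    and \<theta>: "\<And>k m. 0 \<le> \<theta> k m \<and> \<theta> k m \<le> 1" and \<theta>_lim: "\<And>m. (\<lambda>k. \<theta> k (m k)) \<longlonglongrightarrow> 1"
  shows "(\<lambda>k. 1 / dimN (n k) * (\<Sum>u\<in>labels (n k). S s p (\<theta> k) (n k) (R k) u)) \<longlonglongrightarrow> J s p"
proof -
  let ?N = "\<lambda>k. dimN (n k)"
  let ?C = "HI * (64 * HI) ^ p"
  have nr: "filterlim (\<lambda>k. real (n k)) at_top sequentially"
    using n filterlim_compose filterlim_real_sequentially by blast
  have N: "filterlim ?N at_top sequentially"
    by (rule filterlim_at_top_mono[OF nr]) simp
  have nN: "(\<lambda>k. real (n k) / ?N k) \<longlonglongrightarrow> 1 / 2"
  proof -
    have "(\<lambda>k. 1 / ?N k) \<longlonglongrightarrow> 0"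
      using tendsto_inverse_0_at_top[OF N] by (simp add: inverse_eq_divide)
    then have "(\<lambda>k. (1 - 1 / ?N k) / 2) \<longlonglongrightarrow> (1 - 0) / 2" by (intro tendsto_intros) auto
    moreover have "(1 - 1 / ?N k) / 2 = real (n k) / ?N k" for k by (simp add: field_simps)
    ultimately show ?thesis by simp
  qed
  have Rpos: "0 < R k" for k using R1[of k] by simp
  have NR: "filterlim (\<lambda>k. ?N k / R k) at_top sequentially"
  proof -
    have "filterlim (\<lambda>k. inverse (R k / ?N k)) at_top sequentially"
      using Rn by (rule filterlim_inverse_at_top)
        (use Rpos in \<open>auto intro!: always_eventually divide_pos_pos\<close>)
    then show ?thesis by (simp add: inverse_eq_divide)
  qed
  have "(\<lambda>k. 1 / ?N k * (\<Sum>u\<in>labels (n k). S s p (\<theta> k) (n k) (R k) u))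
      \<longlonglongrightarrow> (\<integral>z. indicator {- 1 / 2<..<1 / 2 :: real} z * J s p \<partial>lborel)"
  proof (rule riemann_sum_tendsto[where G = "\<lambda>z. indicator {- 1..1} z * ?C" and R = ?N
        and A = "\<lambda>k. labels (n k)" and \<phi> = "\<lambda>k u. S s p (\<theta> k) (n k) (R k) u"])
    show "0 < ?N k" for k by simp
    show "finite (labels (n k))" for k by (simp add: labels_def)
    show "integrable lborel (\<lambda>z::real. indicator {- 1..1} z * ?C)" by simp
    show "0 \<le> indicator {- 1..1} z * ?C" for z :: real using HI_nonneg by simp
    show "(\<lambda>z. indicator {- 1 / 2<..<1 / 2 :: real} z * J s p) \<in> borel_measurable borel" by measurable
    show "\<bar>S s p (\<theta> k) (n k) (R k) \<lfloor>?N k * z\<rfloor>\<bar> \<le> indicator {- 1..1} z * ?C" if "\<lfloor>?N k * z\<rfloor> \<in> labels (n k)" for k z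
    proof -
      have "- real (n k) \<le> ?N k * z" "?N k * z < real (n k) + 1"
        using that by (auto simp: labels_def le_floor_iff floor_le_iff)
      then have "- ?N k \<le> ?N k * z" "?N k * z \<le> ?N k" by linarith+
      then have "?N k * (- 1) \<le> ?N k * z" "?N k * z \<le> ?N k * 1" by (simp_all only: mult_1_right mult_minus_right)
      then have "z \<in> {- 1..1}" by (subst (asm) (1 2) mult_le_cancel_left_pos) auto
      then show ?thesis using S_le[OF s R1 \<theta>] by simp
    qed
    have "(\<lambda>k. of_bool (\<lfloor>?N k * z\<rfloor> \<in> labels (n k)) * S s p (\<theta> k) (n k) (R k) \<lfloor>?N k * z\<rfloor>)
        \<longlonglongrightarrow> indicator {- 1 / 2<..<1 / 2} z * J s p" if "z \<noteq> 1 / 2" "z \<noteq> - 1 / 2" for z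
    proof -
      note fl = floor_scaled_tendsto[OF N, of z]
      have gap: "(\<lambda>k. real (n k) / ?N k - \<bar>real_of_int \<lfloor>?N k * z\<rfloor> / ?N k\<bar>) \<longlonglongrightarrow> 1 / 2 - \<bar>z\<bar>"
        by (intro tendsto_intros nN fl)
      \<comment> \<open>The room in units of R is the macroscopic gap, which tends to 1/2 - |z|,
        times N/R.\<close>
      have eq: "(real (n k) - \<bar>\<lfloor>?N k * z\<rfloor>\<bar>) / R k
          = (real (n k) / ?N k - \<bar>real_of_int \<lfloor>?N k * z\<rfloor> / ?N k\<bar>) * (?N k / R k)" for k
      proof -
        have "\<bar>real_of_int \<lfloor>?N k * z\<rfloor> / ?N k\<bar> = \<bar>real_of_int \<lfloor>?N k * z\<rfloor>\<bar> / ?N k"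
          by (simp add: abs_divide)
        then show ?thesis by (simp add: diff_divide_distrib[symmetric])
      qed
      show ?thesis
      proof (cases "\<bar>z\<bar> < 1 / 2")
        case True
        have room: "filterlim (\<lambda>k. (real (n k) - \<bar>\<lfloor>?N k * z\<rfloor>\<bar>) / R k) at_top sequentially"
          unfolding eq using True by (intro filterlim_tendsto_pos_mult_at_top[OF gap] NR) auto
        have "\<forall>\<^sub>F k in sequentially. 0 + \<lfloor>?N k * z\<rfloor> \<in> labels (n k)"
          by (rule eventually_mem_labels(1)[OF R room, where y = 0]) simp
        then have ev: "\<forall>\<^sub>F k in sequentially. S s p (\<theta> k) (n k) (R k) \<lfloor>?N k * z\<rfloor>
            = of_bool (\<lfloor>?N k * z\<rfloor> \<in> labels (n k)) * S s p (\<theta> k) (n k) (R k) \<lfloor>?N k * z\<rfloor>"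
          by eventually_elim simp
        have "(\<lambda>k. S s p (\<theta> k) (n k) (R k) \<lfloor>?N k * z\<rfloor>) \<longlonglongrightarrow> J s p"
          by (rule S_tendsto[OF s R1 R room \<theta> \<theta>_lim])
        then have "(\<lambda>k. of_bool (\<lfloor>?N k * z\<rfloor> \<in> labels (n k)) * S s p (\<theta> k) (n k) (R k) \<lfloor>?N k * z\<rfloor>) \<longlonglongrightarrow> J s p"
          using ev by (rule Lim_transform_eventually)
        moreover have "z \<in> {- 1 / 2<..<1 / 2}" using True by auto
        ultimately show ?thesis by simp
      next
        case False
        then have "1 / 2 - \<bar>z\<bar> < 0" using that by auto
        with gap have "\<forall>\<^sub>F k in sequentially. real (n k) / ?N k - \<bar>real_of_int \<lfloor>?N k * z\<rfloor> / ?N k\<bar> < 0"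
          by (rule order_tendstoD)
        then have "\<forall>\<^sub>F k in sequentially. 0 = of_bool (\<lfloor>?N k * z\<rfloor> \<in> labels (n k)) * S s p (\<theta> k) (n k) (R k) \<lfloor>?N k * z\<rfloor>"
        proof eventually_elim
          case (elim k)
          have "\<bar>real_of_int \<lfloor>?N k * z\<rfloor> / ?N k\<bar> = \<bar>real_of_int \<lfloor>?N k * z\<rfloor>\<bar> / ?N k"
            by (simp add: abs_divide)
          then have "real (n k) < \<bar>real_of_int \<lfloor>?N k * z\<rfloor>\<bar>" using elim
            by (simp add: diff_divide_distrib[symmetric] divide_less_0_iff)
          then have "\<lfloor>?N k * z\<rfloor> \<notin> labels (n k)" unfolding labels_def atLeastAtMost_iff by linarith
          then show ?case by simp
        qed
        moreover have "z \<notin> {- 1 / 2<..<1 / 2}" using False by auto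
        ultimately show ?thesis by (auto intro: Lim_transform_eventually[OF tendsto_const])
      qed
    qed
    moreover have "AE z in lborel. z \<noteq> 1 / 2 \<and> z \<noteq> (- 1 / 2 :: real)"
      using AE_lborel_singleton[of "1 / 2"] AE_lborel_singleton[of "- 1 / 2"] by eventually_elim auto
    ultimately show "AE z in lborel. (\<lambda>k. of_bool (\<lfloor>?N k * z\<rfloor> \<in> labels (n k)) * S s p (\<theta> k) (n k) (R k) \<lfloor>?N k * z\<rfloor>)
        \<longlonglongrightarrow> indicator {- 1 / 2<..<1 / 2} z * J s p"
      by (auto elim: eventually_mono)
  qed
  moreover have "(\<integral>z. indicator {- 1 / 2<..<1 / 2 :: real} z * J s p \<partial>lborel) = J s p" by simp
  ultimately show ?thesis by simp
qed

end

section \<open>From the probability space to the random edge set\<close>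

text \<open>The random edge set has finitely many values. The events \<open>Ev U\<close> that it
  equals U partition the space, and by independence their probabilities are the weights in
  \<open>bex\<close>.\<close>

lemma (in prob_space) expectation_bex:
  fixes a :: "'e \<Rightarrow> 'a \<Rightarrow> real" and \<phi> :: "'e set \<Rightarrow> 'b :: {banach, second_countable_topology}"
  assumes E: "finite E" "E \<noteq> {}" and indep: "indep_vars (\<lambda>_. borel) a E"
    and a01: "\<And>e \<omega>. e \<in> E \<Longrightarrow> \<omega> \<in> space M \<Longrightarrow> a e \<omega> \<in> {0, 1}"
    and prob_a: "\<And>e. e \<in> E \<Longrightarrow> prob {\<omega> \<in> space M. a e \<omega> = 1} = q e"
  shows "(\<lambda>\<omega>. \<phi> {e \<in> E. a e \<omega> = 1}) \<in> borel_measurable M"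
    and "(\<integral>\<omega>. \<phi> {e \<in> E. a e \<omega> = 1} \<partial>M) = bex E q \<phi>"
proof -
  have rv [measurable]: "a e \<in> borel_measurable M" if "e \<in> E" for e
    using indep that by (auto simp: indep_vars_def2)
  define v where "v U e = (if e \<in> U then {1} else {0 :: real})" for U and e :: 'e
  define Ev where "Ev U = (\<Inter>e\<in>E. a e -` v U e \<inter> space M)" for U
  have Ev_iff: "\<omega> \<in> Ev U \<longleftrightarrow> {e \<in> E. a e \<omega> = 1} = U" if "\<omega> \<in> space M" "U \<subseteq> E" for \<omega> U
    using that E a01[OF _ that(1)] by (auto simp: Ev_def v_def split: if_splits)
  have meas: "a e -` v U e \<inter> space M \<in> events" if "e \<in> E" for e U
    using rv[OF that] by (rule measurable_sets) (simp add: v_def)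
  have Ev [measurable]: "Ev U \<in> events" for U
    unfolding Ev_def using E meas by (intro sets.finite_INT) auto
  have prob_Ev: "prob (Ev U) = (\<Prod>e\<in>U. q e) * (\<Prod>e\<in>E - U. 1 - q e)" if U: "U \<subseteq> E" for U
  proof -
    have one: "prob (a e -` v U e \<inter> space M) = (if e \<in> U then q e else 1 - q e)" if e: "e \<in> E" for e
    proof -
      have 1: "{\<omega> \<in> space M. a e \<omega> = 1} \<in> events" using e by measurable
      have "a e -` {1} \<inter> space M = {\<omega> \<in> space M. a e \<omega> = 1}" by auto
      moreover have "a e -` {0} \<inter> space M = space M - {\<omega> \<in> space M. a e \<omega> = 1}"
        using a01[OF e] by force
      ultimately show ?thesis
        using prob_a[OF e] prob_compl[OF 1] by (simp add: v_def)
    qed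
    have "prob (Ev U) = (\<Prod>e\<in>E. prob (a e -` v U e \<inter> space M))"
      unfolding Ev_def using E by (intro indep_varsD[OF indep]) (auto simp: v_def)
    also have "\<dots> = (\<Prod>e\<in>E. if e \<in> U then q e else 1 - q e)"
      by (intro prod.cong refl one)
    also have "\<dots> = (\<Prod>e\<in>E \<inter> U. q e) * (\<Prod>e\<in>E \<inter> - U. 1 - q e)"
      using prod.If_cases[OF E(1), of "\<lambda>e. e \<in> U" q "\<lambda>e. 1 - q e"] by simp
    finally show ?thesis using U by (simp add: Int_absorb1 Diff_eq)
  qed
  have eq: "\<phi> {e \<in> E. a e \<omega> = 1} = (\<Sum>U\<in>Pow E. indicator (Ev U) \<omega> *\<^sub>R \<phi> U)" if "\<omega> \<in> space M" for \<omega>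
  proof -
    have "(\<Sum>U\<in>Pow E. indicator (Ev U) \<omega> *\<^sub>R \<phi> U)
        = (\<Sum>U\<in>Pow E. if {e \<in> E. a e \<omega> = 1} = U then \<phi> U else 0)"
      using that by (intro sum.cong) (auto simp: Ev_iff indicator_def)
    then show ?thesis using E by (simp add: sum.delta')
  qed
  show "(\<lambda>\<omega>. \<phi> {e \<in> E. a e \<omega> = 1}) \<in> borel_measurable M"
    by (subst measurable_cong[OF eq]) auto
  have "(\<integral>\<omega>. \<phi> {e \<in> E. a e \<omega> = 1} \<partial>M) = (\<integral>\<omega>. (\<Sum>U\<in>Pow E. indicator (Ev U) \<omega> *\<^sub>R \<phi> U) \<partial>M)"
    by (intro Bochner_Integration.integral_cong refl eq)
  also have "\<dots> = (\<Sum>U\<in>Pow E. prob (Ev U) *\<^sub>R \<phi> U)"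
    using E by (subst Bochner_Integration.integral_sum) (auto simp: less_top[symmetric])
  finally show "(\<integral>\<omega>. \<phi> {e \<in> E. a e \<omega> = 1} \<partial>M) = bex E q \<phi>"
    unfolding bex_def by (simp add: prob_Ev)
qed

lemma trace_cube:
  assumes "B \<in> carrier_mat m m"
  shows "mat_trace (B ^\<^sub>m 3) = (\<Sum>r<m. \<Sum>s<m. \<Sum>t<m. B $$ (r, s) * B $$ (s, t) * B $$ (t, r))"
proof -
  have 3: "B ^\<^sub>m 3 = B * B * B" using assms by (simp add: numeral_3_eq_3)
  have BB: "(B * B) $$ (r, t) = (\<Sum>s<m. B $$ (r, s) * B $$ (s, t))" if "r < m" "t < m" for r t
    using assms that by (simp add: scalar_prod_def lessThan_atLeast0)
  have "(B * B * B) $$ (r, r) = (\<Sum>t<m. \<Sum>s<m. B $$ (r, s) * B $$ (s, t) * B $$ (t, r))" if "r < m" for r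
  proof -
    have "(B * B * B) $$ (r, r) = (\<Sum>t<m. (B * B) $$ (r, t) * B $$ (t, r))"
      using assms that by (subst index_mult_mat) (auto simp: scalar_prod_def lessThan_atLeast0)
    then show ?thesis using that by (simp add: BB sum_distrib_right)
  qed
  then have "mat_trace (B * B * B) = (\<Sum>r<m. \<Sum>t<m. \<Sum>s<m. B $$ (r, s) * B $$ (s, t) * B $$ (t, r))"
    using assms by (simp add: mat_trace_def)
  also have "\<dots> = (\<Sum>r<m. \<Sum>s<m. \<Sum>t<m. B $$ (r, s) * B $$ (s, t) * B $$ (t, r))"
    by (rule sum.cong[OF refl], rule sum.swap)
  finally show ?thesis by (simp add: 3)
qed

lemma trace_adj_matrix_cube:
  "mat_trace (adj_matrix \<alpha> \<psi> n R e ^\<^sub>m 3) = (\<Sum>i\<in>labels n. \<Sum>j\<in>labels n. \<Sum>k\<in>labels n.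
     adj_entry \<alpha> \<psi> R e i j * adj_entry \<alpha> \<psi> R e j k * adj_entry \<alpha> \<psi> R e k i)"
proof -
  have re: "(\<Sum>r<2 * n + 1. f (int r - int n)) = (\<Sum>i\<in>labels n. f i)" for f :: "int \<Rightarrow> real"
    by (rule sum.reindex_bij_witness[where i = "\<lambda>i. nat (i + int n)" and j = "\<lambda>r. int r - int n"])
       (auto simp: labels_def)
  have "adj_matrix \<alpha> \<psi> n R e \<in> carrier_mat (2 * n + 1) (2 * n + 1)"
    by (simp add: adj_matrix_def)
  then have "mat_trace (adj_matrix \<alpha> \<psi> n R e ^\<^sub>m 3)
      = (\<Sum>r<2 * n + 1. \<Sum>s<2 * n + 1. \<Sum>t<2 * n + 1.
          adj_entry \<alpha> \<psi> R e (int r - int n) (int s - int n)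
        * adj_entry \<alpha> \<psi> R e (int s - int n) (int t - int n)
        * adj_entry \<alpha> \<psi> R e (int t - int n) (int r - int n))"
    by (subst trace_cube) (auto simp: adj_matrix_def simp del: sum.lessThan_Suc intro!: sum.cong)
  also have "\<dots> = (\<Sum>i\<in>labels n. \<Sum>j\<in>labels n. \<Sum>k\<in>labels n.
     adj_entry \<alpha> \<psi> R e i j * adj_entry \<alpha> \<psi> R e j k * adj_entry \<alpha> \<psi> R e k i)"
    (is "?lhs = (\<Sum>i\<in>_. \<Sum>j\<in>_. \<Sum>k\<in>_. ?G i j k)")
  proof -
    let ?i = "\<lambda>r. int r - int n"
    have "?lhs = (\<Sum>r<2 * n + 1. \<Sum>s<2 * n + 1. \<Sum>k\<in>labels n. ?G (?i r) (?i s) k)"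
      using re[of "\<lambda>k. ?G (?i r) (?i s) k" for r s] by simp
    also have "\<dots> = (\<Sum>r<2 * n + 1. \<Sum>j\<in>labels n. \<Sum>k\<in>labels n. ?G (?i r) j k)"
      using re[of "\<lambda>j. \<Sum>k\<in>labels n. ?G (?i r) j k" for r] by simp
    also have "\<dots> = (\<Sum>i\<in>labels n. \<Sum>j\<in>labels n. \<Sum>k\<in>labels n. ?G i j k)"
      by (rule re)
    finally show ?thesis .
  qed
  finally show ?thesis .
qed

lemma char_centered_normal:
  assumes "0 < v"
  shows "real_distribution (centered_normal v)"
    and "char (centered_normal v) t = of_real (exp (- (v * t\<^sup>2) / 2))"
proof -
  have "prob_space (centered_normal v)"
    unfolding centered_normal_def using assms by (intro prob_space_normal_density) simp
  then show "real_distribution (centered_normal v)"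
    by (simp add: real_distribution_def real_distribution_axioms_def centered_normal_def)
  interpret std: prob_space std_normal_distribution by (intro prob_space_normal_density) simp
  have "distributed std_normal_distribution lborel (\<lambda>x. x) (\<lambda>x. ennreal (normal_density 0 1 x))"
    by (auto simp: distributed_def distr_id2)
  from std.normal_density_affine[OF this, of "sqrt v" 0]
  have "distributed std_normal_distribution lborel (\<lambda>x. sqrt v * x) (\<lambda>x. ennreal (normal_density 0 (sqrt v) x))"
    using assms by simp
  then have "centered_normal v = distr std_normal_distribution lborel (\<lambda>x. sqrt v * x)"
    by (simp add: centered_normal_def distributed_distr_eq_density)
  then have "char (centered_normal v) t = char std_normal_distribution (sqrt v * t)"
    unfolding char_def by (simp add: integral_distr mult_ac)
  then show "char (centered_normal v) t = of_real (exp (- (v * t\<^sup>2) / 2))"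
    using assms by (simp add: char_std_normal_distribution power_mult_distrib)
qed

section \<open>The variance and the third-order term of the triangle count\<close>

context profile
begin

definition wf :: "real \<Rightarrow> int \<Rightarrow> int \<Rightarrow> real" where
  "wf R i j = (if i = j then 0 else 1 + real \<alpha> * (\<psi> (real_of_int (i - j) / R))\<^sup>2)"

definition qf :: "real \<Rightarrow> real \<Rightarrow> int \<Rightarrow> int \<Rightarrow> real" where
  "qf \<beta> R i j = \<beta> * exp (- (\<psi> (real_of_int (i - j) / R))\<^sup>2)"

definition A0 :: "nat \<Rightarrow> real \<Rightarrow> real" where
  "A0 n R = 6 * (1 / dimN n * (\<Sum>u\<in>labels n. S 2 1 (\<lambda>_. 1) n R u))"

definition B0 :: "nat \<Rightarrow> real \<Rightarrow> real \<Rightarrow> real" where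
  "B0 n \<beta> R = 18 * (1 / dimN n * (\<Sum>u\<in>labels n. S 1 2 (\<lambda>m. 1 - \<beta> * h 0 (m / R)) n R u))"

text \<open>The bound of \<open>kappa_triangles_le\<close> with \<open_K> replaced by
  \<open>64 + HI\<close>, which dominates both the maximum 64 of the majorant and its normalized row
  sums \<open>HI\<close>.\<close>

definition kappa_bound :: "nat \<Rightarrow> real \<Rightarrow> real \<Rightarrow> real" where
  "kappa_bound n \<beta> R = 648 * (64 + HI) ^ 3 * (\<beta> ^ 3 * dimN n * R\<^sup>2)
     * (1 + (64 + HI)\<^sup>2 * (\<beta>\<^sup>2 * R) + (64 + HI) ^ 4 * (\<beta>\<^sup>2 * R)\<^sup>2)"

lemma minus_scaled: "real_of_int (j - i) / R = - (real_of_int (i - j) / R)"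
  unfolding minus_divide_left of_int_minus[symmetric] minus_diff_eq ..

lemma \<psi>_minus: "\<psi> (real_of_int (j - i) / R) = \<psi> (real_of_int (i - j) / R)"
  unfolding minus_scaled[of j i] by (rule even)

lemma H_minus: "H (real_of_int (j - i) / R) = H (real_of_int (i - j) / R)"
  unfolding minus_scaled[of j i] by (rule H_even)

lemma g0_even: "g0 s R (j - i) = g0 s R (i - j)"
  unfolding g0_def h_def \<psi>_minus[of j i] by simp

lemma wf_qf: "1 \<le> m \<Longrightarrow> wf R i j ^ m * qf \<beta> R i j = \<beta> * g0 m R (i - j)"
  by (simp add: wf_def qf_def g0_def h_def power_0_left)

end

locale triangle_profile = profile +
  fixes n :: nat and \<beta> R :: real
  assumes \<beta>: "0 < \<beta>" "\<beta> \<le> 1" and R: "1 \<le> R"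
begin

lemma qf_le: "qf \<beta> R i j \<le> \<beta>"
  using \<beta> by (simp add: qf_def)

sublocale triangles "labels n" "wf R" "qf \<beta> R"
proof
  show "finite (labels n)" by (simp add: labels_def)
  show "wf R i j = wf R j i" for i j unfolding wf_def by (simp only: \<psi>_minus[of j i]) auto
  show "qf \<beta> R i j = qf \<beta> R j i" for i j unfolding qf_def by (simp only: \<psi>_minus[of j i])
  show "wf R i i = 0" for i by (simp add: wf_def)
  show "0 \<le> wf R i j" for i j by (simp add: wf_def)
  show "0 < qf \<beta> R i j" for i j using \<beta> by (simp add: qf_def)
  show "qf \<beta> R i j \<le> 1" for i j using qf_le[of i j] \<beta> by simp
qed

lemma card_labels: "real (card (labels n)) = dimN n"
  by (simp add: labels_def)

lemma kappa_le_bound: "kappa \<le> kappa_bound n \<beta> R"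
proof -
  have "kappa \<le> 648 * (64 + HI) ^ 3 * (\<beta> ^ 3 * card (labels n) * R\<^sup>2)
     * (1 + (64 + HI)\<^sup>2 * (\<beta>\<^sup>2 * R) + (64 + HI) ^ 4 * (\<beta>\<^sup>2 * R)\<^sup>2)"
  proof (rule kappa_triangles_le[where h = "\<lambda>i j. H (real_of_int (i - j) / R)"])
    show "0 \<le> H (real_of_int (i - j) / R)" for i j using H_pos by (rule less_imp_le)
    show "H (real_of_int (i - j) / R) \<le> 64 + HI" for i j
      using H_le[of "real_of_int (i - j) / R"] HI_nonneg by simp
    show "(\<Sum>j\<in>labels n. H (real_of_int (i - j) / R)) \<le> (64 + HI) * R" for i
    proof -
      have "1 / R * (\<Sum>j\<in>labels n. H (real_of_int (i - j) / R)) \<le> HI"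
        unfolding H_minus[of i] using sum_H_le[OF R, of "labels n" i] by (simp add: labels_def)
      then have "(\<Sum>j\<in>labels n. H (real_of_int (i - j) / R)) \<le> HI * R"
        using R by (simp add: field_simps)
      then show ?thesis using R by (simp add: distrib_right)
    qed
    show "wf R i j ^ m * qf \<beta> R i j \<le> \<beta> * H (real_of_int (i - j) / R)" if "m \<in> {1, 2, 3}" for i j m
      using that \<beta> g0_le[of m R "i - j"] by (subst wf_qf) (auto intro: mult_left_mono)
  qed (use \<beta> R HI_nonneg in auto)
  then show ?thesis by (simp only: kappa_bound_def card_labels)
qed

text \<open>Each division by a probability cancels. What remains is a sum of four products of
  numbers between 0 and 1, each with a factor that is at most \<beta>.\<close>

lemma defect_bounds: "0 \<le> defect i j k" "defect i j k \<le> 4 * \<beta>"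
proof -
  let ?a = "qf \<beta> R i j" and ?b = "qf \<beta> R j k" and ?c = "qf \<beta> R i k"
  have pos: "0 < ?a" "0 < ?b" "0 < ?c" using q_pos by auto
  have le1: "?a \<le> 1" "?b \<le> 1" "?c \<le> 1" using q_le_1 by auto
  have eq: "defect i j k = ?a * (?b * ?c) + ?b * (?c * (1 - ?a)) + ?a * (?c * (1 - ?b)) + ?a * (?b * (1 - ?c))"
    using pos by (simp add: defect_def field_simps)
  show "0 \<le> defect i j k" unfolding eq using pos le1 by simp
  have *: "p * (r * s) \<le> \<beta>" if "p \<le> \<beta>" "0 < p" "0 \<le> r" "r \<le> 1" "0 \<le> s" "s \<le> 1" for p r s :: real
    using mult_mono[OF that(1) mult_le_one[OF that(4,5,6)]] that \<beta> by simp
  show "defect i j k \<le> 4 * \<beta>"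
    unfolding eq using *[of ?a ?b ?c] *[of ?b ?c "1 - ?a"] *[of ?a ?c "1 - ?b"] *[of ?a ?b "1 - ?c"]
      qf_le[of i j] qf_le[of j k] pos le1 by simp
qed

text \<open>\<open>B0\<close> enters exactly, because its \<theta> contains the factor 1 - q of the
  edge sum. The coefficient \<open>A\<close> differs from \<open>A0\<close> only by the factors
  \<open>1 - defect\<close>, hence the relative error 4 \<beta>.\<close>

lemma var_form:
  "\<exists>A. var = \<beta> ^ 3 * dimN n * R\<^sup>2 * (A + \<beta>\<^sup>2 * R * B0 n \<beta> R) \<and> \<bar>A - A0 n R\<bar> \<le> 4 * \<beta> * A0 n R"
proof -
  let ?L = "labels n"
  let ?T = "\<lambda>i j k. g0 2 R (i - j) * g0 2 R (j - k) * g0 2 R (i - k)"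
  let ?N = "dimN n"
  have N: "0 < ?N" and R0: "0 < R" using R by auto
  define A where "A = 6 / (?N * R\<^sup>2) * (\<Sum>i\<in>?L. \<Sum>j\<in>?L. \<Sum>k\<in>?L. ?T i j k * (1 - defect i j k))"
  have A0: "A0 n R = 6 / (?N * R\<^sup>2) * (\<Sum>i\<in>?L. \<Sum>j\<in>?L. \<Sum>k\<in>?L. ?T i j k)"
  proof -
    have "(\<Sum>u\<in>?L. S 2 1 (\<lambda>_. 1) n R u) = 1 / R * (1 / R * (\<Sum>i\<in>?L. \<Sum>j\<in>?L. \<Sum>k\<in>?L. ?T i j k))"
      unfolding S_def Q_def sum_distrib_left
      by (intro sum.cong refl) (simp add: sum_distrib_left g0_even mult_ac)
    then show ?thesis by (simp add: A0_def power2_eq_square)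
  qed
  have 1: "6 * (\<Sum>i\<in>?L. \<Sum>j\<in>?L. \<Sum>k\<in>?L. (wf R i j * wf R j k * wf R i k)\<^sup>2
      * (qf \<beta> R i j * qf \<beta> R j k * qf \<beta> R i k) * (1 - defect i j k)) = \<beta> ^ 3 * ?N * R\<^sup>2 * A"
  proof -
    have "(wf R i j * wf R j k * wf R i k)\<^sup>2 * (qf \<beta> R i j * qf \<beta> R j k * qf \<beta> R i k) = \<beta> ^ 3 * ?T i j k" for i j k
    proof -
      have "(a * b * c)\<^sup>2 * (p * r * s) = (a\<^sup>2 * p) * (b\<^sup>2 * r) * (c\<^sup>2 * s)" for a b c p r s :: real
        by (simp add: power2_eq_square)
      then show ?thesis by (simp only: wf_qf one_le_numeral) (simp add: power3_eq_cube)
    qed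
    then have "6 * (\<Sum>i\<in>?L. \<Sum>j\<in>?L. \<Sum>k\<in>?L. (wf R i j * wf R j k * wf R i k)\<^sup>2
      * (qf \<beta> R i j * qf \<beta> R j k * qf \<beta> R i k) * (1 - defect i j k))
      = 6 * (\<beta> ^ 3 * (\<Sum>i\<in>?L. \<Sum>j\<in>?L. \<Sum>k\<in>?L. ?T i j k * (1 - defect i j k)))"
      by (simp add: sum_distrib_left mult.assoc)
    then show ?thesis unfolding A_def using N R0 by simp
  qed
  have 2: "18 * (\<Sum>i\<in>?L. \<Sum>j\<in>?L. (wf R i j)\<^sup>2 * qf \<beta> R i j * (1 - qf \<beta> R i j)
      * (\<Sum>k\<in>?L. wf R i k * qf \<beta> R i k * (wf R j k * qf \<beta> R j k))\<^sup>2)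
    = \<beta> ^ 3 * ?N * R\<^sup>2 * (\<beta>\<^sup>2 * R * B0 n \<beta> R)"
  proof -
    have "(wf R i j)\<^sup>2 * qf \<beta> R i j * (1 - qf \<beta> R i j)
        * (\<Sum>k\<in>?L. wf R i k * qf \<beta> R i k * (wf R j k * qf \<beta> R j k))\<^sup>2
        = \<beta> ^ 5 * R ^ 3 * (1 / R * (g0 2 R (j - i) * (1 - \<beta> * h 0 (real_of_int (j - i) / R)) * Q 1 n R i j ^ 2))" for i j
    proof -
      have wq: "wf R i j * qf \<beta> R i j = \<beta> * g0 1 R (i - j)" for i j
        using wf_qf[of 1 R i j] by simp
      have "(\<Sum>k\<in>?L. wf R i k * qf \<beta> R i k * (wf R j k * qf \<beta> R j k)) = \<beta>\<^sup>2 * (R * Q 1 n R i j)"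
        unfolding wq Q_def using R0 by (simp add: sum_distrib_left g0_even power2_eq_square mult_ac)
      moreover have "qf \<beta> R i j = \<beta> * h 0 (real_of_int (j - i) / R)"
        unfolding qf_def h_def \<psi>_minus[of j i] by simp
      moreover have "(wf R i j)\<^sup>2 * qf \<beta> R i j = \<beta> * g0 2 R (j - i)"
        by (simp add: wf_qf g0_even)
      ultimately have "(wf R i j)\<^sup>2 * qf \<beta> R i j * (1 - qf \<beta> R i j)
        * (\<Sum>k\<in>?L. wf R i k * qf \<beta> R i k * (wf R j k * qf \<beta> R j k))\<^sup>2
        = \<beta> * g0 2 R (j - i) * (1 - \<beta> * h 0 (real_of_int (j - i) / R)) * (\<beta>\<^sup>2 * (R * Q 1 n R i j))\<^sup>2" by simp
      also have "\<dots> = \<beta> ^ 5 * R ^ 3 * (1 / R * (g0 2 R (j - i) * (1 - \<beta> * h 0 (real_of_int (j - i) / R)) * Q 1 n R i j ^ 2))"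
        using R0 by (simp add: power2_eq_square eval_nat_numeral)
      finally show ?thesis .
    qed
    then have "(\<Sum>i\<in>?L. \<Sum>j\<in>?L. (wf R i j)\<^sup>2 * qf \<beta> R i j * (1 - qf \<beta> R i j)
        * (\<Sum>k\<in>?L. wf R i k * qf \<beta> R i k * (wf R j k * qf \<beta> R j k))\<^sup>2)
        = \<beta> ^ 5 * R ^ 3 * (\<Sum>u\<in>?L. S 1 2 (\<lambda>m. 1 - \<beta> * h 0 (m / R)) n R u)"
      unfolding S_def by (simp only: sum_distrib_left)
    then show ?thesis unfolding B0_def using N R0
      by (simp add: power2_eq_square eval_nat_numeral)
  qed
  have "var = \<beta> ^ 3 * ?N * R\<^sup>2 * (A + \<beta>\<^sup>2 * R * B0 n \<beta> R)"
    unfolding var_triangles 1 2 by (simp add: distrib_left)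
  moreover have "\<bar>A - A0 n R\<bar> \<le> 4 * \<beta> * A0 n R"
  proof -
    have T: "0 \<le> ?T i j k" for i j k by (intro mult_nonneg_nonneg g0_nonneg)
    have "A0 n R - A = 6 / (?N * R\<^sup>2) * (\<Sum>i\<in>?L. \<Sum>j\<in>?L. \<Sum>k\<in>?L. ?T i j k * defect i j k)"
      unfolding A0 A_def right_diff_distrib[symmetric] sum_subtractf[symmetric]
      by (simp add: algebra_simps)
    moreover have "0 \<le> 6 / (?N * R\<^sup>2) * (\<Sum>i\<in>?L. \<Sum>j\<in>?L. \<Sum>k\<in>?L. ?T i j k * defect i j k)"
      by (rule mult_nonneg_nonneg, simp) (intro sum_nonneg mult_nonneg_nonneg[OF T] defect_bounds)
    moreover have "(\<Sum>i\<in>?L. \<Sum>j\<in>?L. \<Sum>k\<in>?L. ?T i j k * defect i j k)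
        \<le> (\<Sum>i\<in>?L. \<Sum>j\<in>?L. \<Sum>k\<in>?L. ?T i j k * (4 * \<beta>))"
      by (intro sum_mono mult_left_mono[OF _ T] defect_bounds)
    then have "6 / (?N * R\<^sup>2) * (\<Sum>i\<in>?L. \<Sum>j\<in>?L. \<Sum>k\<in>?L. ?T i j k * defect i j k)
        \<le> 6 / (?N * R\<^sup>2) * (\<Sum>i\<in>?L. \<Sum>j\<in>?L. \<Sum>k\<in>?L. ?T i j k * (4 * \<beta>))"
      using N by (intro mult_left_mono) auto
    then have "6 / (?N * R\<^sup>2) * (\<Sum>i\<in>?L. \<Sum>j\<in>?L. \<Sum>k\<in>?L. ?T i j k * defect i j k) \<le> 4 * \<beta> * A0 n R"
      unfolding A0 sum_distrib_right[symmetric] by (simp add: mult_ac)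
    ultimately show ?thesis by linarith
  qed
  ultimately show ?thesis by blast
qed

text \<open>On the sample space the matrix entries are the functions \<open>x\<close> of the random
  edge set. The trace of the cube is therefore the sum of \<open>Z\<close> over all triangles, and
  subtracting the mean gives \<open>W\<close>.\<close>

lemma model_transfer:
  fixes M :: "'w measure" and e :: "int \<Rightarrow> int \<Rightarrow> 'w \<Rightarrow> real"
  assumes M: "prob_space M" and n: "1 \<le> n"
    and indep: "prob_space.indep_vars M (\<lambda>_. borel) (\<lambda>(i, j). e i j) edges"
    and e01: "\<And>i j \<omega>. (i, j) \<in> edges \<Longrightarrow> \<omega> \<in> space M \<Longrightarrow> e i j \<omega> \<in> {0, 1}"
    and prob: "\<And>i j. (i, j) \<in> edges \<Longrightarrow> measure M {\<omega> \<in> space M. e i j \<omega> = 1} = qf \<beta> R i j"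
    and X_def: "\<And>\<omega>. X \<omega> = mat_trace (adj_matrix \<alpha> \<psi> n R (\<lambda>i j. e i j \<omega>) ^\<^sub>m 3)"
  shows "X \<in> borel_measurable M" and "prob_space.variance M X = var"
    and "(\<integral>\<omega>. iexp (t * (X \<omega> - prob_space.expectation M X)) \<partial>M) = ex (\<lambda>U. iexp (t * W U))"
proof -
  interpret prob_space M by fact
  define Us where "Us \<omega> = {p \<in> edges. (case p of (i, j) \<Rightarrow> e i j) \<omega> = 1}" for \<omega>
  \<comment> \<open>The transfer of expectations requires a nonempty set of edges; n >= 1 provides
    one.\<close>
  have "(0, 1) \<in> edges" unfolding edges_def using n by (simp add: labels_def)
  then have ne: "edges \<noteq> {}" by auto
  have transfer: "(\<lambda>\<omega>. \<phi> (Us \<omega>)) \<in> borel_measurable M"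
      "(\<integral>\<omega>. \<phi> (Us \<omega>) \<partial>M) = ex \<phi>"
    for \<phi> :: "(int \<times> int) set \<Rightarrow> 'b :: {banach, second_countable_topology}"
    unfolding Us_def using e01 prob
    by (intro expectation_bex[OF fin_edges ne indep, of "\<lambda>(i, j). qf \<beta> R i j" \<phi>]; force)+
  have entry: "adj_entry \<alpha> \<psi> R (\<lambda>i j. e i j \<omega>) i j = x i j (Us \<omega>)"
    if "i \<in> labels n" "j \<in> labels n" "\<omega> \<in> space M" for i j \<omega>
  proof (cases "i = j")
    case True
    then show ?thesis by (simp add: adj_entry_def)
  next
    case False
    then have m: "(min i j, max i j) \<in> edges" using that by (auto simp: edges_def min_def max_def)
    have "e (min i j) (max i j) \<omega> = of_bool ((min i j, max i j) \<in> Us \<omega>)"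
      using e01[OF m that(3)] m by (auto simp: Us_def)
    moreover have "\<psi> (real_of_int (min i j - max i j) / R) = \<psi> (real_of_int (i - j) / R)"
      using \<psi>_minus[of i j R] by (cases "i \<le> j") (simp_all add: min_def max_def)
    ultimately show ?thesis using False by (simp add: adj_entry_def x_def wf_def)
  qed
  have X: "X \<omega> = (\<Sum>T\<in>tris. Z T (Us \<omega>))" if "\<omega> \<in> space M" for \<omega>
  proof -
    let ?x = "\<lambda>i j. x i j (Us \<omega>)"
    have "X \<omega> = (\<Sum>i\<in>labels n. \<Sum>j\<in>labels n. \<Sum>k\<in>labels n. ?x i j * ?x j k * ?x k i)"
      unfolding X_def trace_adj_matrix_cube using that by (intro sum.cong refl) (simp add: entry)
    also have "\<dots> = 6 * (\<Sum>(i, j, k)\<in>tris. ?x i j * ?x j k * ?x k i)"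
      by (rule sum_tris) (simp_all add: x_sym mult_ac)
    also have "\<dots> = (\<Sum>T\<in>tris. Z T (Us \<omega>))"
      unfolding sum_distrib_left by (intro sum.cong) (auto simp: Z_tri x_sym)
    finally show ?thesis .
  qed
  show "X \<in> borel_measurable M"
    by (subst measurable_cong[OF X]) (auto intro: transfer(1))
  have "expectation X = (\<integral>\<omega>. (\<Sum>T\<in>tris. Z T (Us \<omega>)) \<partial>M)"
    by (intro Bochner_Integration.integral_cong refl X)
  also have "\<dots> = (\<Sum>T\<in>tris. mu T)"
    by (subst transfer(2)) (simp add: bex_sum ex_Z)
  finally have EX: "expectation X = (\<Sum>T\<in>tris. mu T)" .
  have W: "X \<omega> - expectation X = W (Us \<omega>)" if "\<omega> \<in> space M" for \<omega>
    unfolding EX X[OF that] W_def Y_def by (simp add: sum_subtractf)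
  have "variance X = (\<integral>\<omega>. (W (Us \<omega>))\<^sup>2 \<partial>M)"
    by (intro Bochner_Integration.integral_cong refl) (simp add: W)
  also have "\<dots> = var" unfolding var_eq[symmetric] by (rule transfer(2))
  finally show "variance X = var" .
  have "(\<integral>\<omega>. iexp (t * (X \<omega> - expectation X)) \<partial>M) = (\<integral>\<omega>. iexp (t * W (Us \<omega>)) \<partial>M)"
    by (intro Bochner_Integration.integral_cong refl) (simp add: W)
  also have "\<dots> = ex (\<lambda>U. iexp (t * W U))"
    using transfer(2)[of "\<lambda>U. iexp (t * W U)"] .
  finally show "(\<integral>\<omega>. iexp (t * (X \<omega> - expectation X)) \<partial>M) = ex (\<lambda>U. iexp (t * W U))" .
qed

end

context profile
begin

lemma X3_estimates:
  fixes M :: "nat \<Rightarrow> real \<Rightarrow> real \<Rightarrow> 'w measure"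
  assumes ev: "edge_variables \<psi> M a"
    and good: "1 \<le> n" "0 < c" "c \<le> dimN n" "1 \<le> R"
  defines "\<beta> \<equiv> c / dimN n"
  defines "X \<equiv> X3 \<alpha> \<psi> a n c R"
  shows "prob_space (M n c R)" and "X \<in> borel_measurable (M n c R)"
    and "\<exists>A. Cum2 (M n c R) X = \<beta> ^ 3 * dimN n * R\<^sup>2 * (A + \<beta>\<^sup>2 * R * B0 n \<beta> R)
          \<and> \<bar>A - A0 n R\<bar> \<le> 4 * \<beta> * A0 n R"
    and "cmod ((\<integral>\<omega>. iexp (t * (X \<omega> - prob_space.expectation (M n c R) X)) \<partial>(M n c R))
      - of_real (exp (- (Cum2 (M n c R) X * t\<^sup>2) / 2))) \<le> 36 * kappa_bound n \<beta> R * \<bar>t\<bar> ^ 3"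
proof -
  have \<beta>: "0 < \<beta>" "\<beta> \<le> 1" using good by (auto simp: \<beta>_def)
  interpret triangle_profile \<psi> \<alpha> n \<beta> R
    using \<beta> good by unfold_locales
  have R0: "0 < R" using good by simp
  note model = ev[unfolded edge_variables_def, rule_format, of c n R, OF conjI[OF good(2) conjI[OF good(3) R0]]]
  show M: "prob_space (M n c R)" using model by blast
  have indep: "prob_space.indep_vars (M n c R) (\<lambda>_. borel) (\<lambda>(i, j). a n c R i j) edges"
    using model by (simp add: edges_def)
  have e01: "a n c R i j \<omega> \<in> {0, 1}" if "(i, j) \<in> edges" "\<omega> \<in> space (M n c R)" for i j \<omega>
    using model that unfolding edges_def by blast
  have prob: "measure (M n c R) {\<omega> \<in> space (M n c R). a n c R i j \<omega> = 1} = qf \<beta> R i j" if "(i, j) \<in> edges" for i j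
    using model that unfolding edges_def qf_def \<beta>_def by blast
  have X: "X \<omega> = mat_trace (adj_matrix \<alpha> \<psi> n R (\<lambda>i j. a n c R i j \<omega>) ^\<^sub>m 3)" for \<omega>
    by (simp add: X_def X3_def)
  have tr: "X \<in> borel_measurable (M n c R)" "Cum2 (M n c R) X = var"
    "(\<integral>\<omega>. iexp (t * (X \<omega> - prob_space.expectation (M n c R) X)) \<partial>(M n c R)) = ex (\<lambda>U. iexp (t * W U))"
    by (rule model_transfer[where e = "a n c R"]; (rule M good(1) indep X | erule (1) e01 | erule prob))+
  show "X \<in> borel_measurable (M n c R)" by (rule tr(1))
  show "\<exists>A. Cum2 (M n c R) X = \<beta> ^ 3 * dimN n * R\<^sup>2 * (A + \<beta>\<^sup>2 * R * B0 n \<beta> R)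
          \<and> \<bar>A - A0 n R\<bar> \<le> 4 * \<beta> * A0 n R"
    unfolding tr(2) by (rule var_form)
  show "cmod ((\<integral>\<omega>. iexp (t * (X \<omega> - prob_space.expectation (M n c R) X)) \<partial>(M n c R))
      - of_real (exp (- (Cum2 (M n c R) X * t\<^sup>2) / 2))) \<le> 36 * kappa_bound n \<beta> R * \<bar>t\<bar> ^ 3"
    unfolding tr(2) tr(3)
    by (rule order_trans[OF char_fun_bound]) (intro mult_right_mono mult_left_mono kappa_le_bound, auto)
qed

end

section \<open>Limits along the transition\<close>

text \<open>If convergence failed, a point with f far from L could be picked from the k-th basic set
  for every k. These points form a sequence that tends to the filter and contradicts the sequential
  limit.\<close>

lemma tendsto_via_sequences:
  fixes f :: "'a \<Rightarrow> 'b :: metric_space"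
  assumes basis: "\<And>k::nat. eventually (\<lambda>x. Pr k x) F"
    and converge: "\<And>p. (\<And>k. Pr k (p k)) \<Longrightarrow> filterlim p F sequentially"
    and lim: "\<And>p. filterlim p F sequentially \<Longrightarrow> (\<lambda>k::nat. f (p k)) \<longlonglongrightarrow> L"
  shows "(f \<longlongrightarrow> L) F"
proof (rule tendstoI, rule ccontr)
  fix \<epsilon> :: real assume \<epsilon>: "0 < \<epsilon>" and bad: "\<not> eventually (\<lambda>x. dist (f x) L < \<epsilon>) F"
  have "\<exists>x. Pr k x \<and> \<not> dist (f x) L < \<epsilon>" for k
  proof (rule ccontr)
    assume "\<not> ?thesis"
    with basis[of k] have "eventually (\<lambda>x. dist (f x) L < \<epsilon>) F" by (auto elim: eventually_mono)
    with bad show False by simp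
  qed
  then obtain p where p: "\<And>k. Pr k (p k)" "\<And>k. \<not> dist (f (p k)) L < \<epsilon>" by metis
  from lim[OF converge[OF p(1)]] have "\<forall>\<^sub>F k in sequentially. dist (f (p k)) L < \<epsilon>"
    using \<epsilon> by (rule tendstoD)
  with p(2) show False by simp
qed

text \<open>The continuity theorem wants a probability law for every k, but the parameters are
  admissible only from some index on.\<close>

lemma weak_conv_m_offset:
  assumes "weak_conv_m (\<lambda>k. \<mu> (k + m)) \<nu>"
  shows "weak_conv_m \<mu> \<nu>"
  using assms unfolding weak_conv_m_def weak_conv_def by (blast intro: LIMSEQ_offset)

lemma filterlim_transition:
  "filterlim (\<lambda>k. (n k, c k, R k)) transition F \<longleftrightarrow>
     filterlim n at_top F \<and> filterlim c at_top F \<and> filterlim R at_top F \<and>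
     ((\<lambda>k. R k / dimN (n k)) \<longlongrightarrow> 0) F \<and> ((\<lambda>k. c k / dimN (n k)) \<longlongrightarrow> 0) F"
  by (simp add: transition_def filterlim_inf filterlim_filtercomap_iff o_def)

lemma filterlim_inverse_Suc: "(\<And>k. \<bar>f k\<bar> \<le> 1 / real (Suc k)) \<Longrightarrow> f \<longlonglongrightarrow> 0"
  by (rule Lim_null_comparison[OF _ LIMSEQ_inverse_real_of_nat])
     (auto simp: inverse_eq_divide)

lemma filterlim_real_ge: "(\<And>k. real k \<le> f k) \<Longrightarrow> filterlim f at_top sequentially"
  by (rule filterlim_at_top_mono[OF filterlim_real_sequentially]) simp

definition transition_nbhd :: "nat \<Rightarrow> nat \<times> real \<times> real \<Rightarrow> bool" where
  "transition_nbhd k = (\<lambda>(n, c, R). k \<le> n \<and> real k \<le> c \<and> real k \<le> R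
     \<and> \<bar>R / dimN n\<bar> \<le> 1 / real (Suc k) \<and> \<bar>c / dimN n\<bar> \<le> 1 / real (Suc k))"

lemma eventually_small:
  fixes f :: "'a \<Rightarrow> real"
  assumes "(f \<longlongrightarrow> 0) F"
  shows "eventually (\<lambda>x. \<bar>f x\<bar> \<le> 1 / real (Suc k)) F"
  using tendstoD[OF assms, of "1 / real (Suc k)"] by (auto elim: eventually_mono)

lemma eventually_transition_nbhd: "eventually (transition_nbhd k) transition"
proof -
  have "filterlim (\<lambda>p. (fst p, fst (snd p), snd (snd p))) transition transition"
    by (simp add: filterlim_ident)
  then have "filterlim (\<lambda>p. fst p) at_top transition" "filterlim (\<lambda>p. fst (snd p)) at_top transition"
    "filterlim (\<lambda>p. snd (snd p)) at_top transition"
    "((\<lambda>p. snd (snd p) / dimN (fst p)) \<longlongrightarrow> 0) transition"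
    "((\<lambda>p. fst (snd p) / dimN (fst p)) \<longlongrightarrow> 0) transition"
    unfolding filterlim_transition by blast+
  then have ev: "\<forall>\<^sub>F p in transition. k \<le> fst p" "\<forall>\<^sub>F p in transition. real k \<le> fst (snd p)"
    "\<forall>\<^sub>F p in transition. real k \<le> snd (snd p)"
    "\<forall>\<^sub>F p in transition. \<bar>snd (snd p) / dimN (fst p)\<bar> \<le> 1 / real (Suc k)"
    "\<forall>\<^sub>F p in transition. \<bar>fst (snd p) / dimN (fst p)\<bar> \<le> 1 / real (Suc k)"
    by (simp_all only: filterlim_at_top eventually_small)
  show ?thesis
    using ev by eventually_elim (simp add: transition_nbhd_def split_def)
qed

lemma filterlim_transition_nbhd:
  assumes "\<And>k. transition_nbhd k (p k)"
  shows "filterlim p transition sequentially"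
proof -
  have "k \<le> fst (p k)" "real k \<le> fst (snd (p k))" "real k \<le> snd (snd (p k))"
    "\<bar>snd (snd (p k)) / dimN (fst (p k))\<bar> \<le> 1 / real (Suc k)"
    "\<bar>fst (snd (p k)) / dimN (fst (p k))\<bar> \<le> 1 / real (Suc k)" for k
    using assms[of k] by (auto simp: transition_nbhd_def split: prod.splits)
  then have "filterlim (\<lambda>k. (fst (p k), fst (snd (p k)), snd (snd (p k)))) transition sequentially"
    unfolding filterlim_transition
    by (auto intro!: filterlim_real_ge filterlim_inverse_Suc filterlim_at_top_mono[OF filterlim_ident])
  then show ?thesis by simp
qed

lemma tendsto_inf_via_sequences:
  fixes f :: "nat \<times> real \<times> real \<Rightarrow> real"
  assumes "\<And>k::nat. eventually (Pr k) G"
    and "\<And>p. (\<And>k. Pr k (p k)) \<Longrightarrow> filterlim p G sequentially"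
    and "\<And>p. filterlim p (inf transition G) sequentially \<Longrightarrow> (\<lambda>k::nat. f (p k)) \<longlonglongrightarrow> L"
  shows "(f \<longlongrightarrow> L) (inf transition G)"
proof (rule tendsto_via_sequences[where Pr = "\<lambda>k x. transition_nbhd k x \<and> Pr k x", OF _ _ assms(3)])
  show "\<forall>\<^sub>F x in inf transition G. transition_nbhd k x \<and> Pr k x" for k
    using eventually_transition_nbhd[of k] assms(1)[of k]
    unfolding eventually_inf by blast
  show "filterlim p (inf transition G) sequentially" if "\<And>k. transition_nbhd k (p k) \<and> Pr k (p k)" for p
    using that by (auto simp: filterlim_inf intro: filterlim_transition_nbhd assms(2))
qed

lemma tendsto_regime_i:
  assumes "\<And>p. filterlim p regime_i sequentially \<Longrightarrow> (\<lambda>k::nat. f (p k)) \<longlonglongrightarrow> (L :: real)"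
  shows "(f \<longlongrightarrow> L) regime_i"
  unfolding regime_i_def
proof (rule tendsto_inf_via_sequences[where Pr = "\<lambda>k x. real k \<le> (\<lambda>(n, c, R). c\<^sup>2 * R / (dimN n)\<^sup>2) x"])
  let ?\<rho> = "\<lambda>(n, c, R). c\<^sup>2 * R / (dimN n)\<^sup>2"
  show "\<forall>\<^sub>F x in filtercomap ?\<rho> at_top. real k \<le> ?\<rho> x" for k
    by (intro eventually_filtercomapI eventually_ge_at_top)
  show "filterlim p (filtercomap ?\<rho> at_top) sequentially" if "\<And>k. real k \<le> ?\<rho> (p k)" for p
    unfolding filterlim_filtercomap_iff o_def using that by (rule filterlim_real_ge)
qed (use assms in \<open>simp add: regime_i_def\<close>)

lemma tendsto_regime_ii:
  assumes "\<And>p. filterlim p (regime_ii s) sequentially \<Longrightarrow> (\<lambda>k::nat. f (p k)) \<longlonglongrightarrow> (L :: real)"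
  shows "(f \<longlongrightarrow> L) (regime_ii s)"
  unfolding regime_ii_def
proof (rule tendsto_inf_via_sequences[where Pr = "\<lambda>k x. x \<in> {(n, c, R). c\<^sup>2 * R = s * (dimN n)\<^sup>2}"])
  let ?S = "{(n, c, R). c\<^sup>2 * R = s * (dimN n)\<^sup>2}"
  show "\<forall>\<^sub>F x in principal ?S. x \<in> ?S" by (simp add: eventually_principal)
  show "filterlim p (principal ?S) sequentially" if "\<And>k. p k \<in> ?S" for p
    using that by (simp add: filterlim_principal)
qed (use assms in \<open>simp add: regime_ii_def\<close>)

lemma tendsto_regime_iii:
  assumes "\<And>p. filterlim p regime_iii sequentially \<Longrightarrow> (\<lambda>k::nat. f (p k)) \<longlonglongrightarrow> (L :: real)"
  shows "(f \<longlongrightarrow> L) regime_iii"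
  unfolding regime_iii_def
proof (rule tendsto_inf_via_sequences[where Pr = "\<lambda>k x. \<bar>(\<lambda>(n, c, R). c\<^sup>2 * R / (dimN n)\<^sup>2) x\<bar> \<le> 1 / real (Suc k)"])
  let ?\<rho> = "\<lambda>(n, c, R). c\<^sup>2 * R / (dimN n)\<^sup>2"
  show "\<forall>\<^sub>F x in filtercomap ?\<rho> (nhds 0). \<bar>?\<rho> x\<bar> \<le> 1 / real (Suc k)" for k
    by (intro eventually_small filterlim_filtercomap)
  show "filterlim p (filtercomap ?\<rho> (nhds 0)) sequentially" if "\<And>k. \<bar>?\<rho> (p k)\<bar> \<le> 1 / real (Suc k)" for p
    unfolding filterlim_filtercomap_iff o_def using that by (rule filterlim_inverse_Suc)
qed (use assms in \<open>simp add: regime_iii_def\<close>)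

section \<open>The limit theorem\<close>

context profile
begin

lemma A0_B0_tendsto:
  fixes n :: "nat \<Rightarrow> nat"
  assumes n: "filterlim n at_top sequentially" and R: "filterlim R at_top sequentially"
    and Rn: "(\<lambda>k. R k / dimN (n k)) \<longlonglongrightarrow> 0"
  shows "(\<lambda>k. A0 (n k) (R k)) \<longlonglongrightarrow> 6 * J 2 1"
    and "(\<lambda>k. \<beta> k) \<longlonglongrightarrow> 0 \<Longrightarrow> \<forall>\<^sub>F k in sequentially. 0 \<le> \<beta> k \<Longrightarrow>
      (\<lambda>k. B0 (n k) (\<beta> k) (R k)) \<longlonglongrightarrow> 18 * J 1 2"
proof -
  \<comment> \<open>The results on sums need \<open>1 \<le> R k\<close> for every k, while here it
    holds only eventually. Truncation changes finitely many terms; the same is done with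
    \<open>\<beta>\<close> below.\<close>
  define R' where "R' k = max 1 (R k)" for k
  have R1: "1 \<le> R' k" for k by (simp add: R'_def)
  have "\<forall>\<^sub>F k in sequentially. 1 \<le> R k" using R by (auto simp: filterlim_at_top)
  then have evR: "\<forall>\<^sub>F k in sequentially. R k = R' k" by eventually_elim (simp add: R'_def)
  have R': "filterlim R' at_top sequentially"
    using filterlim_cong[OF refl refl evR, of at_top] R by simp
  have "\<forall>\<^sub>F k in sequentially. R k / dimN (n k) = R' k / dimN (n k)"
    using evR by eventually_elim simp
  with Rn have Rn': "(\<lambda>k. R' k / dimN (n k)) \<longlonglongrightarrow> 0" by (rule Lim_transform_eventually)
  have "(\<lambda>k. A0 (n k) (R' k)) \<longlonglongrightarrow> 6 * J 2 1"
    unfolding A0_def by (intro tendsto_intros mean_S_tendsto[OF _ R1 R' n Rn']) auto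
  moreover have "\<forall>\<^sub>F k in sequentially. A0 (n k) (R' k) = A0 (n k) (R k)"
    using evR by eventually_elim simp
  ultimately show "(\<lambda>k. A0 (n k) (R k)) \<longlonglongrightarrow> 6 * J 2 1" by (rule Lim_transform_eventually)
  assume \<beta>: "(\<lambda>k. \<beta> k) \<longlonglongrightarrow> 0" "\<forall>\<^sub>F k in sequentially. 0 \<le> \<beta> k"
  define \<beta>' where "\<beta>' k = max 0 (min 1 (\<beta> k))" for k
  have b01: "0 \<le> \<beta>' k" "\<beta>' k \<le> 1" for k by (auto simp: \<beta>'_def)
  have "\<forall>\<^sub>F k in sequentially. \<beta> k < 1" using \<beta>(1) by (rule order_tendstoD) simp
  with \<beta>(2) have evb: "\<forall>\<^sub>F k in sequentially. \<beta> k = \<beta>' k" by eventually_elim (simp add: \<beta>'_def)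
  with \<beta>(1) have b0: "\<beta>' \<longlonglongrightarrow> 0" by (rule Lim_transform_eventually)
  have h01: "0 \<le> h 0 y" "h 0 y \<le> 1" for y by (auto simp: h_def)
  have "(\<lambda>k. B0 (n k) (\<beta>' k) (R' k)) \<longlonglongrightarrow> 18 * J 1 2"
    unfolding B0_def
  proof (intro tendsto_intros mean_S_tendsto[OF _ R1 R' n Rn'])
    show "0 \<le> 1 - \<beta>' k * h 0 (real_of_int m / R' k) \<and> 1 - \<beta>' k * h 0 (real_of_int m / R' k) \<le> 1" for k m
      using b01 h01 mult_le_one by (simp add: mult_le_one)
    show "(\<lambda>k. 1 - \<beta>' k * h 0 (real_of_int (m k) / R' k)) \<longlonglongrightarrow> 1" for m
    proof -
      have "(\<lambda>k. \<beta>' k * h 0 (real_of_int (m k) / R' k)) \<longlonglongrightarrow> 0"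
        by (rule Lim_null_comparison[OF _ b0]) (auto simp: abs_mult b01 h01 intro!: always_eventually mult_left_le)
      then have "(\<lambda>k. 1 - \<beta>' k * h 0 (real_of_int (m k) / R' k)) \<longlonglongrightarrow> 1 - 0" by (intro tendsto_intros)
      then show ?thesis by simp
    qed
  qed auto
  moreover have "\<forall>\<^sub>F k in sequentially. B0 (n k) (\<beta>' k) (R' k) = B0 (n k) (\<beta> k) (R k)"
    using evR evb by eventually_elim simp
  ultimately show "(\<lambda>k. B0 (n k) (\<beta> k) (R k)) \<longlonglongrightarrow> 18 * J 1 2" by (rule Lim_transform_eventually)
qed

text \<open>At frequency t / sqrt d the characteristic function is compared with that of a Gaussian
  having the exact normalized variance. The error is of order kappa_bound / d^(3/2), the variances
  converge, and Levy's continuity theorem concludes.\<close>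

lemma clt_of_estimates:
  fixes M :: "nat \<Rightarrow> real \<Rightarrow> real \<Rightarrow> 'w measure" and n :: "nat \<Rightarrow> nat" and d :: "nat \<Rightarrow> real \<Rightarrow> real \<Rightarrow> real"
  assumes ev: "edge_variables \<psi> M a"
    and good: "\<forall>\<^sub>F k in sequentially. 1 \<le> n k \<and> 0 < c k \<and> c k \<le> dimN (n k) \<and> 1 \<le> R k \<and> 0 < d (n k) (c k) (R k)"
    and v: "0 < v"
    and var: "(\<lambda>k. Cum2 (M (n k) (c k) (R k)) (X3 \<alpha> \<psi> a (n k) (c k) (R k)) / d (n k) (c k) (R k)) \<longlonglongrightarrow> v"
    and kappa_bound: "(\<lambda>k. kappa_bound (n k) (c k / dimN (n k)) (R k) / (sqrt (d (n k) (c k) (R k))) ^ 3) \<longlonglongrightarrow> 0"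
  shows "weak_conv_m (\<lambda>k. fluctuation_law d \<alpha> \<psi> M a (n k, c k, R k)) (centered_normal v)"
proof -
  define X where "X k = X3 \<alpha> \<psi> a (n k) (c k) (R k)" for k
  define \<mu> where "\<mu> k = M (n k) (c k) (R k)" for k
  define D where "D k = d (n k) (c k) (R k)" for k
  define \<kappa> where "\<kappa> k = kappa_bound (n k) (c k / dimN (n k)) (R k)" for k
  define m where "m k = prob_space.expectation (\<mu> k) (X k)" for k
  define law where "law k = distr (\<mu> k) borel (\<lambda>\<omega>. 1 / sqrt (D k) * (X k \<omega> - m k))" for k
  obtain m0 where m0: "\<And>k. m0 \<le> k \<Longrightarrow> 1 \<le> n k \<and> 0 < c k \<and> c k \<le> dimN (n k) \<and> 1 \<le> R k \<and> 0 < D k"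
    using good unfolding eventually_sequentially D_def by blast
  have est: "prob_space (\<mu> k)" "X k \<in> borel_measurable (\<mu> k)"
    "cmod ((\<integral>\<omega>. iexp (t * (X k \<omega> - m k)) \<partial>(\<mu> k))
      - of_real (exp (- (Cum2 (\<mu> k) (X k) * t\<^sup>2) / 2))) \<le> 36 * \<kappa> k * \<bar>t\<bar> ^ 3" if "m0 \<le> k" for k t
    using X3_estimates(1,2,4)[OF ev, of "n k" "c k" "R k"] m0[OF that]
    unfolding X_def \<mu>_def m_def \<kappa>_def by blast+
  have char_law: "char (law k) t = (\<integral>\<omega>. iexp (t / sqrt (D k) * (X k \<omega> - m k)) \<partial>(\<mu> k))" if "m0 \<le> k" for k t
    unfolding char_def law_def using est(2)[OF that]
    by (subst integral_distr) (auto simp: mult_ac)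
  have "weak_conv_m (\<lambda>k. law (k + m0)) (centered_normal v)"
  proof (rule levy_continuity)
    show "real_distribution (law (k + m0))" for k
      unfolding law_def using est(1,2)[of "k + m0"]
      by (intro prob_space.real_distribution_distr) auto
    show "real_distribution (centered_normal v)" by (rule char_centered_normal(1)[OF v])
    fix t
    have "(\<lambda>k. char (law k) t) \<longlonglongrightarrow> of_real (exp (- (v * t\<^sup>2) / 2))"
    proof -
      define g where "g k = (of_real (exp (- (Cum2 (\<mu> k) (X k) / D k * t\<^sup>2) / 2)) :: complex)" for k
      have "\<forall>\<^sub>F k in sequentially. cmod (char (law k) t - g k) \<le> \<kappa> k / (sqrt (D k)) ^ 3 * (36 * \<bar>t\<bar> ^ 3)"
        unfolding eventually_sequentially
      proof (intro exI[of _ m0] allI impI)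
        fix k assume k: "m0 \<le> k"
        have D: "0 < D k" using m0[OF k] by simp
        have "cmod (char (law k) t - of_real (exp (- (Cum2 (\<mu> k) (X k) * (t / sqrt (D k))\<^sup>2) / 2)))
            \<le> 36 * \<kappa> k * \<bar>t / sqrt (D k)\<bar> ^ 3"
          unfolding char_law[OF k] by (rule est(3)[OF k])
        moreover have "(t / sqrt (D k))\<^sup>2 = t\<^sup>2 / D k" using D by (simp add: power_divide)
        moreover have "\<bar>t / sqrt (D k)\<bar> ^ 3 = \<bar>t\<bar> ^ 3 / (sqrt (D k)) ^ 3"
          using D by (simp add: power_divide)
        ultimately show "cmod (char (law k) t - g k) \<le> \<kappa> k / (sqrt (D k)) ^ 3 * (36 * \<bar>t\<bar> ^ 3)"
          by (simp add: g_def mult_ac)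
      qed
      moreover have "(\<lambda>k. \<kappa> k / (sqrt (D k)) ^ 3 * (36 * \<bar>t\<bar> ^ 3)) \<longlonglongrightarrow> 0"
        using kappa_bound unfolding \<kappa>_def D_def by (rule tendsto_mult_left_zero)
      ultimately have "(\<lambda>k. char (law k) t - g k) \<longlonglongrightarrow> 0" by (rule Lim_null_comparison)
      moreover have "g \<longlonglongrightarrow> of_real (exp (- (v * t\<^sup>2) / 2))"
        unfolding g_def using var unfolding X_def \<mu>_def D_def by (intro tendsto_intros) auto
      ultimately show ?thesis
        using tendsto_add[of "\<lambda>k. char (law k) t - g k" 0 sequentially g] by simp
    qed
    then show "(\<lambda>k. char (law (k + m0)) t) \<longlonglongrightarrow> char (centered_normal v) t"
      unfolding char_centered_normal(2)[OF v] by (rule LIMSEQ_ignore_initial_segment)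
  qed
  then have "weak_conv_m law (centered_normal v)" by (rule weak_conv_m_offset)
  then show ?thesis
    by (simp add: fluctuation_law_def law_def[abs_def] \<mu>_def X_def D_def m_def)
qed

lemma variance_asymptotics:
  fixes M :: "nat \<Rightarrow> real \<Rightarrow> real \<Rightarrow> 'w measure" and n :: "nat \<Rightarrow> nat"
  assumes ev: "edge_variables \<psi> M a"
    and tr: "filterlim (\<lambda>k. (n k, c k, R k)) transition sequentially"
  obtains A B where "A \<longlonglongrightarrow> 6 * J 2 1" "B \<longlonglongrightarrow> 18 * J 1 2"
    "\<forall>\<^sub>F k in sequentially. 1 \<le> n k \<and> 0 < c k \<and> c k \<le> dimN (n k) \<and> 1 \<le> R k"
    "\<forall>\<^sub>F k in sequentially. Cum2 (M (n k) (c k) (R k)) (X3 \<alpha> \<psi> a (n k) (c k) (R k))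
       = c k ^ 3 * (R k)\<^sup>2 / (dimN (n k))\<^sup>2 * (A k + (c k)\<^sup>2 * R k / (dimN (n k))\<^sup>2 * B k)"
proof -
  let ?N = "\<lambda>k. dimN (n k)"
  have lims: "filterlim n at_top sequentially" "filterlim c at_top sequentially"
    "filterlim R at_top sequentially" "(\<lambda>k. R k / ?N k) \<longlonglongrightarrow> 0" "(\<lambda>k. c k / ?N k) \<longlonglongrightarrow> 0"
    using tr unfolding filterlim_transition by auto
  have "\<forall>\<^sub>F k in sequentially. c k / ?N k < 1" using lims(5) by (rule order_tendstoD) simp
  moreover have "\<forall>\<^sub>F k in sequentially. 1 \<le> n k" "\<forall>\<^sub>F k in sequentially. 0 < c k"
    "\<forall>\<^sub>F k in sequentially. 1 \<le> R k"
    using lims(1,3) lims(2)[unfolded filterlim_at_top_dense] by (auto simp: filterlim_at_top)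
  ultimately have good: "\<forall>\<^sub>F k in sequentially. 1 \<le> n k \<and> 0 < c k \<and> c k \<le> ?N k \<and> 1 \<le> R k"
    by eventually_elim (simp add: divide_less_eq)
  let ?Prop = "\<lambda>k A. Cum2 (M (n k) (c k) (R k)) (X3 \<alpha> \<psi> a (n k) (c k) (R k))
      = (c k / ?N k) ^ 3 * ?N k * (R k)\<^sup>2 * (A + (c k / ?N k)\<^sup>2 * R k * B0 (n k) (c k / ?N k) (R k))
      \<and> \<bar>A - A0 (n k) (R k)\<bar> \<le> 4 * (c k / ?N k) * A0 (n k) (R k)"
  \<comment> \<open>For indices at which the parameters are not yet admissible this choice is
    arbitrary.\<close>
  define A where "A k = (SOME A. ?Prop k A)" for k
  define B where "B k = B0 (n k) (c k / ?N k) (R k)" for k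
  have A: "\<forall>\<^sub>F k in sequentially. ?Prop k (A k)"
    using good
  proof eventually_elim
    case (elim k)
    then have "\<exists>A. ?Prop k A" by (intro X3_estimates(3)[OF ev]) auto
    then show ?case unfolding A_def by (rule someI_ex)
  qed
  note A0 = A0_B0_tendsto(1)[OF lims(1,3,4)]
  have "(\<lambda>k. A k - A0 (n k) (R k)) \<longlonglongrightarrow> 0"
  proof (rule Lim_null_comparison)
    show "\<forall>\<^sub>F k in sequentially. norm (A k - A0 (n k) (R k)) \<le> 4 * (c k / ?N k) * A0 (n k) (R k)"
      using A by eventually_elim simp
    have "(\<lambda>k. 4 * (c k / ?N k) * A0 (n k) (R k)) \<longlonglongrightarrow> 4 * 0 * (6 * J 2 1)"
      by (intro tendsto_mult tendsto_const lims(5) A0)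
    then show "(\<lambda>k. 4 * (c k / ?N k) * A0 (n k) (R k)) \<longlonglongrightarrow> 0" by simp
  qed
  from tendsto_add[OF this A0] have "A \<longlonglongrightarrow> 6 * J 2 1" by simp
  moreover have "B \<longlonglongrightarrow> 18 * J 1 2"
    unfolding B_def
  proof (rule A0_B0_tendsto(2)[OF lims(1,3,4,5)])
    show "\<forall>\<^sub>F k in sequentially. 0 \<le> c k / ?N k" using good by eventually_elim simp
  qed
  moreover have "\<forall>\<^sub>F k in sequentially. Cum2 (M (n k) (c k) (R k)) (X3 \<alpha> \<psi> a (n k) (c k) (R k))
       = c k ^ 3 * (R k)\<^sup>2 / (?N k)\<^sup>2 * (A k + (c k)\<^sup>2 * R k / (?N k)\<^sup>2 * B k)"
    using A
  proof eventually_elim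
    case (elim k)
    have N: "0 < ?N k" by simp
    have "(c k / ?N k) ^ 3 * ?N k * (R k)\<^sup>2 = c k ^ 3 * (R k)\<^sup>2 / (?N k)\<^sup>2"
      using N by (simp only: power_divide) (simp add: power2_eq_square power3_eq_cube)
    moreover have "(c k / ?N k)\<^sup>2 * R k = (c k)\<^sup>2 * R k / (?N k)\<^sup>2" by (simp add: power_divide)
    ultimately show ?case using elim by (simp only: B_def)
  qed
  ultimately show ?thesis using good that by blast
qed

lemma kappa_bound_eq:
  "kappa_bound n (c / dimN n) R = 648 * (64 + HI) ^ 3 * (c ^ 3 * R\<^sup>2 / (dimN n)\<^sup>2)
     * (1 + (64 + HI)\<^sup>2 * (c\<^sup>2 * R / (dimN n)\<^sup>2) + (64 + HI) ^ 4 * (c\<^sup>2 * R / (dimN n)\<^sup>2)\<^sup>2)"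
proof -
  have N: "0 < dimN n" by simp
  have "(c / dimN n) ^ 3 * dimN n * R\<^sup>2 = c ^ 3 * R\<^sup>2 / (dimN n)\<^sup>2"
    using N by (simp only: power_divide) (simp add: power2_eq_square power3_eq_cube)
  moreover have "(c / dimN n)\<^sup>2 * R = c\<^sup>2 * R / (dimN n)\<^sup>2" by (simp add: power_divide)
  ultimately show ?thesis by (simp only: kappa_bound_def)
qed

lemma variance_scale:
  fixes M :: "'w measure" and X :: "'w \<Rightarrow> real"
  shows "prob_space.variance M (\<lambda>\<omega>. r * X \<omega>) = r\<^sup>2 * prob_space.variance M X"
  by (simp add: right_diff_distrib[symmetric] power_mult_distrib)

lemma kappa_bound_ratio:
  fixes n :: nat
  assumes "0 < c" "0 < R"
  defines "y \<equiv> c * R" and "\<rho> \<equiv> c\<^sup>2 * R / (dimN n)\<^sup>2"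
  shows "kappa_bound n (c / dimN n) R / (sqrt (y * \<rho> ^ j)) ^ 3 = 648 * (64 + HI) ^ 3 * (y * \<rho> / (y * \<rho> ^ j))
     * (1 + (64 + HI)\<^sup>2 * \<rho> + (64 + HI) ^ 4 * \<rho>\<^sup>2) / sqrt (y * \<rho> ^ j)"
proof -
  have pos: "0 \<le> y * \<rho> ^ j" using assms by (simp add: y_def \<rho>_def)
  have "c ^ 3 * R\<^sup>2 / (dimN n)\<^sup>2 = y * \<rho>"
    by (simp add: y_def \<rho>_def power2_eq_square power3_eq_cube)
  then have kappa_bound: "kappa_bound n (c / dimN n) R = 648 * (64 + HI) ^ 3 * (y * \<rho>)
     * (1 + (64 + HI)\<^sup>2 * \<rho> + (64 + HI) ^ 4 * \<rho>\<^sup>2)"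
    unfolding kappa_bound_eq by (simp only: \<rho>_def)
  have "(sqrt (y * \<rho> ^ j)) ^ 3 = (y * \<rho> ^ j) * sqrt (y * \<rho> ^ j)"
    using pos by (simp add: power3_eq_cube)
  then show ?thesis unfolding kappa_bound by simp
qed

end

locale edge_model = profile +
  fixes M :: "nat \<Rightarrow> real \<Rightarrow> real \<Rightarrow> 'w measure" and a :: "nat \<Rightarrow> real \<Rightarrow> real \<Rightarrow> int \<Rightarrow> int \<Rightarrow> 'w \<Rightarrow> real"
  assumes model: "edge_variables \<psi> M a"
begin

definition Var :: "nat \<Rightarrow> real \<Rightarrow> real \<Rightarrow> real" where
  "Var n c R = Cum2 (M n c R) (X3 \<alpha> \<psi> a n c R)"

text \<open>
  With \<open>y = c R\<close> and \<open>\<rho> = c\<^sup>2 R / N\<^sup>2\<close> the three normalizations are \<open>y \<rho>\<^sup>j\<close> for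
  \<open>j = 2, 0, 1\<close>, and the variance is \<open>y \<rho> (A + \<rho> B)\<close>.
\<close>

lemma normalized_limits:
  fixes n :: "nat \<Rightarrow> nat" and c R :: "nat \<Rightarrow> real"
  defines "y \<equiv> \<lambda>k. c k * R k" and "\<rho> \<equiv> \<lambda>k. (c k)\<^sup>2 * R k / (dimN (n k))\<^sup>2"
  assumes tr: "filterlim (\<lambda>k. (n k, c k, R k)) transition sequentially"
    and d: "\<And>k. d (n k) (c k) (R k) = y k * \<rho> k ^ j"
    and u: "(\<lambda>k. \<rho> k / \<rho> k ^ j) \<longlonglongrightarrow> u0" "(\<lambda>k. \<rho> k * \<rho> k / \<rho> k ^ j) \<longlonglongrightarrow> u1"
    and g: "\<And>k. g k = 1 / sqrt (y k * \<rho> k ^ j)"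
    and v: "v = 6 * J 2 1 * u0 + 18 * J 1 2 * u1"
  shows "(\<lambda>k. Var (n k) (c k) (R k) / d (n k) (c k) (R k)) \<longlonglongrightarrow> v"
    and "0 < v \<Longrightarrow> (\<lambda>k. \<rho> k * \<rho> k * \<rho> k / \<rho> k ^ j * g k) \<longlonglongrightarrow> 0 \<Longrightarrow> (\<lambda>k. \<rho> k / \<rho> k ^ j * g k) \<longlonglongrightarrow> 0
      \<Longrightarrow> (\<lambda>k. \<rho> k * \<rho> k / \<rho> k ^ j * g k) \<longlonglongrightarrow> 0
      \<Longrightarrow> weak_conv_m (\<lambda>k. fluctuation_law d \<alpha> \<psi> M a (n k, c k, R k)) (centered_normal v)"
proof -
  obtain A B where A: "A \<longlonglongrightarrow> 6 * J 2 1" and B: "B \<longlonglongrightarrow> 18 * J 1 2"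
    and good: "\<forall>\<^sub>F k in sequentially. 1 \<le> n k \<and> 0 < c k \<and> c k \<le> dimN (n k) \<and> 1 \<le> R k"
    and var: "\<forall>\<^sub>F k in sequentially. Cum2 (M (n k) (c k) (R k)) (X3 \<alpha> \<psi> a (n k) (c k) (R k))
       = c k ^ 3 * (R k)\<^sup>2 / (dimN (n k))\<^sup>2 * (A k + (c k)\<^sup>2 * R k / (dimN (n k))\<^sup>2 * B k)"
    by (rule variance_asymptotics[OF model tr])
  have pos: "\<forall>\<^sub>F k in sequentially. 0 < y k \<and> 0 < \<rho> k"
    using good by eventually_elim (simp add: y_def \<rho>_def)
  \<comment> \<open>Normalization leaves \<open>A\<close> with weight \<rho>^(1 - j) and
    \<open>B\<close> with weight \<rho>^(2 - j), whose limits are \<open>u0\<close> and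
    \<open>u1\<close>. They are written as quotients because the exponents may be negative.\<close>
  have "(\<lambda>k. A k * (\<rho> k / \<rho> k ^ j) + B k * (\<rho> k * \<rho> k / \<rho> k ^ j)) \<longlonglongrightarrow> v"
    unfolding v by (intro tendsto_intros A B u)
  moreover have "\<forall>\<^sub>F k in sequentially. A k * (\<rho> k / \<rho> k ^ j) + B k * (\<rho> k * \<rho> k / \<rho> k ^ j)
      = Var (n k) (c k) (R k) / d (n k) (c k) (R k)"
    using var pos
  proof eventually_elim
    case (elim k)
    have "c k ^ 3 * (R k)\<^sup>2 / (dimN (n k))\<^sup>2 = y k * \<rho> k"
      by (simp add: y_def \<rho>_def power2_eq_square power3_eq_cube)
    then have "Var (n k) (c k) (R k) = y k * \<rho> k * (A k + \<rho> k * B k)"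
      using elim(1) unfolding Var_def by (simp only: \<rho>_def)
    then show ?case using elim(2) by (simp add: d field_simps)
  qed
  ultimately show var_lim: "(\<lambda>k. Var (n k) (c k) (R k) / d (n k) (c k) (R k)) \<longlonglongrightarrow> v"
    by (rule Lim_transform_eventually)
  assume v0: "0 < v" and e: "(\<lambda>k. \<rho> k * \<rho> k * \<rho> k / \<rho> k ^ j * g k) \<longlonglongrightarrow> 0"
      "(\<lambda>k. \<rho> k / \<rho> k ^ j * g k) \<longlonglongrightarrow> 0" "(\<lambda>k. \<rho> k * \<rho> k / \<rho> k ^ j * g k) \<longlonglongrightarrow> 0"
  show "weak_conv_m (\<lambda>k. fluctuation_law d \<alpha> \<psi> M a (n k, c k, R k)) (centered_normal v)"
  proof (rule clt_of_estimates[OF model _ v0])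
    show "\<forall>\<^sub>F k in sequentially. 1 \<le> n k \<and> 0 < c k \<and> c k \<le> dimN (n k) \<and> 1 \<le> R k \<and> 0 < d (n k) (c k) (R k)"
      using good pos by eventually_elim (simp add: d)
    show "(\<lambda>k. Cum2 (M (n k) (c k) (R k)) (X3 \<alpha> \<psi> a (n k) (c k) (R k)) / d (n k) (c k) (R k)) \<longlonglongrightarrow> v"
      using var_lim by (simp only: Var_def)
    let ?K = "64 + HI"
    \<comment> \<open>The terms 1, \<rho> and \<rho>^2 of the third-order bound are each controlled
      by \<open>g\<close>, the inverse square root of the normalization.\<close>
    have "(\<lambda>k. 648 * ?K ^ 3 * (\<rho> k / \<rho> k ^ j * g k + ?K\<^sup>2 * (\<rho> k * \<rho> k / \<rho> k ^ j * g k)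
        + ?K ^ 4 * (\<rho> k * \<rho> k * \<rho> k / \<rho> k ^ j * g k))) \<longlonglongrightarrow> 648 * ?K ^ 3 * (0 + ?K\<^sup>2 * 0 + ?K ^ 4 * 0)"
      by (intro tendsto_intros e)
    moreover have "\<forall>\<^sub>F k in sequentially. 648 * ?K ^ 3 * (\<rho> k / \<rho> k ^ j * g k + ?K\<^sup>2 * (\<rho> k * \<rho> k / \<rho> k ^ j * g k)
        + ?K ^ 4 * (\<rho> k * \<rho> k * \<rho> k / \<rho> k ^ j * g k))
        = kappa_bound (n k) (c k / dimN (n k)) (R k) / (sqrt (d (n k) (c k) (R k))) ^ 3"
      using good pos
    proof eventually_elim
      case (elim k)
      have "kappa_bound (n k) (c k / dimN (n k)) (R k) / (sqrt (d (n k) (c k) (R k))) ^ 3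
          = 648 * ?K ^ 3 * (y k * \<rho> k / (y k * \<rho> k ^ j)) * (1 + ?K\<^sup>2 * \<rho> k + ?K ^ 4 * (\<rho> k)\<^sup>2) * g k"
        using kappa_bound_ratio[of "c k" "R k" "n k" j] elim unfolding d g by (simp add: y_def \<rho>_def)
      also have "y k * \<rho> k / (y k * \<rho> k ^ j) = \<rho> k / \<rho> k ^ j" using elim by simp
      also have "648 * ?K ^ 3 * (\<rho> k / \<rho> k ^ j) * (1 + ?K\<^sup>2 * \<rho> k + ?K ^ 4 * (\<rho> k)\<^sup>2) * g k
          = 648 * ?K ^ 3 * (\<rho> k / \<rho> k ^ j * g k + ?K\<^sup>2 * (\<rho> k * \<rho> k / \<rho> k ^ j * g k)
        + ?K ^ 4 * (\<rho> k * \<rho> k * \<rho> k / \<rho> k ^ j * g k))"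
        by (simp add: algebra_simps power2_eq_square)
      finally show ?case ..
    qed
    ultimately show "(\<lambda>k. kappa_bound (n k) (c k / dimN (n k)) (R k) / (sqrt (d (n k) (c k) (R k))) ^ 3) \<longlonglongrightarrow> 0"
      by (simp add: Lim_transform_eventually)
  qed
qed

text \<open>With j = 2 the coefficient \<open>A\<close> has weight 1/\<rho> and disappears, while
  \<open>B\<close> has weight 1. The largest error term is \<rho> g = (c R)^(-1/2).\<close>

lemma regime_i_limits:
  assumes p: "filterlim p regime_i sequentially"
  defines "d \<equiv> \<lambda>n c R. c ^ 5 * R ^ 3 / dimN n ^ 4"
  shows "(\<lambda>k. (\<lambda>(n, c, R). Var n c R / d n c R) (p k)) \<longlonglongrightarrow> 18 * J 1 2"
    and "weak_conv_m (\<lambda>k. fluctuation_law d \<alpha> \<psi> M a (p k)) (centered_normal (18 * J 1 2))"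
proof -
  define n where "n k = fst (p k)" for k
  define c where "c k = fst (snd (p k))" for k
  define R where "R k = snd (snd (p k))" for k
  have p_eq: "p = (\<lambda>k. (n k, c k, R k))" by (simp add: n_def c_def R_def)
  define y where "y k = c k * R k" for k
  define \<rho> where "\<rho> k = (c k)\<^sup>2 * R k / (dimN (n k))\<^sup>2" for k
  define g where "g k = 1 / sqrt (y k * \<rho> k ^ 2)" for k
  have tr: "filterlim (\<lambda>k. (n k, c k, R k)) transition sequentially"
    using p unfolding p_eq regime_i_def filterlim_inf by simp
  have \<rho>: "filterlim \<rho> at_top sequentially"
    using p unfolding p_eq regime_i_def filterlim_inf filterlim_filtercomap_iff by (simp add: o_def \<rho>_def[abs_def])
  have cR: "filterlim c at_top sequentially" "filterlim R at_top sequentially"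
    using tr unfolding filterlim_transition by auto
  have y: "filterlim y at_top sequentially"
    unfolding y_def using cR by (rule filterlim_at_top_mult_at_top)
  have "filterlim (\<lambda>k. sqrt (y k)) at_top sequentially"
    using y by (rule filterlim_compose[OF sqrt_at_top])
  then have isy: "(\<lambda>k. 1 / sqrt (y k)) \<longlonglongrightarrow> 0"
    using tendsto_inverse_0_at_top by (simp add: inverse_eq_divide)
  have i\<rho>: "(\<lambda>k. 1 / \<rho> k) \<longlonglongrightarrow> 0"
    using tendsto_inverse_0_at_top[OF \<rho>] by (simp add: inverse_eq_divide)
  have pos: "\<forall>\<^sub>F k in sequentially. 0 < \<rho> k" using \<rho> unfolding filterlim_at_top_dense by blast
  have g: "g k = 1 / \<rho> k * (1 / sqrt (y k))" if "0 < \<rho> k" for k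
    using that by (simp add: g_def real_sqrt_mult)
  note lim = Lim_transform_eventually
  have u0: "(\<lambda>k. \<rho> k / \<rho> k ^ 2) \<longlonglongrightarrow> 0"
    by (rule lim[OF i\<rho>]) (simp add: power2_eq_square)
  have u1: "(\<lambda>k. \<rho> k * \<rho> k / \<rho> k ^ 2) \<longlonglongrightarrow> 1"
    by (rule lim[OF tendsto_const]) (use pos in \<open>eventually_elim, simp add: power2_eq_square\<close>)
  have e1: "(\<lambda>k. \<rho> k * \<rho> k * \<rho> k / \<rho> k ^ 2 * g k) \<longlonglongrightarrow> 0"
    by (rule lim[OF isy]) (use pos in \<open>eventually_elim, simp add: power2_eq_square g\<close>)
  have "(\<lambda>k. 1 / \<rho> k * (1 / sqrt (y k))) \<longlonglongrightarrow> 0 * 0" by (intro tendsto_mult i\<rho> isy)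
  then have gl: "g \<longlonglongrightarrow> 0"
    by (simp only: mult_zero_left) (rule lim, assumption, use pos in \<open>eventually_elim, simp add: g\<close>)
  have e2: "(\<lambda>k. \<rho> k / \<rho> k ^ 2 * g k) \<longlonglongrightarrow> 0"
    using tendsto_mult[OF u0 gl] by simp
  have e3: "(\<lambda>k. \<rho> k * \<rho> k / \<rho> k ^ 2 * g k) \<longlonglongrightarrow> 0"
    using tendsto_mult[OF u1 gl] by simp
  have dj: "d (n k) (c k) (R k) = c k * R k * ((c k)\<^sup>2 * R k / (dimN (n k))\<^sup>2) ^ 2" for k
    by (simp add: d_def power_mult_distrib power_divide) (simp add: eval_nat_numeral)
  note N = normalized_limits[OF tr dj, folded \<rho>_def y_def, OF u0 u1 g_def, of "18 * J 1 2"]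
  show "(\<lambda>k. (\<lambda>(n, c, R). Var n c R / d n c R) (p k)) \<longlonglongrightarrow> 18 * J 1 2"
    unfolding p_eq using N(1) by simp
  show "weak_conv_m (\<lambda>k. fluctuation_law d \<alpha> \<psi> M a (p k)) (centered_normal (18 * J 1 2))"
    unfolding p_eq using N(2)[OF _ _ e1 e2 e3] J_pos[of 1 2] by simp
qed

text \<open>With j = 0 the weights of \<open>A\<close> and \<open>B\<close> are s and s^2, and the
  error is of order (c R)^(-1/2).\<close>

lemma regime_ii_limits:
  assumes p: "filterlim p (regime_ii s) sequentially" and s: "0 < s"
  defines "d \<equiv> \<lambda>(n::nat) c R :: real. c * R"
  shows "(\<lambda>k. (\<lambda>(n, c, R). Var n c R / d n c R) (p k)) \<longlonglongrightarrow> 6 * J 2 1 * s + 18 * J 1 2 * (s * s)"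
    and "weak_conv_m (\<lambda>k. fluctuation_law d \<alpha> \<psi> M a (p k)) (centered_normal (6 * J 2 1 * s + 18 * J 1 2 * (s * s)))"
proof -
  define n where "n k = fst (p k)" for k
  define c where "c k = fst (snd (p k))" for k
  define R where "R k = snd (snd (p k))" for k
  have p_eq: "p = (\<lambda>k. (n k, c k, R k))" by (simp add: n_def c_def R_def)
  define y where "y k = c k * R k" for k
  define \<rho> where "\<rho> k = (c k)\<^sup>2 * R k / (dimN (n k))\<^sup>2" for k
  define g where "g k = 1 / sqrt (y k * \<rho> k ^ 0)" for k
  have tr: "filterlim (\<lambda>k. (n k, c k, R k)) transition sequentially"
    using p unfolding p_eq regime_ii_def filterlim_inf by simp
  have "\<forall>\<^sub>F k in sequentially. (c k)\<^sup>2 * R k = s * (dimN (n k))\<^sup>2"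
    using p unfolding p_eq regime_ii_def filterlim_inf filterlim_principal by simp
  then have \<rho>: "\<forall>\<^sub>F k in sequentially. s = \<rho> k"
    by eventually_elim (simp add: \<rho>_def)
  have cR: "filterlim c at_top sequentially" "filterlim R at_top sequentially"
    using tr unfolding filterlim_transition by auto
  have y: "filterlim y at_top sequentially"
    unfolding y_def using cR by (rule filterlim_at_top_mult_at_top)
  have "filterlim (\<lambda>k. sqrt (y k)) at_top sequentially"
    using y by (rule filterlim_compose[OF sqrt_at_top])
  then have gl: "g \<longlonglongrightarrow> 0"
    unfolding g_def using tendsto_inverse_0_at_top by (simp add: inverse_eq_divide)
  have \<rho>l: "\<rho> \<longlonglongrightarrow> s" using tendsto_const \<rho> by (rule Lim_transform_eventually)
  have u0: "(\<lambda>k. \<rho> k / \<rho> k ^ 0) \<longlonglongrightarrow> s" using \<rho>l by simp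
  have u1: "(\<lambda>k. \<rho> k * \<rho> k / \<rho> k ^ 0) \<longlonglongrightarrow> s * s" using tendsto_mult[OF \<rho>l \<rho>l] by simp
  have e1: "(\<lambda>k. \<rho> k * \<rho> k * \<rho> k / \<rho> k ^ 0 * g k) \<longlonglongrightarrow> 0"
    using tendsto_mult[OF tendsto_mult[OF tendsto_mult[OF \<rho>l \<rho>l] \<rho>l] gl] by simp
  have e2: "(\<lambda>k. \<rho> k / \<rho> k ^ 0 * g k) \<longlonglongrightarrow> 0" using tendsto_mult[OF u0 gl] by simp
  have e3: "(\<lambda>k. \<rho> k * \<rho> k / \<rho> k ^ 0 * g k) \<longlonglongrightarrow> 0" using tendsto_mult[OF u1 gl] by simp
  have dj: "d (n k) (c k) (R k) = c k * R k * ((c k)\<^sup>2 * R k / (dimN (n k))\<^sup>2) ^ 0" for k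
    by (simp add: d_def)
  note N = normalized_limits[OF tr dj, folded \<rho>_def y_def, OF u0 u1 g_def refl]
  show "(\<lambda>k. (\<lambda>(n, c, R). Var n c R / d n c R) (p k)) \<longlonglongrightarrow> 6 * J 2 1 * s + 18 * J 1 2 * (s * s)"
    unfolding p_eq using N(1) by simp
  show "weak_conv_m (\<lambda>k. fluctuation_law d \<alpha> \<psi> M a (p k)) (centered_normal (6 * J 2 1 * s + 18 * J 1 2 * (s * s)))"
    unfolding p_eq using N(2)[OF _ e1 e2 e3] J_pos[of 1 2] J_pos[of 2 1] s by (simp add: add_pos_pos)
qed

text \<open>With j = 1 only \<open>A\<close> survives. Here \<open>g\<close> is the square root of
  N^2 / (c^3 R^2), so the extra condition of the limit theorem is exactly that the error vanishes;
  the variance converges without it.\<close>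

lemma regime_iii_limits:
  assumes p: "filterlim p regime_iii sequentially"
  defines "d \<equiv> \<lambda>n c R. c ^ 3 * R\<^sup>2 / (dimN n)\<^sup>2"
  shows "(\<lambda>k. (\<lambda>(n, c, R). Var n c R / d n c R) (p k)) \<longlonglongrightarrow> 6 * J 2 1"
    and "filterlim p regime_iii_clt sequentially \<Longrightarrow>
      weak_conv_m (\<lambda>k. fluctuation_law d \<alpha> \<psi> M a (p k)) (centered_normal (6 * J 2 1))"
proof -
  define n where "n k = fst (p k)" for k
  define c where "c k = fst (snd (p k))" for k
  define R where "R k = snd (snd (p k))" for k
  have p_eq: "p = (\<lambda>k. (n k, c k, R k))" by (simp add: n_def c_def R_def)
  define y where "y k = c k * R k" for k
  define \<rho> where "\<rho> k = (c k)\<^sup>2 * R k / (dimN (n k))\<^sup>2" for k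
  define g where "g k = 1 / sqrt (y k * \<rho> k ^ 1)" for k
  have tr: "filterlim (\<lambda>k. (n k, c k, R k)) transition sequentially"
    using p unfolding p_eq regime_iii_def filterlim_inf by simp
  have \<rho>: "\<rho> \<longlonglongrightarrow> 0"
    using p unfolding p_eq regime_iii_def filterlim_inf filterlim_filtercomap_iff by (simp add: o_def \<rho>_def[abs_def])
  have cR: "filterlim c at_top sequentially" "filterlim R at_top sequentially"
    using tr unfolding filterlim_transition by auto
  have "\<forall>\<^sub>F k in sequentially. 0 < c k" "\<forall>\<^sub>F k in sequentially. 0 < R k"
    using cR unfolding filterlim_at_top_dense by blast+
  then have pos: "\<forall>\<^sub>F k in sequentially. 0 < \<rho> k"
    by eventually_elim (simp add: \<rho>_def)
  have u0: "(\<lambda>k. \<rho> k / \<rho> k ^ 1) \<longlonglongrightarrow> 1"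
    by (rule Lim_transform_eventually[OF tendsto_const]) (use pos in \<open>eventually_elim, simp\<close>)
  have u1: "(\<lambda>k. \<rho> k * \<rho> k / \<rho> k ^ 1) \<longlonglongrightarrow> 0"
    by (rule Lim_transform_eventually[OF \<rho>]) (use pos in \<open>eventually_elim, simp\<close>)
  have dy: "d (n k) (c k) (R k) = y k * \<rho> k" for k
    by (simp add: d_def y_def \<rho>_def power2_eq_square power3_eq_cube)
  have dj: "d (n k) (c k) (R k) = c k * R k * ((c k)\<^sup>2 * R k / (dimN (n k))\<^sup>2) ^ 1" for k
    using dy by (simp add: y_def \<rho>_def)
  note N = normalized_limits[OF tr dj, folded \<rho>_def y_def, OF u0 u1 g_def, of "6 * J 2 1"]
  show "(\<lambda>k. (\<lambda>(n, c, R). Var n c R / d n c R) (p k)) \<longlonglongrightarrow> 6 * J 2 1"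
    unfolding p_eq using N(1) by simp
  assume "filterlim p regime_iii_clt sequentially"
  then have "(\<lambda>k. (dimN (n k))\<^sup>2 / (c k ^ 3 * (R k)\<^sup>2)) \<longlonglongrightarrow> 0"
    unfolding p_eq regime_iii_clt_def filterlim_inf filterlim_filtercomap_iff by (simp add: o_def)
  then have "(\<lambda>k. sqrt ((dimN (n k))\<^sup>2 / (c k ^ 3 * (R k)\<^sup>2))) \<longlonglongrightarrow> sqrt 0" by (rule tendsto_real_sqrt)
  moreover have "sqrt ((dimN (n k))\<^sup>2 / (c k ^ 3 * (R k)\<^sup>2)) = g k" for k
  proof -
    have "(dimN (n k))\<^sup>2 / (c k ^ 3 * (R k)\<^sup>2) = 1 / (y k * \<rho> k)"
      unfolding dy[symmetric] d_def by simp
    then show ?thesis by (simp add: g_def real_sqrt_divide del: real_sqrt_mult)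
  qed
  ultimately have gl: "g \<longlonglongrightarrow> 0" by simp
  have e1: "(\<lambda>k. \<rho> k * \<rho> k * \<rho> k / \<rho> k ^ 1 * g k) \<longlonglongrightarrow> 0"
    using tendsto_mult[OF tendsto_mult[OF \<rho> u1] gl]
    by (simp only: mult_zero_left times_divide_eq_right mult.assoc)
  have e2: "(\<lambda>k. \<rho> k / \<rho> k ^ 1 * g k) \<longlonglongrightarrow> 0" using tendsto_mult[OF u0 gl] by simp
  have e3: "(\<lambda>k. \<rho> k * \<rho> k / \<rho> k ^ 1 * g k) \<longlonglongrightarrow> 0" using tendsto_mult[OF u1 gl] by simp
  show "weak_conv_m (\<lambda>k. fluctuation_law d \<alpha> \<psi> M a (p k)) (centered_normal (6 * J 2 1))"
    unfolding p_eq using N(2)[OF _ _ e1 e2 e3] J_pos[of 2 1] by simp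
qed

text \<open>A limit determines \<open>Lim\<close> only along a proper filter. In the theorem the
  given sequence shows that the filter is proper.\<close>

lemma Theta2_i_eq:
  assumes "regime_i \<noteq> bot"
  shows "Theta2_i \<alpha> \<psi> M a = 18 * J 1 2"
  unfolding Theta2_i_def
proof (intro tendsto_Lim assms tendsto_regime_i)
  fix p :: "nat \<Rightarrow> nat \<times> real \<times> real" assume p: "filterlim p regime_i sequentially"
  have "1 / (c * R) * Cum2 (M n c R) (\<lambda>\<omega>. (dimN n)\<^sup>2 / (c\<^sup>2 * R) * X3 \<alpha> \<psi> a n c R \<omega>)
      = Var n c R / (c ^ 5 * R ^ 3 / dimN n ^ 4)" for n c R
  proof -
    \<comment> \<open>The scaling of the trace contributes N^4 / (c^4 R^2) to the variance, which
      turns 1 / (c R) into the inverse of the normalization.\<close>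
    have "1 / (c * R) * ((N\<^sup>2 / (c\<^sup>2 * R))\<^sup>2 * v) = v / (c ^ 5 * R ^ 3 / N ^ 4)" for N v :: real
      by (cases "c = 0 \<or> R = 0") (auto simp: power_divide power_mult_distrib, simp add: eval_nat_numeral mult_ac)
    then show ?thesis unfolding variance_scale Var_def .
  qed
  then show "(\<lambda>k. case p k of (n, c, R) \<Rightarrow> 1 / (c * R) * Cum2 (M n c R)
      (\<lambda>\<omega>. (dimN n)\<^sup>2 / (c\<^sup>2 * R) * X3 \<alpha> \<psi> a n c R \<omega>)) \<longlonglongrightarrow> 18 * J 1 2"
    using regime_i_limits(1)[OF p] by simp
qed

lemma Theta2_ii_eq:
  assumes "regime_ii s \<noteq> bot" "0 < s"
  shows "Theta2_ii \<alpha> \<psi> M a s = 6 * J 2 1 * s + 18 * J 1 2 * (s * s)"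
  unfolding Theta2_ii_def
  by (intro tendsto_Lim assms tendsto_regime_ii) (use regime_ii_limits(1)[OF _ assms(2)] in \<open>simp add: Var_def\<close>)

lemma Theta2_iii_eq:
  assumes "regime_iii \<noteq> bot"
  shows "Theta2_iii \<alpha> \<psi> M a = 6 * J 2 1"
  unfolding Theta2_iii_def
  by (intro tendsto_Lim assms tendsto_regime_iii) (use regime_iii_limits(1) in \<open>simp add: Var_def mult.commute\<close>)

end

lemma filterlim_sequentially_not_bot: "filterlim p F (sequentially :: nat filter) \<Longrightarrow> F \<noteq> bot"
  by (auto simp: filterlim_iff dest!: spec[of _ "\<lambda>_. False"])

text \<open>Each regime is a filter with a countable base, so convergence along all sequences of
  triples tending to it expresses convergence along the regime.\<close>

theorem theorem6p2:
  fixes \<psi> :: "real \<Rightarrow> real"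
    and \<alpha> :: nat
    and M :: "nat \<Rightarrow> real \<Rightarrow> real \<Rightarrow> 'w measure"
    and a :: "nat \<Rightarrow> real \<Rightarrow> real \<Rightarrow> int \<Rightarrow> int \<Rightarrow> 'w \<Rightarrow> real"
  assumes "\<forall>x. \<psi> (- x) = \<psi> x"
    and "continuous_on UNIV \<psi>"
    and "\<forall>x. 0 < \<psi> x"
    and "mono_on {0..} \<psi>"
    and "integrable lborel (\<lambda>t. exp (- (\<psi> t)\<^sup>2))"
    and "\<forall>m::nat. integrable lborel (\<lambda>s. (1 + (\<psi> s)\<^sup>2) ^ m * exp (- (\<psi> s)\<^sup>2))"
    and "\<alpha> \<in> {0, 1}"
    and "edge_variables \<psi> M a"
  shows "(\<forall>p :: nat \<Rightarrow> nat \<times> real \<times> real. filterlim p regime_i sequentially \<longrightarrow>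
            weak_conv_m
              (\<lambda>k. fluctuation_law (\<lambda>n c R. c ^ 5 * R ^ 3 / dimN n ^ 4) \<alpha> \<psi> M a (p k))
              (centered_normal (Theta2_i \<alpha> \<psi> M a)))
       \<and> (\<forall>s > 0. \<forall>p :: nat \<Rightarrow> nat \<times> real \<times> real. filterlim p (regime_ii s) sequentially \<longrightarrow>
            weak_conv_m
              (\<lambda>k. fluctuation_law (\<lambda>n c R. c * R) \<alpha> \<psi> M a (p k))
              (centered_normal (Theta2_ii \<alpha> \<psi> M a s)))
       \<and> (\<forall>p :: nat \<Rightarrow> nat \<times> real \<times> real. filterlim p regime_iii_clt sequentially \<longrightarrow>
            weak_conv_m
              (\<lambda>k. fluctuation_law (\<lambda>n c R. c ^ 3 * R\<^sup>2 / (dimN n)\<^sup>2) \<alpha> \<psi> M a (p k))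
              (centered_normal (Theta2_iii \<alpha> \<psi> M a)))"
proof -
  interpret edge_model \<psi> \<alpha> M a
    using assms by unfold_locales auto
  \<comment> \<open>\<open>Theta2_iii\<close> is a limit along \<open>regime_iii\<close>, without
    the additional condition, so the sequence has to be viewed there.\<close>
  have iii: "filterlim p regime_iii sequentially" if "filterlim p regime_iii_clt sequentially"
    for p :: "nat \<Rightarrow> nat \<times> real \<times> real"
    using that by (simp add: regime_iii_clt_def filterlim_inf)
  show ?thesis
  proof (intro conjI allI impI)
    fix p :: "nat \<Rightarrow> nat \<times> real \<times> real" assume p: "filterlim p regime_i sequentially"
    show "weak_conv_m (\<lambda>k. fluctuation_law (\<lambda>n c R. c ^ 5 * R ^ 3 / dimN n ^ 4) \<alpha> \<psi> M a (p k))
        (centered_normal (Theta2_i \<alpha> \<psi> M a))"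
      unfolding Theta2_i_eq[OF filterlim_sequentially_not_bot[OF p]] by (rule regime_i_limits(2)[OF p])
  next
    fix s :: real and p :: "nat \<Rightarrow> nat \<times> real \<times> real"
    assume s: "0 < s" and p: "filterlim p (regime_ii s) sequentially"
    show "weak_conv_m (\<lambda>k. fluctuation_law (\<lambda>n c R. c * R) \<alpha> \<psi> M a (p k))
        (centered_normal (Theta2_ii \<alpha> \<psi> M a s))"
      unfolding Theta2_ii_eq[OF filterlim_sequentially_not_bot[OF p] s] by (rule regime_ii_limits(2)[OF p s])
  next
    fix p :: "nat \<Rightarrow> nat \<times> real \<times> real" assume p: "filterlim p regime_iii_clt sequentially"
    show "weak_conv_m (\<lambda>k. fluctuation_law (\<lambda>n c R. c ^ 3 * R\<^sup>2 / (dimN n)\<^sup>2) \<alpha> \<psi> M a (p k))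
        (centered_normal (Theta2_iii \<alpha> \<psi> M a))"
      unfolding Theta2_iii_eq[OF filterlim_sequentially_not_bot[OF iii[OF p]]]
      by (rule regime_iii_limits(2)[OF iii[OF p] p])
  qed
qed

end
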